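(* Let $R:\mathbb{R}^n\to\mathbb{Z}^n$ be a quantizer, let $L\in\mathbb{R}^{n\times n}$ be nonsingular, and let $T=R\circ L:\mathbb{Z}^n\to\mathbb{Z}^n$. Suppose the matrix $L$ is iteratively nonresonant. For $N\in\mathbb{N}$ let $\nu_N(x)=\#T^{-N}(x)$, $x\in\mathbb{Z}^n$. Then the functions $$\widetilde{\nu}_N=|\det L|^N\nu_N:\mathbb{Z}^n\to\mathbb{R}_+$$ form a martingale with respect to the filtration $\{\mathcal{Q}_N^-\}_{N\ge1}$ in the sense that $$\mathbf{A}(\widetilde{\nu}_{N+1}\mathcal{I}_A)=\mathbf{A}(\widetilde{\nu}_N\mathcal{I}_A)\qquad\text{for all }N\in\mathbb{N},\ A\in\mathcal{Q}_N^-,$$ where $\mathcal{I}_A$ is the indicator function of $A$.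
   Context: Averages. For $a\in\mathbb{Z}^n$ and $\ell\in\mathbb{N}^n$ let $P_{a,\ell}=\{x\in\mathbb{Z}^n:\ a_k\le x_k<a_k+\ell_k \text{ for all }1\le k\le n\}$, and for $N\in\mathbb{N}$ let $\mathcal{P}_N=\{P_{a,\ell}:\ a\in\mathbb{Z}^n,\ \ell\in\mathbb{N}^n,\ \min_k\ell_k\ge N\}$. For a bounded function $f:\mathbb{Z}^n\to\mathbb{R}$ put $W(f,P)=\frac{1}{\#P}\sum_{x\in P}f(x)$, $\mathbf{A}_*(f)=\sup_{N\ge1}\inf_{P\in\mathcal{P}_N}W(f,P)$, $\mathbf{A}^*(f)=\inf_{N\ge1}\sup_{P\in\mathcal{P}_N}W(f,P)$. The function $f$ is averageable if these coincide, and the common value is the average value $\mathbf{A}(f)$. (Writing $\mathbf{A}(f)$ includes the assertion that $f$ is averageable.) System. A quantizer is a map $R:\mathbb{R}^n\to\mathbb{Z}^n$ such that $R(u+z)=R(u)+z$ for all $u\in\mathbb{R}^n$, $z\in\mathbb{Z}^n$, and the set $R^{-1}(0)$ is Jordan measurable (bounded with boundary of zero Lebesgue measure). $T^{-N}(x)=\{y\in\mathbb{Z}^n: T^N(y)=x\}$. Algebras. For $m\in\mathbb{N}$, $G\subset\mathbb{R}^m$ and $\Lambda\in\mathbb{R}^{m\times n}$ let $Q_m(G,\Lambda)=\{x\in\mathbb{Z}^n:\ \Lambda x\in G+\mathbb{Z}^m\}$ and $\mathcal{Q}_m(\Lambda)=\{Q_m(G,\Lambda):\ G\subset[0,1)^m\text{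 Jordan measurable}\}$. For $N\in\mathbb{N}$, $\mathcal{Q}_N^-=\mathcal{Q}_{Nn}(\mathcal{L}_N^-)$, where $\mathcal{L}_N^-\in\mathbb{R}^{Nn\times n}$ is obtained by stacking $L^{-N},\ldots,L^{-1}$. Nonresonance. $\Lambda\in\mathbb{R}^{m\times n}$ is nonresonant if the rows of $\begin{bmatrix}I_n\\ \Lambda\end{bmatrix}$ are linearly independent over the rationals. A nonsingular $L$ is iteratively nonresonant if every finite submatrix (formed from finitely many rows with distinct indices) of the infinite matrix obtained by stacking all nonzero integer powers $L^k$, $k\in\mathbb{Z}\setminus\{0\}$, is nonresonant. *)

theory Defs
  imports "HOL-Analysis.Analysis"
begin

definition real_vec :: "int ^ 'n \<Rightarrow> real ^ 'n" where
  "real_vec z = (\<chi> i. real_of_int (z $ i))"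


subsection \<open>Averages over the integer lattice\<close>

definition lattice_box :: "int ^ 'n \<Rightarrow> nat ^ 'n \<Rightarrow> (int ^ 'n) set" where
  "lattice_box a l = {x. \<forall>k. a $ k \<le> x $ k \<and> x $ k < a $ k + int (l $ k)}"

definition lattice_boxes :: "nat \<Rightarrow> (int ^ 'n) set set" where
  "lattice_boxes N = {lattice_box a l | a l. \<forall>k. N \<le> l $ k}"

definition box_average :: "(int ^ 'n \<Rightarrow> real) \<Rightarrow> (int ^ 'n) set \<Rightarrow> real" where
  "box_average f P = (\<Sum>x\<in>P. f x) / real (card P)"

text \<open>Suprema and infima are taken in the reals, so the two quantities below are meaningful
  only for bounded \<open>f\<close>; boundedness is therefore part of averageability.\<close>

definition lower_average :: "(int ^ 'n \<Rightarrow> real) \<Rightarrow> real" where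
  "lower_average f = (SUP N\<in>{1..}. INF P\<in>lattice_boxes N. box_average f P)"

definition upper_average :: "(int ^ 'n \<Rightarrow> real) \<Rightarrow> real" where
  "upper_average f = (INF N\<in>{1..}. SUP P\<in>lattice_boxes N. box_average f P)"

definition averageable :: "(int ^ 'n \<Rightarrow> real) \<Rightarrow> bool" where
  "averageable f \<longleftrightarrow> bounded (range f) \<and> lower_average f = upper_average f"

definition average :: "(int ^ 'n \<Rightarrow> real) \<Rightarrow> real" where
  "average f = lower_average f"


subsection \<open>Quantized linear systems\<close>

definition jordan_measurable :: "(real ^ 'n) set \<Rightarrow> bool" where
  "jordan_measurable S \<longleftrightarrow> bounded S \<and> negligible (frontier S)"

definition quantizer :: "(real ^ 'n \<Rightarrow> int ^ 'n) \<Rightarrow> bool" where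
  "quantizer R \<longleftrightarrow>
    (\<forall>u z. R (u + real_vec z) = R u + z) \<and> jordan_measurable (R -` {0})"

definition quantized_map ::
    "(real ^ 'n \<Rightarrow> int ^ 'n) \<Rightarrow> real ^ 'n ^ 'n \<Rightarrow> int ^ 'n \<Rightarrow> int ^ 'n" where
  "quantized_map R L x = R (L *v real_vec x)"

definition preimage_count :: "(int ^ 'n \<Rightarrow> int ^ 'n) \<Rightarrow> nat \<Rightarrow> int ^ 'n \<Rightarrow> nat" where
  "preimage_count T N x = card {y. (T ^^ N) y = x}"


subsection \<open>Integer powers of a matrix\<close>

text \<open>The overloaded power on \<open>real ^ 'n ^ 'n\<close> is entrywise, hence the explicit definition
  through the matrix product. Negative powers are meant for nonsingular matrices only.\<close>

definition matrix_pow :: "real ^ 'n ^ 'n \<Rightarrow> nat \<Rightarrow> real ^ 'n ^ 'n" where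
  "matrix_pow A k = (((**) A) ^^ k) (mat 1)"

definition matrix_powi :: "real ^ 'n ^ 'n \<Rightarrow> int \<Rightarrow> real ^ 'n ^ 'n" where
  "matrix_powi A k =
    (if 0 \<le> k then matrix_pow A (nat k) else matrix_pow (matrix_inv A) (nat (- k)))"


subsection \<open>Matrices with an arbitrary finite set of rows\<close>

text \<open>The number of rows of the matrices below varies, so a real matrix with \<open>n\<close> columns
  and rows indexed by a finite set \<open>I\<close> is represented by the family \<open>\<Lambda> :: 'i \<Rightarrow> real ^ 'n\<close>
  of its rows, considered on \<open>I\<close> only. Accordingly, \<open>m\<close>-dimensional Euclidean space becomes
  the set \<open>I \<rightarrow>\<^sub>E UNIV\<close> of extensional functions, \<open>m = card I\<close>, with its product topology and
  product Lebesgue measure. The frontier is closed, hence a Borel set, so no completion of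
  the measure is needed.\<close>

definition jordan_measurable_on :: "'i set \<Rightarrow> ('i \<Rightarrow> real) set \<Rightarrow> bool" where
  "jordan_measurable_on I G \<longleftrightarrow>
    G \<subseteq> (I \<rightarrow>\<^sub>E UNIV) \<and>
    (\<exists>B. \<forall>g\<in>G. \<forall>i\<in>I. \<bar>g i\<bar> \<le> B) \<and>
    (product_topology (\<lambda>_. euclideanreal) I) frontier_of G \<in> null_sets (\<Pi>\<^sub>M i\<in>I. lborel)"

definition quasiperiodic_set ::
    "'i set \<Rightarrow> ('i \<Rightarrow> real) set \<Rightarrow> ('i \<Rightarrow> real ^ 'n) \<Rightarrow> (int ^ 'n) set" where
  "quasiperiodic_set I G \<Lambda> =
    {x. \<exists>g\<in>G. \<exists>z :: 'i \<Rightarrow> int. \<forall>i\<in>I. \<Lambda> i \<bullet> real_vec x = g i + real_of_int (z i)}"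

definition quasiperiodic_algebra :: "'i set \<Rightarrow> ('i \<Rightarrow> real ^ 'n) \<Rightarrow> (int ^ 'n) set set" where
  "quasiperiodic_algebra I \<Lambda> =
    {quasiperiodic_set I G \<Lambda> | G. G \<subseteq> (I \<rightarrow>\<^sub>E {0..<1}) \<and> jordan_measurable_on I G}"

text \<open>Row \<open>(k, i)\<close> of the stacked matrix is row \<open>i\<close> of \<open>L\<^sup>k\<close>.\<close>

definition stacked_powers :: "real ^ 'n ^ 'n \<Rightarrow> int \<times> 'n \<Rightarrow> real ^ 'n" where
  "stacked_powers L = (\<lambda>(k, i). row i (matrix_powi L k))"

definition backward_algebra :: "real ^ 'n ^ 'n \<Rightarrow> nat \<Rightarrow> (int ^ 'n) set set" where
  "backward_algebra L N = quasiperiodic_algebra ({- int N .. - 1} \<times> UNIV) (stacked_powers L)"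


subsection \<open>Nonresonance\<close>

text \<open>Independence of a family: a vector occurring under two distinct indices makes the
  family dependent.\<close>

definition rat_independent :: "'j set \<Rightarrow> ('j \<Rightarrow> real ^ 'n) \<Rightarrow> bool" where
  "rat_independent J v \<longleftrightarrow>
    (\<forall>c :: 'j \<Rightarrow> rat. (\<Sum>j\<in>J. of_rat (c j) *\<^sub>R v j) = 0 \<longrightarrow> (\<forall>j\<in>J. c j = 0))"

definition nonresonant :: "'i set \<Rightarrow> ('i \<Rightarrow> real ^ 'n) \<Rightarrow> bool" where
  "nonresonant I \<Lambda> \<longleftrightarrow>
    rat_independent ((UNIV :: 'n set) <+> I) (case_sum (\<lambda>i. row i (mat 1)) \<Lambda>)"

definition iteratively_nonresonant :: "real ^ 'n ^ 'n \<Rightarrow> bool" where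
  "iteratively_nonresonant L \<longleftrightarrow>
    (\<forall>J. finite J \<and> J \<subseteq> (UNIV - {0}) \<times> UNIV \<longrightarrow> nonresonant J (stacked_powers L))"


subsection \<open>Finiteness of the preimages\<close>

lemma finite_bounded_int_vecs: "finite {y :: int ^ 'n. \<forall>i. \<bar>y $ i\<bar> \<le> b}"
proof (rule finite_subset)
  show "{y :: int ^ 'n. \<forall>i. \<bar>y $ i\<bar> \<le> b} \<subseteq> vec_lambda ` (UNIV \<rightarrow>\<^sub>E {- b..b})"
  proof
    fix y :: "int ^ 'n" assume "y \<in> {y. \<forall>i. \<bar>y $ i\<bar> \<le> b}"
    then have "vec_nth y \<in> UNIV \<rightarrow>\<^sub>E {- b..b}"
      by (auto simp: abs_le_iff minus_le_iff)
    then show "y \<in> vec_lambda ` (UNIV \<rightarrow>\<^sub>E {- b..b})"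
      by (metis image_eqI vec_nth_inverse)
  qed
qed (auto intro!: finite_imageI finite_PiE)

lemma finite_quantized_map_preimage:
  fixes L :: "real ^ 'n ^ 'n"
  assumes R: "quantizer R" and L: "det L \<noteq> 0"
  shows "finite {y. quantized_map R L y = x}"
proof -
  have inv: "matrix_inv L ** L = mat 1"
    using L unfolding matrix_inv_def invertible_det_nz[symmetric] invertible_def
    by (rule someI2_ex) simp
  let ?S = "(\<lambda>u. matrix_inv L *v (u + real_vec x)) ` (R -` {0})"
  have "bounded ((\<lambda>u. u + real_vec x) ` (R -` {0}))"
    using R bounded_translation[of "R -` {0}" "real_vec x"]
    by (simp add: quantizer_def jordan_measurable_def add.commute)
  then have "bounded ((*v) (matrix_inv L) ` (\<lambda>u. u + real_vec x) ` (R -` {0}))"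
    by (rule bounded_linear_image) (rule matrix_vector_mul_bounded_linear)
  then have "bounded ?S" by (simp add: image_image)
  then obtain B where B: "\<forall>v\<in>?S. norm v \<le> B"
    by (auto simp: bounded_iff)
  have "{y. quantized_map R L y = x} \<subseteq> {y. \<forall>i. \<bar>y $ i\<bar> \<le> \<lfloor>B\<rfloor>}"
  proof clarify
    fix y i assume x: "x = quantized_map R L y"
    let ?u = "L *v real_vec y + real_vec (- x)"
    have "R ?u = 0"
      using R x by (simp add: quantizer_def quantized_map_def)
    moreover have "real_vec (- x) = - real_vec x"
      by (simp add: real_vec_def vec_eq_iff)
    then have "matrix_inv L *v (?u + real_vec x) = real_vec y"
      by (simp add: matrix_vector_mul_assoc inv)
    ultimately have "real_vec y \<in> ?S" by (force intro: image_eqI[of _ _ ?u])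
    then have "norm (real_vec y) \<le> B" using B by blast
    then have "\<bar>real_vec y $ i\<bar> \<le> B" using component_le_norm_cart order_trans by blast
    then show "\<bar>y $ i\<bar> \<le> \<lfloor>B\<rfloor>" by (simp add: real_vec_def le_floor_iff)
  qed
  then show ?thesis using finite_bounded_int_vecs finite_subset by blast
qed

text \<open>In particular \<open>preimage_count\<close> never takes the default cardinality of an infinite set.\<close>

lemma finite_quantized_map_iterated_preimage:
  fixes L :: "real ^ 'n ^ 'n"
  assumes "quantizer R" and "det L \<noteq> 0"
  shows "finite {y. (quantized_map R L ^^ N) y = x}"
proof (induction N arbitrary: x)
  case (Suc N)
  have "{y. (quantized_map R L ^^ Suc N) y = x} =
      (\<Union>z\<in>{z. quantized_map R L z = x}. {y. (quantized_map R L ^^ N) y = z})"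
    by auto
  then show ?case
    using Suc finite_quantized_map_preimage[OF assms] by simp
qed simp

end

theory Submission
  imports Defs
begin

text \<open>A backward orbit \<open>y\<^sub>1, \<dots>, y\<^sub>N\<close> of \<open>x\<close> under \<open>T\<close> stays at bounded distance from
  \<open>L\<^sup>-\<^sup>1 x, \<dots>, L\<^sup>-\<^sup>N x\<close>, and which orbits occur depends on \<open>x\<close> only through the fractional parts
  of these vectors. So \<open>\<nu>\<^sub>N(x) = F\<^sub>N(\<theta>(x))\<close> for a bounded function \<open>F\<^sub>N\<close> on the \<open>N n\<close>-dimensional unit
  cube that is locally constant almost everywhere. By nonresonance the points \<open>\<theta>(x)\<close> are uniformly
  distributed along large boxes, hence averages are integrals over the cube. Integrating
  \<open>F\<^sub>N\<^sub>+\<^sub>1\<close> over the last \<open>n\<close> coordinates gives \<open>F\<^sub>N / \<bar>det L\<bar>\<close>: summed over all integer shifts, the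
  last step integrates to the volume of the preimage under \<open>L\<close> of a quantizer cell, and the cell has
  volume 1 because its integer translates tile the space.\<close>

subsection \<open>Averages as limits along large boxes\<close>

text \<open>Approximation is only ever carried out in one real variable. A box in the torus is a
  product of intervals, so equidistribution follows by exchanging the factors of a product of
  characters for general periodic functions one at a time. The rows of the identity belong to the
  nonresonance condition because a character is trivial on the lattice exactly when its frequency
  vector is integral.

  The obstacle is measurability. The cells of \<open>R\<close> and the set \<open>G\<close> have
  null frontiers but may fail to be Borel sets, so the function whose lattice averages are wanted
  may fail to be measurable. Averages are therefore taken of the original function and integrals of
  a measurable companion, built from \<open>borel_quantizer R\<close> and the interior of
  \<open>G\<close>. The two agree almost everywhere, and local constancy of the original almost
  everywhere ties its average to the integral of the companion. The companion quantizer has to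
  commute with integer translations exactly, since the volume of its cells and the count over
  integer shifts rest on that.\<close>

definition large_boxes :: "(int ^ 'n) set filter" where
  "large_boxes = (INF N. principal (lattice_boxes N))"

text \<open>The sup-inf and inf-sup of box averages become one limit along a filter, so limit laws
  apply. Values are vectors because the argument passes through complex exponentials.\<close>

definition has_average :: "(int ^ 'n \<Rightarrow> 'b::real_normed_vector) \<Rightarrow> 'b \<Rightarrow> bool" where
  "has_average f a \<longleftrightarrow> ((\<lambda>P. (\<Sum>x\<in>P. f x) /\<^sub>R real (card P)) \<longlongrightarrow> a) large_boxes"

lemma lattice_boxes_antimono: "M \<le> N \<Longrightarrow> lattice_boxes N \<subseteq> lattice_boxes M"
  unfolding lattice_boxes_def by (blast intro: order_trans)

text \<open>The families of boxes decrease in \<open>N\<close>, so finite infima of the principal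
  filters are dominated by another member. The restriction to positive \<open>N\<close> matches the
  index range in \<open>lower_average\<close> and \<open>upper_average\<close>.\<close>

lemma eventually_large_boxes:
  "eventually Q large_boxes \<longleftrightarrow> (\<exists>N\<ge>1. \<forall>P\<in>lattice_boxes N. Q P)"
proof -
  have "eventually Q large_boxes \<longleftrightarrow> (\<exists>N\<in>UNIV. eventually Q (principal (lattice_boxes N)))"
    unfolding large_boxes_def
  proof (rule eventually_INF_base)
    fix a b :: nat
    show "\<exists>x\<in>UNIV. principal (lattice_boxes x)
        \<le> inf (principal (lattice_boxes a)) (principal (lattice_boxes b))"
      using lattice_boxes_antimono[of a "max a b"] lattice_boxes_antimono[of b "max a b"]
      by (intro bexI[of _ "max a b"]) auto
  qed simp
  also have "\<dots> \<longleftrightarrow> (\<exists>N\<ge>1. \<forall>P\<in>lattice_boxes N. Q P)"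
  proof -
    have "\<exists>N\<ge>1. \<forall>P\<in>lattice_boxes N. Q P" if "\<forall>P\<in>lattice_boxes N. Q P" for N
      using that lattice_boxes_antimono[of N "Suc N"] by (intro exI[of _ "Suc N"]) auto
    then show ?thesis by (auto simp: eventually_principal)
  qed
  finally show ?thesis .
qed

text \<open>In terms of extensional functions the sum of a product over coordinates factors by
  \<open>prod_sum_PiE\<close>.\<close>

lemma sum_lattice_box:
  "(\<Sum>x\<in>lattice_box a l. f x) =
    (\<Sum>g\<in>PiE UNIV (\<lambda>k. {a $ k..<a $ k + int (l $ k)}). f (vec_lambda g))"
proof (rule sum.reindex_bij_witness[of _ vec_lambda vec_nth])
qed (auto simp: lattice_box_def)

lemma finite_lattice_box: "finite (lattice_box a l)"
proof -
  have "lattice_box a l \<subseteq> vec_lambda ` PiE UNIV (\<lambda>k. {a $ k..<a $ k + int (l $ k)})"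
    by (auto simp: lattice_box_def intro!: image_eqI[of x _ "vec_nth x" for x])
  then show ?thesis by (rule finite_subset) (auto intro!: finite_imageI finite_PiE)
qed

lemma card_lattice_box: "card (lattice_box a l) = (\<Prod>k\<in>UNIV. l $ k)"
proof -
  have "card (lattice_box a l) = card (PiE UNIV (\<lambda>k. {a $ k..<a $ k + int (l $ k)}))"
    using sum_lattice_box[of "\<lambda>_. 1::nat" a l] by simp
  then show ?thesis by (simp add: card_PiE)
qed

lemma eventually_large_boxes_card_pos: "eventually (\<lambda>P. finite P \<and> card P > 0) large_boxes"
  unfolding eventually_large_boxes
  \<comment> \<open>Side lengths of at least 1 exclude the empty box, whose average would be a
    division by zero.\<close>
  by (rule exI[of _ 1])
    (auto simp: lattice_boxes_def finite_lattice_box card_lattice_box Suc_le_eq intro!: prod_pos)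

lemma has_average_const: "has_average (\<lambda>_. c) c"
proof -
  have "eventually (\<lambda>P. c = (\<Sum>x\<in>P. c) /\<^sub>R real (card P)) large_boxes"
    using eventually_large_boxes_card_pos
    by eventually_elim (auto simp: sum_constant_scaleR card_gt_0_iff)
  then show ?thesis unfolding has_average_def
    by (rule Lim_transform_eventually[OF tendsto_const])
qed

lemma has_average_add:
  "has_average f a \<Longrightarrow> has_average g b \<Longrightarrow> has_average (\<lambda>x. f x + g x) (a + b)"
  unfolding has_average_def sum.distrib scaleR_add_right by (rule tendsto_add)

lemma has_average_bounded_linear:
  assumes "bounded_linear h" "has_average f a"
  shows "has_average (\<lambda>x. h (f x)) (h a)"
proof -
  interpret bounded_linear h by fact
  show ?thesis
    using tendsto[of "\<lambda>P. (\<Sum>x\<in>P. f x) /\<^sub>R real (card P)" a large_boxes] assms(2)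
    by (simp add: has_average_def scaleR sum)
qed

lemma has_average_mult_left:
  fixes f :: "_ \<Rightarrow> 'b::real_normed_algebra"
  shows "has_average f a \<Longrightarrow> has_average (\<lambda>x. c * f x) (c * a)"
  by (rule has_average_bounded_linear[OF bounded_linear_mult_right])

lemma has_average_sum:
  assumes "finite S" "\<And>s. s \<in> S \<Longrightarrow> has_average (f s) (a s)"
  shows "has_average (\<lambda>x. \<Sum>s\<in>S. f s x) (\<Sum>s\<in>S. a s)"
  using assms
proof (induction S rule: finite_induct)
  case empty show ?case using has_average_const[of 0] by simp
next
  case (insert s S) then show ?case by (simp add: has_average_add)
qed

text \<open>The error is controlled by a majorant with small mean rather than uniformly. This is
  what allows discontinuous functions to be approximated by continuous ones and by step
  functions.\<close>

lemma has_average_approx: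
  assumes "\<And>e. e > 0 \<Longrightarrow> \<exists>f' a' q m. has_average f' a' \<and> has_average q m \<and>
    norm (a - a') < e \<and> m < e \<and> (\<forall>x. norm (f x - f' x) \<le> q x)"
  shows "has_average f a"
  unfolding has_average_def
proof (rule tendstoI)
  fix e :: real assume "e > 0"
  \<comment> \<open>The mean of \<open>q\<close> over a large box is within e/4 of \<open>m\<close>,
    itself below e/4, so replacing \<open>f\<close> by \<open>f'\<close> costs less than e/2. The
    other two quarters pay for the average of \<open>f'\<close> and for the distance from
    \<open>a'\<close> to \<open>a\<close>.\<close>
  then obtain f' a' q m where *: "has_average f' a'" "has_average q m"
    "norm (a - a') < e / 4" "m < e / 4" "\<And>x. norm (f x - f' x) \<le> q x"
    using assms[of "e / 4"] by auto
  let ?m = "\<lambda>f P. (\<Sum>x\<in>P. f x) /\<^sub>R real (card P)"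
  have "eventually (\<lambda>P. dist (?m f' P) a' < e / 4) large_boxes"
    using *(1) \<open>e > 0\<close> unfolding has_average_def by (intro tendstoD) auto
  moreover have "eventually (\<lambda>P. dist (?m q P) m < e / 4) large_boxes"
    using *(2) \<open>e > 0\<close> unfolding has_average_def by (intro tendstoD) auto
  ultimately show "eventually (\<lambda>P. dist (?m f P) a < e) large_boxes"
  proof eventually_elim
    case (elim P)
    have "norm (?m f P - ?m f' P) = norm (\<Sum>x\<in>P. f x - f' x) / real (card P)"
      by (simp add: sum_subtractf divide_inverse flip: scaleR_diff_right)
    also have "\<dots> \<le> (\<Sum>x\<in>P. q x) / real (card P)"
      by (intro divide_right_mono sum_norm_le *) auto
    also have "\<dots> = ?m q P" by (simp add: divide_inverse_commute)
    finally have "norm (?m f P - ?m f' P) \<le> ?m q P" .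
    moreover have "norm (?m f P - a) \<le> norm (?m f P - ?m f' P) + norm (?m f' P - a') + norm (a' - a)"
      using norm_triangle_ineq[of "?m f P - ?m f' P" "?m f' P - a'"]
        norm_triangle_ineq[of "?m f P - a'" "a' - a"] by simp
    moreover have "norm (a' - a) < e / 4" using *(3) by (simp add: norm_minus_commute)
    moreover have "?m q P < e / 2" using abs_le_D1[OF order.strict_implies_order[OF elim(2)[unfolded dist_real_def]]] *(4) by linarith
    ultimately show ?case using elim(1) by (simp add: dist_norm)
  qed
qed

text \<open>Any lower bound at level \<open>M\<close> is below any upper bound at level
  \<open>N\<close>, since boxes large enough for both levels exist; convergence pushes both towards
  \<open>a\<close>. The bound \<open>B\<close> keeps all suprema and infima genuine real
  numbers.\<close>

lemma has_average_imp_average: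
  fixes f :: "int ^ 'n \<Rightarrow> real"
  assumes f: "has_average f a" and B: "\<And>x. \<bar>f x\<bar> \<le> B"
  shows "averageable f" "average f = a"
proof -
  have B0: "0 \<le> B" using B[of 0] by linarith
  have W: "\<bar>box_average f P\<bar> \<le> B" for P
  proof (cases "card P = 0")
    case False
    have "\<bar>\<Sum>x\<in>P. f x\<bar> \<le> real (card P) * B"
      using B sum_norm_bound[of P f B] by simp
    then show ?thesis using False by (simp add: box_average_def divide_le_eq mult.commute)
  qed (simp add: box_average_def B0)
  then have W': "box_average f P \<le> B" "- B \<le> box_average f P" for P
    by (auto simp: abs_le_iff minus_le_iff)
  have ne: "lattice_boxes N \<noteq> {}" for N
    by (auto simp: lattice_boxes_def intro!: exI[of _ "\<chi> k. N"])
  have bl: "bdd_below (box_average f ` X)" and bu: "bdd_above (box_average f ` X)" for X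
    using W' by (auto intro!: bdd_belowI[of _ "- B"] bdd_aboveI[of _ B])
  define lo where "lo N = (INF P\<in>lattice_boxes N. box_average f P)" for N
  define up where "up N = (SUP P\<in>lattice_boxes N. box_average f P)" for N
  have lo: "- B \<le> lo N" "lo N \<le> B" and up: "- B \<le> up N" "up N \<le> B" for N
  proof -
    obtain P :: "(int ^ 'n) set" where P: "P \<in> lattice_boxes N" using ne by blast
    show "- B \<le> lo N" unfolding lo_def using ne W' by (intro cINF_greatest) auto
    show "up N \<le> B" unfolding up_def using ne W' by (intro cSUP_least) auto
    show "lo N \<le> B" unfolding lo_def using P W' by (intro cINF_lower2[OF bl P])
    show "- B \<le> up N" unfolding up_def using P W' by (intro cSUP_upper2[OF bu P])
  qed
  have lo_up: "lo M \<le> up N" for M N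
  proof -
    obtain P :: "(int ^ 'n) set" where P: "P \<in> lattice_boxes (max M N)" using ne by blast
    then have "P \<in> lattice_boxes M" "P \<in> lattice_boxes N"
      using lattice_boxes_antimono[of M "max M N"] lattice_boxes_antimono[of N "max M N"] by auto
    then have "lo M \<le> box_average f P" "box_average f P \<le> up N"
      unfolding lo_def up_def using bl bu by (auto intro: cINF_lower cSUP_upper)
    then show ?thesis by linarith
  qed
  have near: "\<exists>N\<ge>1. a - e \<le> lo N \<and> up N \<le> a + e" if "e > 0" for e
  proof -
    have "eventually (\<lambda>P. dist (box_average f P) a < e) large_boxes"
      using f that unfolding has_average_def box_average_def
      by (auto dest!: tendstoD[of _ _ _ e] simp: divide_inverse_commute)
    then obtain N where N: "N \<ge> 1" "\<And>P. P \<in> lattice_boxes N \<Longrightarrow> dist (box_average f P) a < e"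
      unfolding eventually_large_boxes by blast
    have "a - e \<le> lo N" unfolding lo_def using N(2) ne
      by (intro cINF_greatest) (auto simp: dist_real_def abs_less_iff, smt (verit))
    moreover have "up N \<le> a + e" unfolding up_def using N(2) ne
      by (intro cSUP_least) (auto simp: dist_real_def abs_less_iff, smt (verit))
    ultimately show ?thesis using N(1) by blast
  qed
  have bdl: "bdd_above (lo ` {1..})" and bdu: "bdd_below (up ` {1..})"
    using lo up by (auto intro!: bdd_aboveI[of _ B] bdd_belowI[of _ "- B"])
  have L: "lower_average f = (SUP N\<in>{1..}. lo N)" and U: "upper_average f = (INF N\<in>{1..}. up N)"
    by (simp_all add: lower_average_def upper_average_def lo_def up_def)
  have LU: "lower_average f \<le> upper_average f"
    unfolding L U by (intro cSUP_least cINF_greatest lo_up) auto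
  have a1: "a \<le> lower_average f"
  proof (rule field_le_epsilon)
    fix e :: real assume "e > 0"
    then obtain N where "N \<ge> 1" "a - e \<le> lo N" using near by blast
    then show "a \<le> lower_average f + e"
      using cSUP_upper[OF _ bdl, of N] unfolding L by simp
  qed
  have a2: "upper_average f \<le> a"
  proof (rule field_le_epsilon)
    fix e :: real assume "e > 0"
    then obtain N where "N \<ge> 1" "up N \<le> a + e" using near by blast
    then show "upper_average f \<le> a + e"
      using cINF_lower[OF bdu, of N] unfolding U by simp
  qed
  show "average f = a" using LU a1 a2 by (simp add: average_def)
  have "bounded (range f)" using B by (auto simp: bounded_iff)
  then show "averageable f" using LU a1 a2 by (simp add: averageable_def)
qed

subsection \<open>Exponential sums\<close>

lemma cis_sum: "cis (\<Sum>i\<in>A. f i) = (\<Prod>i\<in>A. cis (f i))"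
  by (induction A rule: infinite_finite_induct) (simp_all flip: cis_mult)

text \<open>The exponential sum over a box is a product of geometric sums. The one in direction
  \<open>k\<close> has ratio different from 1, hence is bounded independently of its length, while
  each other factor is at most the side length. Dividing by the volume leaves at most
  \<open>C / l $ k\<close>.\<close>

lemma has_average_cis:
  fixes v :: "real ^ 'n"
  assumes "v $ k \<notin> \<int>"
  shows "has_average (\<lambda>x. cis (2 * pi * (v \<bullet> real_vec x))) 0"
proof -
  define z where "z j = cis (2 * pi * v $ j)" for j
  define g where "g j t = cis (2 * pi * v $ j * of_int t)" for j t
  have g_add: "g j (t + 1) = z j * g j t" for j t
    by (simp add: g_def z_def cis_mult algebra_simps)
  have z1: "z k \<noteq> 1"
  proof
    assume "z k = 1"
    then have "cos (2 * pi * v $ k) = 1" by (simp add: z_def complex_eq_iff)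
    then obtain m where "2 * pi * v $ k = of_int m * 2 * pi"
      using cos_one_2pi_int by auto
    then have "v $ k = of_int m" by simp
    then show False using assms by simp
  qed
  have tele: "(1 - z j) * (\<Sum>t\<in>{a..<a + int m}. g j t) = g j a - g j (a + int m)" for j a m
  proof (induction m)
    case (Suc m)
    have "{a..<a + int (Suc m)} = insert (a + int m) {a..<a + int m}" by auto
    then show ?case using Suc g_add[of j "a + int m"] by (simp add: distrib_left) (simp add: algebra_simps)
  qed simp
  define C where "C = 2 / norm (1 - z k)"
  have C: "norm (\<Sum>t\<in>{a..<a + int m}. g k t) \<le> C" for a m
  proof -
    have "norm (1 - z k) * norm (\<Sum>t\<in>{a..<a + int m}. g k t) = norm (g k a - g k (a + int m))"
      by (simp flip: norm_mult add: tele)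
    also have "\<dots> \<le> 2" by (rule order_trans[OF norm_triangle_ineq4]) (simp add: g_def)
    finally show ?thesis using z1 by (simp add: C_def field_simps)
  qed
  have C0: "C > 0" using z1 by (simp add: C_def)
  have box: "norm ((\<Sum>x\<in>lattice_box a l. cis (2 * pi * (v \<bullet> real_vec x))) /\<^sub>R
      real (card (lattice_box a l))) \<le> C / l $ k" (is "?L \<le> _") if "\<forall>j. l $ j > 0" for a l
  proof -
    have "(\<Sum>x\<in>lattice_box a l. cis (2 * pi * (v \<bullet> real_vec x))) =
        (\<Sum>f\<in>PiE UNIV (\<lambda>j. {a $ j..<a $ j + int (l $ j)}). \<Prod>j\<in>UNIV. g j (f j))"
      unfolding sum_lattice_box
      by (intro sum.cong refl)
        (simp add: g_def inner_vec_def real_vec_def sum_distrib_left cis_sum mult.assoc)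
    also have "\<dots> = (\<Prod>j\<in>UNIV. \<Sum>t\<in>{a $ j..<a $ j + int (l $ j)}. g j t)"
      by (rule prod_sum_PiE[symmetric]) auto
    finally have "?L = (\<Prod>j\<in>UNIV. norm (\<Sum>t\<in>{a $ j..<a $ j + int (l $ j)}. g j t) / l $ j)"
      by (simp add: card_lattice_box prod_dividef norm_mult abs_prod flip: prod_norm)
        (simp add: field_simps)
    also have "\<dots> \<le> (\<Prod>j\<in>UNIV. if j = k then C / l $ k else 1)"
    proof (rule prod_mono, safe)
      fix j
      have "norm (\<Sum>t\<in>{a $ j..<a $ j + int (l $ j)}. g j t) \<le> l $ j"
        by (rule order_trans[OF norm_sum]) (simp add: g_def)
      then show "norm (\<Sum>t\<in>{a $ j..<a $ j + int (l $ j)}. g j t) / l $ j \<le>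
          (if j = k then C / l $ k else 1)"
        using that C by (auto intro!: divide_right_mono simp: divide_le_eq)
    qed auto
    also have "\<dots> = C / l $ k" by simp
    finally show ?thesis .
  qed
  show ?thesis unfolding has_average_def
  proof (rule tendstoI)
    fix e :: real assume "e > 0"
    define N where "N = nat \<lceil>C / e\<rceil> + 1"
    have N: "C / e < N" "N \<ge> 1" unfolding N_def by linarith+
    have "C / l < e" if "N \<le> l" for l :: nat
    proof -
      have "C / e < l" using N that by linarith
      then show ?thesis using \<open>e > 0\<close> N that by (simp add: field_simps)
    qed
    then show "eventually (\<lambda>P. dist ((\<Sum>x\<in>P. cis (2 * pi * (v \<bullet> real_vec x))) /\<^sub>R real (card P)) 0 < e) large_boxes"
      unfolding eventually_large_boxes lattice_boxes_def using N(2) box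
      by (intro exI[of _ N]) (auto simp del: norm_scaleR intro!: le_less_trans[OF box] simp: Suc_le_eq intro: less_le_trans)
  qed
qed

subsection \<open>Mean values of periodic functions\<close>

text \<open>The second argument plays the role of the integral over a period. An inductive predicate
  is used so that averaging statements follow by rule induction, one limit law per rule. The
  majorant in \<open>approx\<close> must itself have a mean, as in Riemann integration.\<close>

inductive torus_mean :: "(real \<Rightarrow> complex) \<Rightarrow> complex \<Rightarrow> bool" where
  character: "torus_mean (\<lambda>t. cis (2 * pi * (of_int h * t))) (if h = 0 then 1 else 0)"
| add: "torus_mean f a \<Longrightarrow> torus_mean g b \<Longrightarrow> torus_mean (\<lambda>t. f t + g t) (a + b)"
| scale: "torus_mean f a \<Longrightarrow> torus_mean (\<lambda>t. c * f t) (c * a)"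
| approx: "(\<And>e::real. e > 0 \<Longrightarrow> \<exists>f b q m. torus_mean f b \<and>
      torus_mean (\<lambda>t. complex_of_real (q t)) (of_real m) \<and>
      norm (a - b) < e \<and> m < e \<and> (\<forall>t. norm (g t - f t) \<le> q t)) \<Longrightarrow> torus_mean g a"

lemma torus_mean_bounded: "torus_mean g m \<Longrightarrow> \<exists>C. \<forall>t. norm (g t) \<le> C"
proof (induction rule: torus_mean.induct)
  case (add f a g b)
  then show ?case by (meson add_mono norm_triangle_le)
next
  case (scale f a c)
  then obtain C where "\<forall>t. norm (f t) \<le> C" by blast
  then have "\<forall>t. norm (c * f t) \<le> norm c * C" by (simp add: norm_mult mult_left_mono)
  then show ?case by blast
next
  case (approx a g)
  obtain f q C D where *: "\<forall>t. norm (f t) \<le> C" "\<forall>t. norm (complex_of_real (q t)) \<le> D"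
    "\<forall>t. norm (g t - f t) \<le> q t"
    using approx(1)[of 1] by auto
  have "norm (g t) \<le> C + D" for t
    using norm_triangle_ineq[of "f t" "g t - f t"] *(1,3)[rule_format, of t] *(2)[rule_format, of t] by simp
  then show ?case by blast
qed (auto intro: exI[of _ 1])

text \<open>It suffices to test against characters. Both conclusions are proved in one induction
  because the approximation rule bounds the error of the weighted function by \<open>C * q\<close>,
  whose unweighted average must then be available.\<close>

lemma has_average_torus_mean:
  fixes s :: "int ^ 'n \<Rightarrow> real"
  assumes g: "torus_mean g m"
    and char: "\<And>h::int. has_average (\<lambda>x. cis (2 * pi * (of_int h * s x))) (if h = 0 then 1 else 0)"
    and \<Psi>char: "\<And>h::int. has_average (\<lambda>x. \<Psi> x * cis (2 * pi * (of_int h * s x))) (A * (if h = 0 then 1 else 0))"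
    and \<Psi>: "\<And>x. norm (\<Psi> x) \<le> C"
  shows "has_average (\<lambda>x. g (s x)) m \<and> has_average (\<lambda>x. \<Psi> x * g (s x)) (A * m)"
  using g
proof (induction rule: torus_mean.induct)
  case (character h)
  show ?case using char[of h] \<Psi>char[of h] by simp
next
  case (add f a g b)
  then show ?case using has_average_add[of "\<lambda>x. f (s x)" a] has_average_add[of "\<lambda>x. \<Psi> x * f (s x)" "A * a"]
    by (simp add: distrib_left)
next
  case (scale f a c)
  then show ?case using has_average_mult_left[of "\<lambda>x. f (s x)" a c]
      has_average_mult_left[of "\<lambda>x. \<Psi> x * f (s x)" "A * a" c]
    by (simp add: mult.left_commute)
next
  case (approx a g)
  have C0: "0 \<le> C" using \<Psi>[of 0] norm_ge_zero order_trans by blast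
  have Re: "has_average q m" if "has_average (\<lambda>x. complex_of_real (q x)) (of_real m)"
    for q :: "int ^ 'n \<Rightarrow> real" and m
    using has_average_bounded_linear[OF bounded_linear_Re that] by simp
  have "has_average (\<lambda>x. g (s x)) a"
  proof (rule has_average_approx)
    fix e :: real assume "e > 0"
    then obtain f b q m where "has_average (\<lambda>x. f (s x)) b" "has_average (\<lambda>x. complex_of_real (q (s x))) (of_real m)"
      "norm (a - b) < e" "m < e" "\<forall>t. norm (g t - f t) \<le> q t"
      using approx(1)[of e] by auto
    then show "\<exists>f' a' q m. has_average f' a' \<and> has_average q m \<and> norm (a - a') < e \<and> m < e \<and>
        (\<forall>x. norm (g (s x) - f' x) \<le> q x)"
      using Re by (intro exI[of _ "\<lambda>x. f (s x)"] exI[of _ b] exI[of _ "\<lambda>x. q (s x)"] exI[of _ m]) auto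
  qed
  moreover have "has_average (\<lambda>x. \<Psi> x * g (s x)) (A * a)"
  proof (rule has_average_approx)
    fix e :: real assume e: "e > 0"
    \<comment> \<open>Dividing the tolerance by this constant keeps both \<open>norm A\<close> and
      \<open>C\<close> times it below \<open>e\<close>.\<close>
    define D where "D = 1 + C + norm A"
    have D: "D > 0" using C0 by (simp add: D_def add_pos_nonneg)
    obtain f b q m where *: "has_average (\<lambda>x. \<Psi> x * f (s x)) (A * b)"
      "has_average (\<lambda>x. complex_of_real (q (s x))) (of_real m)"
      "norm (a - b) < e / D" "m < e / D" "\<forall>t. norm (g t - f t) \<le> q t"
      using approx(1)[of "e / D"] e D by auto
    have "norm (A * a - A * b) \<le> norm A * (e / D)"
      using *(3) mult_left_mono[of "norm (a - b)" "e / D" "norm A"]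
      by (simp add: norm_mult flip: right_diff_distrib)
    also have "\<dots> < e" using D e C0 by (simp add: D_def field_simps add_pos_nonneg)
    finally have 1: "norm (A * a - A * b) < e" .
    have "C * m \<le> C * (e / D)" by (rule mult_left_mono) (use *(4) C0 in auto)
    also have "\<dots> < e" using D e C0 by (simp add: D_def field_simps add_pos_nonneg)
    finally have 2: "C * m < e" .
    have 3: "norm (\<Psi> x * g (s x) - \<Psi> x * f (s x)) \<le> C * q (s x)" for x
      using *(5) \<Psi>[of x] C0
      by (simp add: norm_mult mult_mono flip: right_diff_distrib)
    show "\<exists>f' a' q m. has_average f' a' \<and> has_average q m \<and> norm (A * a - a') < e \<and> m < e \<and>
        (\<forall>x. norm (\<Psi> x * g (s x) - f' x) \<le> q x)"
      using *(1) has_average_mult_left[OF Re[OF *(2)], of C] 1 2 3 by blast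
  qed
  ultimately show ?case by blast
qed

section \<open>Trigonometric polynomials: the mean equals the integral over a period\<close>

lemma has_integral_character:
  "((\<lambda>t. cis (2 * pi * (of_int h * t))) has_integral (if h = 0 then 1 else 0)) {0..1::real}"
proof (cases "h = 0")
  case True
  then show ?thesis using has_integral_const_real[of "1::complex" 0 1] by simp
next
  case False
  define w where "w = \<i> * (2 * pi * of_int h)"
  have w: "w \<noteq> 0" using False by (simp add: w_def)
  have "((\<lambda>t. exp (w * of_real t)) has_integral (exp (w * of_real 1) / w - exp (w * of_real 0) / w)) {0..1}"
  proof (rule fundamental_theorem_of_calculus)
    fix t :: real
    have "((\<lambda>z. exp (w * z) / w) has_field_derivative exp (w * of_real t)) (at (of_real t))"
      using w by (auto intro!: derivative_eq_intros)
    then show "((\<lambda>t. exp (w * of_real t) / w) has_vector_derivative exp (w * of_real t)) (at t within {0..1})"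
      by (rule has_vector_derivative_real_field)
  qed simp
  moreover have "exp w = 1"
    unfolding w_def by (subst exp_eq_1) (auto intro!: exI[of _ h])
  moreover have "exp (w * of_real t) = cis (2 * pi * (of_int h * t))" for t
    by (simp add: w_def cis_conv_exp algebra_simps)
  ultimately show ?thesis using False by simp
qed

text \<open>The same \<open>m\<close> serves both claims, so means of trigonometric polynomials can
  later be estimated by comparing integrals.\<close>

lemma torus_mean_sum_character:
  assumes "finite S"
  shows "\<exists>m. torus_mean (\<lambda>t. \<Sum>s\<in>S. c s * cis (2 * pi * (of_int (h s) * t))) m \<and>
    ((\<lambda>t. \<Sum>s\<in>S. c s * cis (2 * pi * (of_int (h s) * t))) has_integral m) {0..1}"
  using assms
proof (induction S rule: finite_induct)
  case empty
  have "torus_mean (\<lambda>t. 0) 0" using torus_mean.scale[OF torus_mean.character[of 0], of 0] by simp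
  then show ?case by (auto intro!: exI[of _ 0])
next
  case (insert s S)
  let ?m = "c s * (if h s = 0 then 1 else 0)"
  have "((\<lambda>t. c s * cis (2 * pi * (of_int (h s) * t))) has_integral ?m) {0..1}"
    by (rule has_integral_mult_right) (rule has_integral_character)
  moreover have "torus_mean (\<lambda>t. c s * cis (2 * pi * (of_int (h s) * t))) ?m"
    by (rule torus_mean.scale) (rule torus_mean.character)
  moreover obtain m where "torus_mean (\<lambda>t. \<Sum>s\<in>S. c s * cis (2 * pi * (of_int (h s) * t))) m"
    "((\<lambda>t. \<Sum>s\<in>S. c s * cis (2 * pi * (of_int (h s) * t))) has_integral m) {0..1}"
    using insert.IH by blast
  ultimately show ?case
    unfolding sum.insert[OF insert.hyps]
    by (intro exI[of _ "?m + m"] conjI torus_mean.add has_integral_add)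
qed

text \<open>Writing the cosine as half the sum of two conjugate exponentials, the binomial theorem
  expands each of its powers into characters; the shift by \<open>c\<close> only changes the
  coefficients.\<close>

lemma torus_mean_polynomial_cos:
  assumes "real_polynomial_function p"
  shows "\<exists>m. torus_mean (\<lambda>t. of_real (p (cos (2 * pi * (t - c))))) (of_real m) \<and>
    ((\<lambda>t. p (cos (2 * pi * (t - c)))) has_integral m) {0..1}"
proof -
  obtain a n where p: "\<And>s. p s = (\<Sum>i\<le>n. a i * s ^ i)"
    using assms unfolding real_polynomial_function_iff_sum by metis
  have cos_power: "complex_of_real (cos (2 * pi * (t - c)) ^ i) =
    (\<Sum>k\<le>i. (of_nat (i choose k) / 2 ^ i * cis (- 2 * pi * (of_int (2 * int k - int i) * c))) *
      cis (2 * pi * (of_int (2 * int k - int i) * t)))" for t i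
  proof -
    define \<alpha> where "\<alpha> = 2 * pi * (t - c)"
    have "complex_of_real (cos \<alpha> ^ i) = ((cis \<alpha> + cis (- \<alpha>)) / 2) ^ i"
      by (simp add: complex_eq_iff[of "cis \<alpha> + cis (- \<alpha>)" "2 * complex_of_real (cos \<alpha>)"] field_simps
          del: of_real_power)
        (simp add: complex_eq_iff)
    also have "\<dots> = (\<Sum>k\<le>i. of_nat (i choose k) * cis \<alpha> ^ k * cis (- \<alpha>) ^ (i - k)) / 2 ^ i"
      by (simp add: power_divide binomial_ring)
    also have "\<dots> = (\<Sum>k\<le>i. of_nat (i choose k) / 2 ^ i * (cis \<alpha> ^ k * cis (- \<alpha>) ^ (i - k)))"
      by (simp add: sum_divide_distrib mult.assoc)
    also have "\<dots> = (\<Sum>k\<le>i. (of_nat (i choose k) / 2 ^ i * cis (- 2 * pi * (of_int (2 * int k - int i) * c))) *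
      cis (2 * pi * (of_int (2 * int k - int i) * t)))"
    proof (rule sum.cong[OF refl])
      fix k assume "k \<in> {..i}"
      then have "cis \<alpha> ^ k * cis (- \<alpha>) ^ (i - k) = cis (- 2 * pi * (of_int (2 * int k - int i) * c)) *
        cis (2 * pi * (of_int (2 * int k - int i) * t))"
        unfolding Complex.DeMoivre cis_mult by (simp add: \<alpha>_def of_nat_diff algebra_simps)
      then show "of_nat (i choose k) / 2 ^ i * (cis \<alpha> ^ k * cis (- \<alpha>) ^ (i - k)) =
        (of_nat (i choose k) / 2 ^ i * cis (- 2 * pi * (of_int (2 * int k - int i) * c))) *
        cis (2 * pi * (of_int (2 * int k - int i) * t))" by (simp add: mult.assoc)
    qed
    finally show ?thesis by (simp add: \<alpha>_def)
  qed
  let ?S = "SIGMA i:{..n}. {..i}"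
  have eq: "(\<lambda>t. complex_of_real (p (cos (2 * pi * (t - c))))) =
    (\<lambda>t. \<Sum>s\<in>?S. (of_real (a (fst s)) * (of_nat (fst s choose snd s) / 2 ^ fst s *
        cis (- 2 * pi * (of_int (2 * int (snd s) - int (fst s)) * c)))) *
      cis (2 * pi * (of_int (2 * int (snd s) - int (fst s)) * t)))" (is "?f = _")
    unfolding p of_real_sum of_real_mult cos_power
    by (simp add: sum_distrib_left sum.Sigma case_prod_unfold mult.assoc del: of_real_power)
  obtain M where M: "torus_mean ?f M" "(?f has_integral M) {0..1}"
    unfolding eq using torus_mean_sum_character[of ?S
        "\<lambda>s. of_real (a (fst s)) * (of_nat (fst s choose snd s) / 2 ^ fst s *
          cis (- 2 * pi * (of_int (2 * int (snd s) - int (fst s)) * c)))"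
        "\<lambda>s. 2 * int (snd s) - int (fst s)"] by auto
  \<comment> \<open>The mean \<open>M\<close> is so far complex; it is real because it is the
    integral of a real function.\<close>
  have "((Re \<circ> ?f) has_integral Re M) {0..1}"
    by (rule has_integral_linear[OF M(2) bounded_linear_Re])
  then have Re: "((\<lambda>t. p (cos (2 * pi * (t - c)))) has_integral Re M) {0..1}" by (simp add: o_def)
  have "((complex_of_real \<circ> (\<lambda>t. p (cos (2 * pi * (t - c))))) has_integral of_real (Re M)) {0..1}"
    by (rule has_integral_linear[OF Re bounded_linear_of_real])
  then have "M = of_real (Re M)" using M(2) by (simp add: o_def has_integral_unique)
  then show ?thesis using Re M(1) by metis
qed


lemma has_integral_indicator_frac:
  assumes "0 \<le> a" "a < b" "b \<le> 1"
  shows "((\<lambda>t. indicator {a..<b} (frac t)) has_integral (b - a)) {0..1::real}"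
proof -
  have "((\<lambda>_. 1::real) has_integral (b - a)) {a..b}"
    using has_integral_const_real[of "1::real" a b] assms by simp
  then have "((\<lambda>t. if t \<in> {a..b} then 1 else 0::real) has_integral (b - a)) {0..1}"
    using assms by (subst has_integral_restrict) auto
  \<comment> \<open>The two functions differ at most at \<open>b\<close>, where one interval is
    closed and the other open, and at 1, where \<open>frac\<close> wraps to 0.\<close>
  then show ?thesis
  proof (rule has_integral_spike_finite[where S = "{b, 1}", rotated 2])
    fix t :: real assume "t \<in> {0..1} - {b, 1}"
    then show "indicator {a..<b} (frac t) = (if t \<in> {a..b} then 1 else 0::real)"
      by (auto simp: frac_eq[THEN iffD2] indicator_def)
  qed simp
qed

text \<open>An interval modulo 1 is the set where the cosine centred at its midpoint exceeds its
  value at the end points. So Weierstrass approximation in the single variable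
  \<open>cos (2 * pi * (t - c))\<close> suffices.\<close>

lemma torus_mean_interval:
  assumes ab: "0 \<le> a" "a < b" "b \<le> 1"
  shows "torus_mean (\<lambda>t. of_real (indicator {a..<b} (frac t))) (of_real (b - a))"
proof (rule torus_mean.approx)
  fix e :: real assume e: "e > 0"
  define c where "c = (a + b) / 2"
  define r where "r = cos (pi * (b - a))"
  define s where "s t = cos (2 * pi * (t - c))" for t
  \<comment> \<open>\<open>ramp k\<close> is a continuous substitute for the indicator of x > r,
    rising from 0 to 1 between r and r + 1/k. \<open>tent k\<close> is 1 up to distance 1/k from r
    and vanishes from distance 2/k on, so it dominates the error.\<close>
  define tent where "tent k x = max 0 (min 1 (2 - k * \<bar>x - r\<bar>))" for k x :: real
  define ramp where "ramp k x = max 0 (min 1 (k * (x - r)))" for k x :: real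
  have s_frac: "s (frac t) = s t" for t
  proof -
    have "2 * pi * (frac t - c) = 2 * pi * (t - c) - (2 * pi) * of_int \<lfloor>t\<rfloor>"
      by (simp add: frac_def algebra_simps)
    then show ?thesis unfolding s_def by (simp only: cos_diff cos_int_2pin sin_int_2pin)
  qed
  have s_abs: "s t = cos (2 * pi * \<bar>t - c\<bar>)" for t
    unfolding s_def by (cases "t \<ge> c") (simp_all, metis cos_minus minus_diff_eq mult_minus_right)
  have inside: "r \<le> s t" "t \<noteq> a \<Longrightarrow> r < s t" if "t \<in> {a..<b}" for t
  proof -
    have *: "\<bar>t - c\<bar> \<le> (b - a) / 2" "t \<noteq> a \<Longrightarrow> \<bar>t - c\<bar> < (b - a) / 2"
      using that unfolding c_def by (auto simp: abs_le_iff abs_less_iff field_simps)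
    have "2 * pi * \<bar>t - c\<bar> \<le> 2 * pi * ((b - a) / 2)"
      "t \<noteq> a \<Longrightarrow> 2 * pi * \<bar>t - c\<bar> < 2 * pi * ((b - a) / 2)"
      using * by (simp_all only: mult_le_cancel_left_pos mult_less_cancel_left_pos pi_gt_zero
          zero_less_mult_iff zero_less_numeral simp_thms)
    then have "2 * pi * \<bar>t - c\<bar> \<le> pi * (b - a)" "t \<noteq> a \<Longrightarrow> 2 * pi * \<bar>t - c\<bar> < pi * (b - a)"
      by simp_all
    moreover have "pi * (b - a) \<le> pi" using ab by (simp add: mult_le_cancel_left1)
    ultimately show "r \<le> s t" "t \<noteq> a \<Longrightarrow> r < s t"
      unfolding r_def s_abs using cos_monotone_0_pi_le cos_monotone_0_pi by auto
  qed
  have outside: "s t \<le> r" "t \<noteq> b \<Longrightarrow> t \<noteq> 0 \<Longrightarrow> t \<noteq> 1 \<Longrightarrow> s t < r" if "t \<in> {0..1} - {a..<b}" for t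
  proof -
    define x where "x = 2 * pi * \<bar>t - c\<bar>"
    have 1: "(b - a) / 2 \<le> \<bar>t - c\<bar>" "t \<noteq> b \<Longrightarrow> (b - a) / 2 < \<bar>t - c\<bar>"
      using that ab unfolding c_def by (auto simp: abs_if field_simps)
    have 2: "\<bar>t - c\<bar> \<le> 1 - (b - a) / 2" "t \<noteq> 0 \<Longrightarrow> t \<noteq> 1 \<Longrightarrow> \<bar>t - c\<bar> < 1 - (b - a) / 2"
      using that ab unfolding c_def by (auto simp: abs_if field_simps)
    have "2 * pi * ((b - a) / 2) \<le> 2 * pi * \<bar>t - c\<bar>"
      "t \<noteq> b \<Longrightarrow> 2 * pi * ((b - a) / 2) < 2 * pi * \<bar>t - c\<bar>"
      using 1 by (simp_all only: mult_le_cancel_left_pos mult_less_cancel_left_pos pi_gt_zero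
          zero_less_mult_iff zero_less_numeral simp_thms)
    then have x1: "pi * (b - a) \<le> x" "t \<noteq> b \<Longrightarrow> pi * (b - a) < x"
      by (simp_all add: x_def)
    have "2 * pi * \<bar>t - c\<bar> \<le> 2 * pi * (1 - (b - a) / 2)"
      "t \<noteq> 0 \<Longrightarrow> t \<noteq> 1 \<Longrightarrow> 2 * pi * \<bar>t - c\<bar> < 2 * pi * (1 - (b - a) / 2)"
      using 2 by auto
    moreover have "2 * pi * (1 - (b - a) / 2) = 2 * pi - pi * (b - a)" by (simp add: field_simps)
    ultimately have x2: "pi * (b - a) \<le> 2 * pi - x" "t \<noteq> 0 \<Longrightarrow> t \<noteq> 1 \<Longrightarrow> pi * (b - a) < 2 * pi - x"
      unfolding x_def by linarith+
    \<comment> \<open>The cosine decreases only on the interval from 0 to pi, so beyond pi the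
      reflected angle is compared instead.\<close>
    have s: "s t = cos x" "s t = cos (2 * pi - x)" by (simp_all add: s_abs x_def)
    have p: "0 \<le> pi * (b - a)" using ab by simp
    show "s t \<le> r"
      using cos_monotone_0_pi_le[OF p x1(1)] cos_monotone_0_pi_le[OF p x2(1)] s unfolding r_def
      by (cases "x \<le> pi") auto
    show "s t < r" if "t \<noteq> b" "t \<noteq> 0" "t \<noteq> 1"
      using cos_monotone_0_pi[OF p x1(2)] cos_monotone_0_pi[OF p x2(2)] s that unfolding r_def
      by (cases "x \<le> pi") auto
  qed
  have ind: "\<bar>indicator {a..<b} (frac t) - ramp k (s t)\<bar> \<le> tent k (s t)" if "k > 0" for t k
  proof -
    have fr: "frac t \<in> {0..1}" using frac_ge_0 frac_lt_1 less_imp_le by auto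
    show ?thesis
    proof (cases "frac t \<in> {a..<b}")
      case True
      then have "0 \<le> s t - r" using inside(1)[of "frac t"] by (simp add: s_frac)
      then show ?thesis using that True by (auto simp: tent_def ramp_def abs_if max_def min_def)
    next
      case False
      then have "s t - r \<le> 0" using outside(1)[of "frac t"] fr by (simp add: s_frac)
      then have "k * (s t - r) \<le> 0" using that by (simp add: mult_le_0_iff)
      then show ?thesis using False by (auto simp: tent_def ramp_def)
    qed
  qed
  have cont: "continuous_on X s" for X unfolding s_def by (intro continuous_intros)
  have tent_int: "(\<lambda>t. tent k (s t)) integrable_on {0..1}" for k
    unfolding tent_def by (intro integrable_continuous_interval continuous_intros cont)
  \<comment> \<open>At \<open>a\<close> and \<open>b\<close> the cosine takes the value
    \<open>r\<close>; at 0 and 1 it may do so too, as these points are identified modulo 1. Setting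
    the functions to 0 there makes the convergence hold at every point.\<close>
  let ?Z = "{a, b, 0, 1}"
  define g where "g n t = (if t \<in> ?Z then 0 else tent (real n) (s t))" for n t
  have g: "(g n has_integral integral {0..1} (\<lambda>t. tent (real n) (s t))) {0..1}" for n
    by (rule has_integral_spike_finite[OF _ _ integrable_integral[OF tent_int[of n]], where S = ?Z])
      (auto simp: g_def)
  have "(\<lambda>n. integral {0..1} (g n)) \<longlonglongrightarrow> integral {0..1::real} (\<lambda>t. 0::real)"
  proof (rule dominated_convergence(2)[of _ _ "\<lambda>_. 1"])
    fix t :: real assume t: "t \<in> {0..1}"
    show "(\<lambda>n. g n t) \<longlonglongrightarrow> 0"
    proof (cases "t \<in> ?Z")
      case False
      then have "s t \<noteq> r" using inside(2)[of t] outside(2)[of t] t by (cases "t \<in> {a..<b}") auto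
      then have pos: "\<bar>s t - r\<bar> > 0" by simp
      have "eventually (\<lambda>n. 2 / \<bar>s t - r\<bar> \<le> real n) sequentially"
        by (rule eventually_sequentiallyI[of "nat \<lceil>2 / \<bar>s t - r\<bar>\<rceil>"]) linarith
      then have "eventually (\<lambda>n. 0 = g n t) sequentially"
        by eventually_elim (use pos False in \<open>simp add: g_def tent_def field_simps\<close>)
      then show ?thesis by (rule Lim_transform_eventually[OF tendsto_const])
    qed (simp add: g_def)
  qed (use g in \<open>auto simp: has_integral_integrable g_def tent_def\<close>)
  then have "(\<lambda>n. integral {0..1} (\<lambda>t. tent (real n) (s t))) \<longlonglongrightarrow> 0"
    using integral_unique[OF g] by simp
  then have "eventually (\<lambda>n. integral {0..1} (\<lambda>t. tent (real n) (s t)) < e / 4 \<and> n > 0) sequentially"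
    using e by (intro eventually_conj order_tendstoD(2) eventually_gt_at_top) auto
  then obtain n where n: "integral {0..1} (\<lambda>t. tent (real n) (s t)) < e / 4" "n > 0"
    using eventually_happens'[OF sequentially_bot] by blast
  have s_range: "s t \<in> {-1..1}" for t by (simp add: s_def)
  \<comment> \<open>The tolerance e/16 is spent once on the ramp and once on the tent, so
    \<open>q\<close> plus e/8 dominates the distance of \<open>p\<close> from the indicator. The
    integral of this majorant exceeds that of the tent, below e/4, by at most 3e/16, which stays
    below \<open>e\<close>.\<close>
  obtain p where p: "real_polynomial_function p" "\<And>x. x \<in> {-1..1} \<Longrightarrow> \<bar>ramp n x - p x\<bar> < e / 16"
  proof (rule Stone_Weierstrass_real_polynomial_function[of "{-1..1::real}" "ramp n" "e / 16"])
    show "continuous_on {-1..1} (ramp n)" unfolding ramp_def by (intro continuous_intros)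
  qed (use e in simp_all)
  obtain q where q: "real_polynomial_function q" "\<And>x. x \<in> {-1..1} \<Longrightarrow> \<bar>tent n x - q x\<bar> < e / 16"
  proof (rule Stone_Weierstrass_real_polynomial_function[of "{-1..1::real}" "tent n" "e / 16"])
    show "continuous_on {-1..1} (tent n)" unfolding tent_def by (intro continuous_intros)
  qed (use e in simp_all)
  have q': "real_polynomial_function (\<lambda>x. q x + e / 8)"
    by (rule real_polynomial_function.intros(3)[OF q(1) real_polynomial_function.intros(2)])
  obtain m where m: "torus_mean (\<lambda>t. of_real (p (s t))) (of_real m)"
      "((\<lambda>t. p (s t)) has_integral m) {0..1}"
    using torus_mean_polynomial_cos[OF p(1), of c] unfolding s_def by blast
  obtain M where M: "torus_mean (\<lambda>t. of_real (q (s t) + e / 8)) (of_real M)"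
      "((\<lambda>t. q (s t) + e / 8) has_integral M) {0..1}"
    using torus_mean_polynomial_cos[OF q', of c] unfolding s_def by blast
  have le: "\<bar>indicator {a..<b} (frac t) - p (s t)\<bar> \<le> q (s t) + e / 8" for t
    using ind[of n t] n(2) p(2)[OF s_range[of t]] q(2)[OF s_range[of t]] by linarith
  note I = has_integral_indicator_frac[OF ab]
  have "b - a - m \<le> M"
    by (rule has_integral_le[OF has_integral_diff[OF I m(2)] M(2)])
      (rule order_trans[OF abs_ge_self le])
  moreover have "m - (b - a) \<le> M"
    by (rule has_integral_le[OF has_integral_diff[OF m(2) I] M(2)])
      (rule order_trans[OF abs_ge_self], subst abs_minus_commute, rule le)
  moreover have "M \<le> integral {0..1} (\<lambda>t. tent (real n) (s t)) + 3 * e / 16"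
  proof (rule has_integral_le[OF M(2)])
    show "((\<lambda>t. tent n (s t) + 3 * e / 16) has_integral
        (integral {0..1} (\<lambda>t. tent n (s t)) + 3 * e / 16)) {0..1}"
      using has_integral_const_real[of "3 * e / 16" 0 1]
      by (intro has_integral_add integrable_integral tent_int) simp
    fix t :: real
    show "q (s t) + e / 8 \<le> tent n (s t) + 3 * e / 16" using q(2)[OF s_range[of t]] by linarith
  qed
  ultimately have "\<bar>(b - a) - m\<bar> < e" "M < e" using n(1) e by linarith+
  then show "\<exists>f b' q m. torus_mean f b' \<and> torus_mean (\<lambda>t. complex_of_real (q t)) (of_real m) \<and>
      norm (of_real (b - a) - b') < e \<and> m < e \<and>
      (\<forall>t. norm (of_real (indicator {a..<b} (frac t)) - f t) \<le> q t)"
    using m(1) M(1) le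
    by (intro exI[of _ "\<lambda>t. of_real (p (s t))"] exI[of _ "of_real m"]
        exI[of _ "\<lambda>t. q (s t) + e / 8"] exI[of _ M])
      (simp flip: of_real_diff)
qed

subsection \<open>Equidistribution modulo 1 of boxes\<close>

text \<open>The product is a single character with frequency vector \<open>v\<close>. Were
  \<open>v\<close> integral, subtracting a combination of unit rows would give a rational relation
  among the rows of the identity and of \<open>\<Lambda>\<close>, so nonresonance would force all
  \<open>h i\<close> to vanish.\<close>

lemma has_average_prod_character:
  fixes \<Lambda> :: "'i \<Rightarrow> real ^ 'n"
  assumes I: "finite I" and \<Lambda>: "nonresonant I \<Lambda>"
  shows "has_average (\<lambda>x. \<Prod>i\<in>I. cis (2 * pi * (of_int (h i) * (\<Lambda> i \<bullet> real_vec x))))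
    (\<Prod>i\<in>I. if h i = 0 then 1 else 0)"
proof (cases "\<forall>i\<in>I. h i = 0")
  case True
  then show ?thesis using has_average_const[of 1] by simp
next
  case False
  define v where "v = (\<Sum>i\<in>I. of_int (h i) *\<^sub>R \<Lambda> i)"
  have eq: "(\<Prod>i\<in>I. cis (2 * pi * (of_int (h i) * (\<Lambda> i \<bullet> real_vec x)))) =
      cis (2 * pi * (v \<bullet> real_vec x))" for x
    by (simp add: v_def inner_sum_left sum_distrib_left cis_sum)
  have "\<exists>k. v $ k \<notin> \<int>"
  proof (rule ccontr)
    assume "\<not> (\<exists>k. v $ k \<notin> \<int>)"
    then have "\<forall>k. \<exists>z::int. v $ k = of_int z" by (metis Ints_cases)
    then obtain z :: "'n \<Rightarrow> int" where z: "\<And>k. v $ k = of_int (z k)" by metis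
    define c where "c = (case_sum (\<lambda>k. - of_int (z k)) (\<lambda>i. of_int (h i)) :: 'n + 'i \<Rightarrow> rat)"
    have "v = (\<Sum>k\<in>UNIV. of_int (z k) *\<^sub>R row k (mat 1 :: real ^ 'n ^ 'n))"
      by (simp add: vec_eq_iff z row_def mat_def if_distrib[of "\<lambda>x. _ * x"] cong: if_cong)
    then have "(\<Sum>j\<in>(UNIV :: 'n set) <+> I. of_rat (c j) *\<^sub>R case_sum (\<lambda>i. row i (mat 1)) \<Lambda> j) = 0"
      using I by (simp add: sum.Plus c_def v_def of_rat_minus sum_negf)
    then have "\<forall>j\<in>(UNIV :: 'n set) <+> I. c j = 0"
      using \<Lambda> unfolding nonresonant_def rat_independent_def by blast
    then have "\<forall>i\<in>I. h i = 0" by (force simp: c_def)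
    then show False using False by blast
  qed
  then obtain k where "v $ k \<notin> \<int>" by blast
  moreover have "(\<Prod>i\<in>I. if h i = 0 then 1 else 0) = (0::complex)"
    using False I by (auto intro: prod_zero)
  ultimately show ?thesis using has_average_cis[of v k] by (simp add: eq)
qed

text \<open>Induction on the set \<open>J\<close> of coordinates with an arbitrary factor, all
  others carrying characters. To free coordinate \<open>j\<close>, the product of the remaining
  factors becomes the weight \<open>\<Psi>\<close>; its averages against characters in coordinate
  \<open>j\<close> are the induction hypothesis with \<open>g j\<close> replaced by a
  character.\<close>

lemma has_average_prod_torus_mean:
  fixes \<Lambda> :: "'i \<Rightarrow> real ^ 'n"
  assumes I: "finite I" and \<Lambda>: "nonresonant I \<Lambda>"
    and g: "\<And>i. i \<in> I \<Longrightarrow> torus_mean (g i) (m i)"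
  shows "has_average (\<lambda>x. \<Prod>i\<in>I. g i (\<Lambda> i \<bullet> real_vec x)) (\<Prod>i\<in>I. m i)"
proof -
  define ch where "ch h t = cis (2 * pi * (of_int h * t))" for h :: int and t
  define \<delta> where "\<delta> h = (if h = 0 then 1 else 0 :: complex)" for h :: int
  have "has_average (\<lambda>x. \<Prod>i\<in>I. g i (\<Lambda> i \<bullet> real_vec x)) (\<Prod>i\<in>I. m i)"
    if "finite J" "J \<subseteq> I" "\<And>i. i \<in> J \<Longrightarrow> torus_mean (g i) (m i)"
      "\<And>i. i \<in> I - J \<Longrightarrow> \<exists>h. g i = ch h \<and> m i = \<delta> h" for J g m
    using that
  proof (induction J arbitrary: g m rule: finite_induct)
    case empty
    then obtain h where h: "\<And>i. i \<in> I \<Longrightarrow> g i = ch (h i) \<and> m i = \<delta> (h i)"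
      by (metis Diff_empty)
    show ?case
      using has_average_prod_character[OF I \<Lambda>, of h] h
      by (simp add: ch_def \<delta>_def cong: prod.cong)
  next
    case (insert j J)
    have j: "j \<in> I" using insert.prems by blast
    define \<Psi> where "\<Psi> x = (\<Prod>i\<in>I - {j}. g i (\<Lambda> i \<bullet> real_vec x))" for x
    define A where "A = (\<Prod>i\<in>I - {j}. m i)"
    have \<Psi>: "(\<Prod>i\<in>I. (g(j := f)) i (\<Lambda> i \<bullet> real_vec x)) = \<Psi> x * f (\<Lambda> j \<bullet> real_vec x)" for f x
      using I j unfolding \<Psi>_def by (subst prod.remove[of I j]) (auto intro!: prod.cong)
    have A: "(\<Prod>i\<in>I. (m(j := a)) i) = A * a" for a
      using I j unfolding A_def by (subst prod.remove[of I j]) (auto intro!: prod.cong)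
    have tm: "torus_mean (g i) (m i)" if "i \<in> I" for i
    proof (cases "i \<in> insert j J")
      case False
      then obtain h where "g i = ch h" "m i = \<delta> h" using insert.prems(3)[of i] \<open>i \<in> I\<close> by blast
      then show ?thesis using torus_mean.character[of h] by (simp add: ch_def[abs_def] \<delta>_def)
    qed (use insert.prems in blast)
    then have "\<forall>i. \<exists>C. i \<in> I \<longrightarrow> (\<forall>t. norm (g i t) \<le> C)"
      using torus_mean_bounded by blast
    then obtain C where C: "\<And>i t. i \<in> I \<Longrightarrow> norm (g i t) \<le> C i"
      by metis
    have "has_average (\<lambda>x. \<Psi> x * g j (\<Lambda> j \<bullet> real_vec x)) (A * m j)"
    proof (rule has_average_torus_mean[THEN conjunct2])
      show "torus_mean (g j) (m j)" using tm j .
      show "norm (\<Psi> x) \<le> (\<Prod>i\<in>I - {j}. C i)" for x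
        unfolding \<Psi>_def prod_norm[symmetric] using C by (intro prod_mono) auto
      show "has_average (\<lambda>x. \<Psi> x * cis (2 * pi * (of_int h * (\<Lambda> j \<bullet> real_vec x))))
          (A * (if h = 0 then 1 else 0))" for h
      proof -
        have "has_average (\<lambda>x. \<Prod>i\<in>I. (g(j := ch h)) i (\<Lambda> i \<bullet> real_vec x))
            (\<Prod>i\<in>I. (m(j := \<delta> h)) i)"
        proof (rule insert.IH)
          fix i assume "i \<in> I - J"
          then show "\<exists>h'. (g(j := ch h)) i = ch h' \<and> (m(j := \<delta> h)) i = \<delta> h'"
            using insert.prems(3)[of i] by auto
        qed (use insert in auto)
        then show ?thesis unfolding \<Psi> A by (simp add: ch_def \<delta>_def)
      qed
      show "has_average (\<lambda>x. cis (2 * pi * (of_int h * (\<Lambda> j \<bullet> real_vec x)))) (if h = 0 then 1 else 0)" for h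
      proof -
        \<comment> \<open>A character in one coordinate is a product of characters with frequency 0
          in all other coordinates.\<close>
        have "(\<Prod>i\<in>I. cis (2 * pi * (of_int (((\<lambda>_. 0)(j := h)) i) * y i))) =
            (\<Prod>i\<in>I. if i = j then cis (2 * pi * (of_int h * y j)) else 1)" for y
          by (intro prod.cong) auto
        moreover have "(\<Prod>i\<in>I. if ((\<lambda>_. 0)(j := h)) i = 0 then 1 else 0) =
            (\<Prod>i\<in>I. if i = j then if h = 0 then 1 else 0 else 1 :: complex)"
          by (intro prod.cong) auto
        ultimately show ?thesis
          using has_average_prod_character[OF I \<Lambda>, of "(\<lambda>_. 0)(j := h)"] I j by simp
      qed
    qed
    then show ?case using \<Psi>[of "g j"] A[of "m j"] by simp
  qed
  from this[of I g m] show ?thesis using I g by simp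
qed

lemma has_average_box:
  fixes \<Lambda> :: "'i \<Rightarrow> real ^ 'n"
  assumes I: "finite I" "nonresonant I \<Lambda>"
    and ab: "\<And>i. i \<in> I \<Longrightarrow> 0 \<le> a i \<and> a i < b i \<and> b i \<le> 1"
  shows "has_average (\<lambda>x. \<Prod>i\<in>I. indicator {a i..<b i} (frac (\<Lambda> i \<bullet> real_vec x))) (\<Prod>i\<in>I. b i - a i :: real)"
proof -
  have "has_average (\<lambda>x. \<Prod>i\<in>I. complex_of_real (indicator {a i..<b i} (frac (\<Lambda> i \<bullet> real_vec x))))
      (\<Prod>i\<in>I. of_real (b i - a i))"
    by (rule has_average_prod_torus_mean[OF I]) (use ab torus_mean_interval in blast)
  from has_average_bounded_linear[OF bounded_linear_Re this]
  show ?thesis by (simp flip: of_real_prod del: of_real_diff)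
qed

subsection \<open>Equidistribution modulo 1 for almost everywhere continuous functions\<close>

text \<open>As a combination of products of interval indicators this step function has a computable
  average and a computable integral. On the unit cube it takes the value of \<open>w\<close> at the
  cell of the point, see \<open>grid_step_eq\<close>.\<close>

definition grid_step :: "'i set \<Rightarrow> nat \<Rightarrow> (('i \<Rightarrow> nat) \<Rightarrow> real) \<Rightarrow> ('i \<Rightarrow> real) \<Rightarrow> real" where
  "grid_step I k w \<theta> = (\<Sum>c\<in>I \<rightarrow>\<^sub>E {..<k}.
    w c * (\<Prod>i\<in>I. indicator {real (c i) / real k..<(real (c i) + 1) / real k} (\<theta> i)))"

definition grid_cell :: "'i set \<Rightarrow> nat \<Rightarrow> ('i \<Rightarrow> real) \<Rightarrow> 'i \<Rightarrow> nat" where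
  "grid_cell I k \<theta> = (\<lambda>i\<in>I. nat \<lfloor>real k * \<theta> i\<rfloor>)"

lemma grid_interval_iff:
  assumes "0 \<le> t" "k > 0"
  shows "t \<in> {real c / real k..<(real c + 1) / real k} \<longleftrightarrow> nat \<lfloor>real k * t\<rfloor> = c"
proof -
  have "t \<in> {real c / real k..<(real c + 1) / real k} \<longleftrightarrow> real c \<le> real k * t \<and> real k * t < real c + 1"
    using assms(2) by (auto simp: field_simps)
  also have "\<dots> \<longleftrightarrow> \<lfloor>real k * t\<rfloor> = int c" by (simp add: floor_eq_iff)
  also have "\<dots> \<longleftrightarrow> nat \<lfloor>real k * t\<rfloor> = c"
  proof -
    have "0 \<le> \<lfloor>real k * t\<rfloor>" using assms by simp
    then show ?thesis by linarith
  qed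
  finally show ?thesis .
qed

lemma grid_cell_in:
  assumes "\<theta> \<in> I \<rightarrow>\<^sub>E {0..<1}" "k > 0"
  shows "grid_cell I k \<theta> \<in> I \<rightarrow>\<^sub>E {..<k}"
proof
  fix i assume "i \<in> I"
  then have "0 \<le> \<theta> i" "\<theta> i < 1" using assms by (auto simp: PiE_iff)
  then have "real k * \<theta> i < real k" "0 \<le> real k * \<theta> i" using assms(2) by simp_all
  then have "nat \<lfloor>real k * \<theta> i\<rfloor> < k" by linarith
  then show "grid_cell I k \<theta> i \<in> {..<k}" using \<open>i \<in> I\<close> by (simp add: grid_cell_def)
qed (simp add: grid_cell_def)

lemma grid_step_eq:
  assumes I: "finite I" and \<theta>: "\<theta> \<in> I \<rightarrow>\<^sub>E {0..<1}" and k: "k > 0"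
  shows "grid_step I k w \<theta> = w (grid_cell I k \<theta>)"
proof -
  have "(\<Prod>i\<in>I. indicator {real (c i) / real k..<(real (c i) + 1) / real k} (\<theta> i)) =
      (if c = grid_cell I k \<theta> then 1 else 0 :: real)" if c: "c \<in> I \<rightarrow>\<^sub>E {..<k}" for c
  proof -
    have *: "indicator {real (c i) / real k..<(real (c i) + 1) / real k} (\<theta> i) =
        (if c i = grid_cell I k \<theta> i then 1 else 0 :: real)" if "i \<in> I" for i
    proof -
      have "0 \<le> \<theta> i" using \<theta> that by (auto simp: PiE_iff)
      then show ?thesis
        using grid_interval_iff[of "\<theta> i" k "c i"] k that by (auto simp: indicator_def grid_cell_def)
    qed
    have "c = grid_cell I k \<theta> \<longleftrightarrow> (\<forall>i\<in>I. c i = grid_cell I k \<theta> i)"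
      using PiE_ext[OF c grid_cell_in[OF \<theta> k]] by auto
    then show ?thesis using I * by (auto intro: prod_zero)
  qed
  then have "grid_step I k w \<theta> = (\<Sum>c\<in>I \<rightarrow>\<^sub>E {..<k}. if c = grid_cell I k \<theta> then w c else 0)"
    unfolding grid_step_def by (intro sum.cong) auto
  also have "\<dots> = w (grid_cell I k \<theta>)"
    using I grid_cell_in[OF \<theta> k] by (simp add: finite_PiE)
  finally show ?thesis .
qed

lemma grid_step_outside:
  assumes I: "finite I" and \<theta>: "\<theta> \<in> extensional I" "\<theta> \<notin> I \<rightarrow>\<^sub>E {0..<1}"
  shows "grid_step I k w \<theta> = 0"
proof -
  obtain i where i: "i \<in> I" "\<theta> i \<notin> {0..<1}" using \<theta> by (auto simp: PiE_iff)
  have "(\<Prod>i\<in>I. indicator {real (c i) / real k..<(real (c i) + 1) / real k} (\<theta> i)) = (0::real)"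
    if "c \<in> I \<rightarrow>\<^sub>E {..<k}" for c
  proof -
    have "c i < k" using that i by (auto simp: PiE_iff)
    then have "(real (c i) + 1) / real k \<le> 1" "0 \<le> real (c i) / real k" by (simp_all add: field_simps)
    then have "\<theta> i \<notin> {real (c i) / real k..<(real (c i) + 1) / real k}"
      using i(2) unfolding atLeastLessThan_iff by linarith
    then show ?thesis by (intro prod_zero[OF I] bexI[OF _ i(1)] indicator_simps(2))
  qed
  then show ?thesis by (simp add: grid_step_def)
qed

lemma product_sigma_finite_lborel: "product_sigma_finite (\<lambda>_. lborel)"
  by (simp add: product_sigma_finite_def sigma_finite_lborel)

lemma integral_grid_step:
  assumes I: "finite I"
  shows "integrable (Pi\<^sub>M I (\<lambda>_. lborel)) (grid_step I k w)"
    "integral\<^sup>L (Pi\<^sub>M I (\<lambda>_. lborel)) (grid_step I k w) = (\<Sum>c\<in>I \<rightarrow>\<^sub>E {..<k}. w c * (\<Prod>i\<in>I. 1 / real k))"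
proof -
  interpret product_sigma_finite "\<lambda>_. lborel :: real measure" by (rule product_sigma_finite_lborel)
  define u where "u c i t = (indicator {real (c i) / real k..<(real (c i) + 1) / real k} t :: real)"
    for c :: "'a \<Rightarrow> nat" and i t
  have u: "integrable lborel (u c i)" "integral\<^sup>L lborel (u c i) = 1 / real k" for c i
  proof -
    have "(real (c i) + 1) / real k - real (c i) / real k = 1 / real k"
      by (simp add: diff_divide_distrib[symmetric])
    then show "integral\<^sup>L lborel (u c i) = 1 / real k"
      unfolding u_def by (simp add: divide_right_mono)
    show "integrable lborel (u c i)"
      unfolding u_def by (intro integrable_real_indicator) (auto simp: divide_right_mono)
  qed
  have int: "integrable (Pi\<^sub>M I (\<lambda>_. lborel)) (\<lambda>\<theta>. \<Prod>i\<in>I. u c i (\<theta> i))" for c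
    by (rule product_integrable_prod[OF I u(1)])
  have eq: "grid_step I k w = (\<lambda>\<theta>. \<Sum>c\<in>I \<rightarrow>\<^sub>E {..<k}. w c * (\<Prod>i\<in>I. u c i (\<theta> i)))"
    by (simp add: fun_eq_iff grid_step_def u_def)
  show "integrable (Pi\<^sub>M I (\<lambda>_. lborel)) (grid_step I k w)"
    unfolding eq using int by simp
  show "integral\<^sup>L (Pi\<^sub>M I (\<lambda>_. lborel)) (grid_step I k w) = (\<Sum>c\<in>I \<rightarrow>\<^sub>E {..<k}. w c * (\<Prod>i\<in>I. 1 / real k))"
    unfolding eq using int by (simp add: product_integral_prod[OF I u(1)] u(2))
qed

definition torus_point :: "'i set \<Rightarrow> ('i \<Rightarrow> real ^ 'n) \<Rightarrow> int ^ 'n \<Rightarrow> 'i \<Rightarrow> real" where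
  "torus_point I \<Lambda> x = (\<lambda>i\<in>I. frac (\<Lambda> i \<bullet> real_vec x))"

lemma torus_point_in: "torus_point I \<Lambda> x \<in> I \<rightarrow>\<^sub>E {0..<1}"
  by (auto simp: torus_point_def frac_lt_1)

lemma has_average_grid_step:
  assumes "finite I" "nonresonant I \<Lambda>"
  shows "has_average (\<lambda>x. grid_step I k w (torus_point I \<Lambda> x))
    (integral\<^sup>L (Pi\<^sub>M I (\<lambda>_. lborel)) (grid_step I k w))"
proof -
  have "has_average (\<lambda>x. \<Prod>i\<in>I. indicator {real (c i) / real k..<(real (c i) + 1) / real k}
      (frac (\<Lambda> i \<bullet> real_vec x))) (\<Prod>i\<in>I. (real (c i) + 1) / real k - real (c i) / real k)"
    if "c \<in> I \<rightarrow>\<^sub>E {..<k}" for c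
  proof (rule has_average_box[OF assms])
    fix i assume "i \<in> I"
    then have "c i < k" using that by (auto simp: PiE_iff)
    then show "0 \<le> real (c i) / real k \<and> real (c i) / real k < (real (c i) + 1) / real k \<and>
        (real (c i) + 1) / real k \<le> 1"
      by (auto simp: field_simps)
  qed
  then have "has_average (\<lambda>x. \<Sum>c\<in>I \<rightarrow>\<^sub>E {..<k}. w c *
      (\<Prod>i\<in>I. indicator {real (c i) / real k..<(real (c i) + 1) / real k} (frac (\<Lambda> i \<bullet> real_vec x))))
    (\<Sum>c\<in>I \<rightarrow>\<^sub>E {..<k}. w c * (\<Prod>i\<in>I. (real (c i) + 1) / real k - real (c i) / real k))"
    using assms(1) by (intro has_average_sum has_average_mult_left) (auto simp: finite_PiE)
  then show ?thesis
    by (simp add: integral_grid_step[OF assms(1)] grid_step_def torus_point_def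
        diff_divide_distrib[symmetric])
qed

text \<open>A Riemann sum argument: \<open>F\<close> is sampled at one node per cell, and the step
  function of oscillations is the majorant. Continuity almost everywhere makes the oscillations tend
  to 0 almost everywhere, and dominated convergence makes their mean small. The limit is an integral
  of \<open>H\<close> because \<open>F\<close> may fail to be measurable.\<close>

lemma has_average_torus_function:
  fixes F H :: "('i \<Rightarrow> real) \<Rightarrow> real" and \<Lambda> :: "'i \<Rightarrow> real ^ 'n"
  assumes I: "finite I" and \<Lambda>: "nonresonant I \<Lambda>"
    and bdd: "\<And>\<theta>. \<theta> \<in> I \<rightarrow>\<^sub>E {0..<1} \<Longrightarrow> \<bar>F \<theta>\<bar> \<le> B"
    and H: "H \<in> borel_measurable (Pi\<^sub>M I (\<lambda>_. lborel))"
    and cont: "AE \<theta> in Pi\<^sub>M I (\<lambda>_. lborel). \<theta> \<in> I \<rightarrow>\<^sub>E {0..<1} \<longrightarrow> F \<theta> = H \<theta> \<and>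
      (\<forall>e>0. \<exists>d>0. \<forall>\<phi>\<in>I \<rightarrow>\<^sub>E {0..<1}. (\<forall>i\<in>I. \<bar>\<phi> i - \<theta> i\<bar> < d) \<longrightarrow> \<bar>F \<phi> - F \<theta>\<bar> < e)"
  shows "has_average (\<lambda>x. F (torus_point I \<Lambda> x))
    (\<integral>\<theta>. indicator (I \<rightarrow>\<^sub>E {0..<1}) \<theta> * H \<theta> \<partial>Pi\<^sub>M I (\<lambda>_. lborel))"
proof -
  interpret product_sigma_finite "\<lambda>_. lborel :: real measure" by (rule product_sigma_finite_lborel)
  let ?M = "Pi\<^sub>M I (\<lambda>_. lborel :: real measure)"
  let ?C = "I \<rightarrow>\<^sub>E {0..<1::real}"
  define node where "node k c = (\<lambda>i\<in>I. real (c i) / real k)" for k and c :: "'i \<Rightarrow> nat"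
  define cell where "cell k c = {\<phi> \<in> ?C. grid_cell I k \<phi> = c}" for k c
  \<comment> \<open>Measured from the node, this is the error of sampling. Finiteness of the
    supremum comes from the bound \<open>B\<close>.\<close>
  define osc where "osc k c = (SUP \<phi>\<in>cell k c. \<bar>F \<phi> - F (node k c)\<bar>)" for k c
  have B0: "0 \<le> B"
    using bdd[of "\<lambda>i\<in>I. 0"] by force
  have node_C: "node k c \<in> ?C" if "c \<in> I \<rightarrow>\<^sub>E {..<k}" for k c
    using that by (auto simp: node_def PiE_iff)
  have diff_le: "\<bar>F \<phi> - F \<psi>\<bar> \<le> 2 * B" if "\<phi> \<in> ?C" "\<psi> \<in> ?C" for \<phi> \<psi>
    using bdd[OF that(1)] bdd[OF that(2)] by linarith
  have bdd_cell: "bdd_above ((\<lambda>\<phi>. \<bar>F \<phi> - F (node k c)\<bar>) ` cell k c)" if "c \<in> I \<rightarrow>\<^sub>E {..<k}" for k c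
    using diff_le node_C[OF that] by (auto intro!: bdd_aboveI[of _ "2 * B"] simp: cell_def)
  have osc_upper: "\<bar>F \<theta> - F (node k (grid_cell I k \<theta>))\<bar> \<le> osc k (grid_cell I k \<theta>)"
    if "\<theta> \<in> ?C" "k > 0" for k \<theta>
    unfolding osc_def using that grid_cell_in[OF that]
    by (intro cSUP_upper bdd_cell) (auto simp: cell_def)
  have osc_le: "osc k (grid_cell I k \<theta>) \<le> b"
    if "\<theta> \<in> ?C" "\<And>\<phi>. \<phi> \<in> cell k (grid_cell I k \<theta>) \<Longrightarrow> \<bar>F \<phi> - F (node k (grid_cell I k \<theta>))\<bar> \<le> b" for k \<theta> b
    unfolding osc_def using that by (intro cSUP_least) (auto simp: cell_def)
  have near: "\<bar>\<phi> i - \<theta> i\<bar> < 1 / real k" "\<bar>node k (grid_cell I k \<theta>) i - \<theta> i\<bar> < 1 / real k"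
    if "\<theta> \<in> ?C" "\<phi> \<in> cell k (grid_cell I k \<theta>)" "k > 0" "i \<in> I" for \<theta> \<phi> k i
  proof -
    let ?c = "nat \<lfloor>real k * \<theta> i\<rfloor>"
    have "0 \<le> \<theta> i" "0 \<le> \<phi> i" using that by (auto simp: cell_def PiE_iff)
    moreover have "nat \<lfloor>real k * \<phi> i\<rfloor> = ?c"
      using that unfolding cell_def grid_cell_def by (metis (mono_tags, lifting) mem_Collect_eq restrict_apply)
    ultimately have "\<phi> i \<in> {real ?c / real k..<(real ?c + 1) / real k}"
      "\<theta> i \<in> {real ?c / real k..<(real ?c + 1) / real k}"
      using grid_interval_iff[OF _ that(3)] by blast+
    moreover have "(real ?c + 1) / real k = real ?c / real k + 1 / real k" by (simp add: add_divide_distrib)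
    moreover have "node k (grid_cell I k \<theta>) i = real ?c / real k"
      using that(4) by (simp add: node_def grid_cell_def)
    ultimately show "\<bar>\<phi> i - \<theta> i\<bar> < 1 / real k" "\<bar>node k (grid_cell I k \<theta>) i - \<theta> i\<bar> < 1 / real k"
      by auto
  qed
  have cube: "?C \<in> sets ?M" by (intro sets_PiM_I_finite[OF I]) auto
  have cube_int: "integrable ?M (\<lambda>\<theta>. 2 * B * indicator ?C \<theta>)"
  proof -
    have "emeasure ?M ?C = 1" using I by (subst emeasure_PiM) auto
    then show ?thesis using cube by (intro integrable_mult_right integrable_real_indicator) auto
  qed
  have lim: "AE \<theta> in ?M. (\<lambda>k. grid_step I (Suc k) (\<lambda>c. F (node (Suc k) c)) \<theta>) \<longlonglongrightarrow> indicator ?C \<theta> * H \<theta> \<and>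
      (\<lambda>k. grid_step I (Suc k) (osc (Suc k)) \<theta>) \<longlonglongrightarrow> 0"
    using cont AE_space
  proof eventually_elim
    case (elim \<theta>)
    show ?case
    proof (cases "\<theta> \<in> ?C")
      case False
      moreover have "\<theta> \<in> extensional I" using elim by (simp add: space_PiM PiE_def)
      ultimately show ?thesis using grid_step_outside[OF I] by (simp add: indicator_def)
    next
      case True
      \<comment> \<open>The factor 2 arises because points of the cell are compared with the node
        through \<open>F \<theta>\<close>.\<close>
      have *: "\<exists>no. \<forall>k\<ge>no. \<bar>F (node (Suc k) (grid_cell I (Suc k) \<theta>)) - F \<theta>\<bar> < e \<and>
          osc (Suc k) (grid_cell I (Suc k) \<theta>) \<le> 2 * e" if e: "e > 0" for e
      proof -
        obtain d where d: "d > 0" "\<And>\<phi>. \<phi> \<in> ?C \<Longrightarrow> \<forall>i\<in>I. \<bar>\<phi> i - \<theta> i\<bar> < d \<Longrightarrow> \<bar>F \<phi> - F \<theta>\<bar> < e"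
          using elim(1) True e by blast
        obtain no where no: "1 / real (Suc no) < d" using nat_approx_posE[OF d(1)] by blast
        have "\<bar>F (node (Suc k) (grid_cell I (Suc k) \<theta>)) - F \<theta>\<bar> < e \<and>
          osc (Suc k) (grid_cell I (Suc k) \<theta>) \<le> 2 * e" if "k \<ge> no" for k
        proof -
          let ?c = "grid_cell I (Suc k) \<theta>"
          have "1 / real (Suc k) \<le> 1 / real (Suc no)" using that by (simp add: frac_le)
          then have kd: "1 / real (Suc k) < d" using no by linarith
          have nC: "node (Suc k) ?c \<in> ?C" using node_C[OF grid_cell_in[OF True]] by simp
          have 1: "\<bar>F (node (Suc k) ?c) - F \<theta>\<bar> < e"
            using near(2)[OF True, of \<theta> "Suc k"] True kd
            by (intro d(2)[OF nC]) (auto simp: cell_def intro: less_trans)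
          have "osc (Suc k) ?c \<le> 2 * e"
          proof (rule osc_le[OF True])
            fix \<phi> assume \<phi>: "\<phi> \<in> cell (Suc k) ?c"
            have "\<bar>F \<phi> - F \<theta>\<bar> < e"
              using near(1)[OF True \<phi>] \<phi> kd by (intro d(2)) (auto simp: cell_def intro: less_trans)
            then show "\<bar>F \<phi> - F (node (Suc k) ?c)\<bar> \<le> 2 * e" using 1 by linarith
          qed
          then show ?thesis using 1 by blast
        qed
        then show ?thesis by blast
      qed
      have osc0: "0 \<le> osc (Suc k) (grid_cell I (Suc k) \<theta>)" for k
        using osc_upper[OF True, of "Suc k"] by simp
      have "(\<lambda>k. F (node (Suc k) (grid_cell I (Suc k) \<theta>))) \<longlonglongrightarrow> F \<theta>"
        unfolding LIMSEQ_iff using * by fastforce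
      moreover have "(\<lambda>k. osc (Suc k) (grid_cell I (Suc k) \<theta>)) \<longlonglongrightarrow> 0"
        unfolding LIMSEQ_iff
      proof (intro allI impI)
        fix r :: real assume "r > 0"
        then obtain no where "\<forall>k\<ge>no. osc (Suc k) (grid_cell I (Suc k) \<theta>) \<le> 2 * (r / 4)"
          using *[of "r / 4"] by auto
        then show "\<exists>no. \<forall>k\<ge>no. norm (osc (Suc k) (grid_cell I (Suc k) \<theta>) - 0) < r"
          using osc0 \<open>r > 0\<close> by (intro exI[of _ no]) fastforce
      qed
      ultimately show ?thesis using True elim(1) by (simp add: grid_step_eq[OF I True])
    qed
  qed
  have step_bound: "norm (grid_step I (Suc k) w \<theta>) \<le> 2 * B * indicator ?C \<theta>"
    if "\<theta> \<in> space ?M" "\<And>\<theta>. \<theta> \<in> ?C \<Longrightarrow> \<bar>w (grid_cell I (Suc k) \<theta>)\<bar> \<le> 2 * B" for k w \<theta>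
    using that grid_step_eq[OF I, of \<theta> "Suc k" w] grid_step_outside[OF I, of \<theta> "Suc k" w]
    by (cases "\<theta> \<in> ?C") (auto simp: space_PiM PiE_iff)
  have lim1: "(\<lambda>k. integral\<^sup>L ?M (grid_step I (Suc k) (\<lambda>c. F (node (Suc k) c)))) \<longlonglongrightarrow>
      (\<integral>\<theta>. indicator ?C \<theta> * H \<theta> \<partial>?M)"
  proof (rule integral_dominated_convergence[OF _ _ cube_int])
    show "AE \<theta> in ?M. norm (grid_step I (Suc k) (\<lambda>c. F (node (Suc k) c)) \<theta>) \<le> 2 * B * indicator ?C \<theta>" for k
      using B0 by (intro AE_I2 step_bound) (auto intro!: order_trans[OF bdd] node_C grid_cell_in)
  qed (use lim H cube integral_grid_step(1)[OF I] in \<open>auto intro: borel_measurable_integrable\<close>)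
  have lim2: "(\<lambda>k. integral\<^sup>L ?M (grid_step I (Suc k) (osc (Suc k)))) \<longlonglongrightarrow> (\<integral>\<theta>. 0 \<partial>?M)"
  proof (rule integral_dominated_convergence[OF _ _ cube_int])
    have "\<bar>osc (Suc k) (grid_cell I (Suc k) \<theta>)\<bar> \<le> 2 * B" if "\<theta> \<in> ?C" for k \<theta>
      using osc_upper[OF that, of "Suc k"] osc_le[OF that, of "Suc k" "2 * B"]
        diff_le[OF _ node_C[OF grid_cell_in[OF that]]]
      by (fastforce simp: cell_def)
    then show "AE \<theta> in ?M. norm (grid_step I (Suc k) (osc (Suc k)) \<theta>) \<le> 2 * B * indicator ?C \<theta>" for k
      by (intro AE_I2 step_bound)
  qed (use lim integral_grid_step(1)[OF I] in \<open>auto intro: borel_measurable_integrable\<close>)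
  show ?thesis
  proof (rule has_average_approx)
    fix e :: real assume e: "e > 0"
    have "eventually (\<lambda>k. dist (integral\<^sup>L ?M (grid_step I (Suc k) (\<lambda>c. F (node (Suc k) c))))
          (\<integral>\<theta>. indicator ?C \<theta> * H \<theta> \<partial>?M) < e \<and>
        integral\<^sup>L ?M (grid_step I (Suc k) (osc (Suc k))) < e) sequentially"
      using lim2 e by (intro eventually_conj tendstoD[OF lim1] order_tendstoD(2)[OF lim2]) auto
    then obtain k where k: "dist (integral\<^sup>L ?M (grid_step I (Suc k) (\<lambda>c. F (node (Suc k) c))))
          (\<integral>\<theta>. indicator ?C \<theta> * H \<theta> \<partial>?M) < e"
        "integral\<^sup>L ?M (grid_step I (Suc k) (osc (Suc k))) < e"
      using eventually_happens'[OF sequentially_bot] by blast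
    have "norm (F (torus_point I \<Lambda> x) - grid_step I (Suc k) (\<lambda>c. F (node (Suc k) c)) (torus_point I \<Lambda> x))
        \<le> grid_step I (Suc k) (osc (Suc k)) (torus_point I \<Lambda> x)" for x
      using osc_upper[OF torus_point_in, of "Suc k" \<Lambda> x] by (simp add: grid_step_eq[OF I torus_point_in])
    then show "\<exists>f' a' q m. has_average f' a' \<and> has_average q m \<and>
        norm ((\<integral>\<theta>. indicator ?C \<theta> * H \<theta> \<partial>?M) - a') < e \<and> m < e \<and>
        (\<forall>x. norm (F (torus_point I \<Lambda> x) - f' x) \<le> q x)"
      using k has_average_grid_step[OF I \<Lambda>]
      by (intro exI[of _ "\<lambda>x. grid_step I (Suc k) (\<lambda>c. F (node (Suc k) c)) (torus_point I \<Lambda> x)"]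
          exI[of _ "integral\<^sup>L ?M (grid_step I (Suc k) (\<lambda>c. F (node (Suc k) c)))"]
          exI[of _ "\<lambda>x. grid_step I (Suc k) (osc (Suc k)) (torus_point I \<Lambda> x)"]
          exI[of _ "integral\<^sup>L ?M (grid_step I (Suc k) (osc (Suc k)))"])
        (simp add: dist_norm norm_minus_commute)
  qed
qed

subsection \<open>Linear images and Lebesgue measure\<close>

text \<open>The library proves the determinant formula for linear images only for well-ordered index
  types; every finite index type is in bijection with such a copy.\<close>

typedef 'a wo_copy = "UNIV :: 'a set" by auto

instance wo_copy :: (finite) finite
proof
  have "finite (range (Abs_wo_copy :: 'a \<Rightarrow> 'a wo_copy))" by simp
  moreover have "x \<in> range (Abs_wo_copy :: 'a \<Rightarrow> 'a wo_copy)" for x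
    by (metis Rep_wo_copy_inverse rangeI)
  ultimately show "finite (UNIV :: 'a wo_copy set)"
    by (metis UNIV_eq_I)
qed

definition wo_rank :: "'a::finite wo_copy \<Rightarrow> nat" where
  "wo_rank = (SOME f. inj f)"

lemma inj_wo_rank: "inj (wo_rank :: 'a::finite wo_copy \<Rightarrow> nat)"
proof -
  obtain f :: "'a wo_copy \<Rightarrow> nat" where "inj f"
    using finite_imp_inj_to_nat_seg[of "UNIV :: 'a wo_copy set"] by auto
  then show ?thesis unfolding wo_rank_def by (rule someI[of inj])
qed

instantiation wo_copy :: (finite) wellorder
begin

definition less_eq_wo_copy :: "'a wo_copy \<Rightarrow> 'a wo_copy \<Rightarrow> bool" where
  "less_eq_wo_copy x y \<longleftrightarrow> wo_rank x \<le> wo_rank y"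

definition less_wo_copy :: "'a wo_copy \<Rightarrow> 'a wo_copy \<Rightarrow> bool" where
  "less_wo_copy x y \<longleftrightarrow> wo_rank x < wo_rank y"

instance
proof
  fix x y :: "'a wo_copy"
  assume "x \<le> y" "y \<le> x"
  then have "wo_rank x = wo_rank y" by (simp add: less_eq_wo_copy_def)
  then show "x = y" by (rule injD[OF inj_wo_rank])
next
  fix P :: "'a wo_copy \<Rightarrow> bool" and a
  assume *: "\<And>x. (\<And>y. y < x \<Longrightarrow> P y) \<Longrightarrow> P x"
  show "P a"
    by (induction a rule: measure_induct_rule[of wo_rank]) (rule *, simp add: less_wo_copy_def)
qed (simp_all add: less_eq_wo_copy_def less_wo_copy_def less_le_not_le linear)

end

definition to_wo :: "real ^ 'n::finite \<Rightarrow> real ^ 'n wo_copy" where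
  "to_wo v = (\<chi> i. v $ Rep_wo_copy i)"

definition of_wo :: "real ^ 'n::finite wo_copy \<Rightarrow> real ^ 'n" where
  "of_wo v = (\<chi> i. v $ Abs_wo_copy i)"

lemma to_wo_of_wo [simp]: "to_wo (of_wo v) = v" "of_wo (to_wo w) = w"
  by (simp_all add: to_wo_def of_wo_def vec_eq_iff Rep_wo_copy_inverse Abs_wo_copy_inverse)

lemma wo_copy_inverses [simp]: "Abs_wo_copy (Rep_wo_copy i) = i" "Rep_wo_copy (Abs_wo_copy j) = j"
  by (simp_all add: Rep_wo_copy_inverse Abs_wo_copy_inverse)

definition mat_to_wo :: "real ^ 'n::finite ^ 'n \<Rightarrow> real ^ 'n wo_copy ^ 'n wo_copy" where
  "mat_to_wo A = (\<chi> i j. A $ Rep_wo_copy i $ Rep_wo_copy j)"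

text \<open>Conjugating permutations with the bijection of index types preserves the sign, so the
  two Leibniz sums agree term by term.\<close>

lemma det_mat_to_wo:
  fixes A :: "real ^ 'n ^ 'n"
  shows "det (mat_to_wo A) = det A"
proof -
  let ?f = "Abs_wo_copy :: 'n \<Rightarrow> 'n wo_copy" and ?g = "Rep_wo_copy :: 'n wo_copy \<Rightarrow> 'n"
  have "det A = (\<Sum>p | p permutes UNIV. of_int (sign p) * (\<Prod>i\<in>UNIV. A $ i $ p i))"
    by (rule det_def)
  also have "\<dots> = (\<Sum>q | q permutes UNIV. of_int (sign q) * (\<Prod>i\<in>UNIV. mat_to_wo A $ i $ q i))"
  proof (rule sum.reindex_bij_witness[of _ "\<lambda>q. ?g \<circ> q \<circ> ?f" "\<lambda>p. ?f \<circ> p \<circ> ?g"])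
    fix p :: "'n \<Rightarrow> 'n" assume "p \<in> {p. p permutes UNIV}"
    then have p: "p permutes UNIV" by simp
    have bij: "bij ?f" by (rule o_bij[of ?g]) auto
    interpret permutes_bij_finite p UNIV UNIV ?f ?g "\<lambda>x. if x \<in> UNIV then ?f (p (?g x)) else x"
      by unfold_locales (use p bij in simp_all)
    show "?f \<circ> p \<circ> ?g \<in> {q. q permutes UNIV}" using permutes_p' by (simp add: o_def)
    have "sign (?f \<circ> p \<circ> ?g) = sign p" using sign_p' by (simp add: o_def)
    moreover have "(\<Prod>i\<in>UNIV. mat_to_wo A $ i $ (?f \<circ> p \<circ> ?g) i) = (\<Prod>i\<in>UNIV. A $ i $ p i)"
      by (rule prod.reindex_bij_witness[of _ ?f ?g]) (auto simp: mat_to_wo_def)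
    ultimately show "of_int (sign (?f \<circ> p \<circ> ?g)) * (\<Prod>i\<in>UNIV. mat_to_wo A $ i $ (?f \<circ> p \<circ> ?g) i) =
      of_int (sign p) * (\<Prod>i\<in>UNIV. A $ i $ p i)" by simp
  next
    fix q :: "'n wo_copy \<Rightarrow> 'n wo_copy" assume "q \<in> {q. q permutes UNIV}"
    then have q: "bij q" by (simp add: permutes_bij)
    have "bij ?f" "bij ?g" by (rule o_bij[of ?g ?f] o_bij[of ?f ?g]; auto)+
    then have "bij (?g \<circ> q \<circ> ?f)" using q by (intro bij_comp)
    then show "?g \<circ> q \<circ> ?f \<in> {p. p permutes UNIV}" by (auto intro: bij_imp_permutes)
  qed (auto simp: fun_eq_iff)
  finally show ?thesis by (simp add: det_def)
qed

lemma mat_to_wo_mult: "to_wo (A *v v) = mat_to_wo A *v to_wo v"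
proof -
  have "(\<Sum>j\<in>UNIV. A $ Rep_wo_copy i $ j * v $ j) =
      (\<Sum>j\<in>UNIV. A $ Rep_wo_copy i $ Rep_wo_copy j * v $ Rep_wo_copy j)" for i
    by (rule sum.reindex_bij_witness[of _ Rep_wo_copy Abs_wo_copy]) auto
  then show ?thesis by (simp add: vec_eq_iff to_wo_def mat_to_wo_def matrix_vector_mult_def)
qed

lemma continuous_on_vec_components:
  fixes f :: "'a::topological_space \<Rightarrow> real ^ 'n"
  assumes "\<And>i. continuous_on S (\<lambda>x. f x $ i)"
  shows "continuous_on S f"
  using continuous_on_vec_lambda[of S "\<lambda>i x. f x $ i"] assms by simp

lemma prod_Basis_cart:
  fixes l u :: "real ^ 'n"
  shows "(\<Prod>b\<in>Basis. (u - l) \<bullet> b) = (\<Prod>i\<in>UNIV. u $ i - l $ i)"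
  by (simp add: Basis_vec_def cart_eq_inner_axis axis_eq_axis prod.UNION_disjoint inner_diff_left)

lemma Basis_le_cart:
  fixes l u :: "real ^ 'n"
  assumes "\<And>b. b \<in> Basis \<Longrightarrow> l \<bullet> b \<le> u \<bullet> b"
  shows "l $ i \<le> u $ i"
  using assms[of "axis i 1"] by (simp add: inner_axis axis_in_Basis_iff)

text \<open>Renaming coordinates maps boxes to boxes with the same side lengths, and values on boxes
  determine Lebesgue measure.\<close>

lemma distr_lborel_to_wo:
  "distr lborel borel to_wo = (lborel :: (real ^ 'n::finite wo_copy) measure)"
proof (rule lborel_eqI[symmetric])
  fix l u :: "real ^ 'n::finite wo_copy" assume "\<And>b. b \<in> Basis \<Longrightarrow> l \<bullet> b \<le> u \<bullet> b"
  then have lu: "l $ i \<le> u $ i" for i by (rule Basis_le_cart)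
  have m: "(to_wo :: real ^ 'n \<Rightarrow> _) \<in> borel_measurable borel"
    unfolding to_wo_def by (intro borel_measurable_continuous_onI continuous_on_vec_components) (auto intro!: continuous_intros)
  have "(to_wo :: real ^ 'n \<Rightarrow> _) -` box l u = box (of_wo l) (of_wo u)"
  proof -
    have "(\<forall>i. l $ i < v $ Rep_wo_copy i \<and> v $ Rep_wo_copy i < u $ i) \<longleftrightarrow>
      (\<forall>i. l $ Abs_wo_copy i < v $ i \<and> v $ i < u $ Abs_wo_copy i)" for v :: "real ^ 'n"
      by (metis wo_copy_inverses)
    then show ?thesis by (auto simp: mem_box_cart to_wo_def of_wo_def)
  qed
  then have "emeasure (distr lborel borel to_wo) (box l u) = emeasure lborel (box (of_wo l) (of_wo u))"
    using m by (simp add: emeasure_distr)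
  also have "\<dots> = (\<Prod>b\<in>Basis. (of_wo u - of_wo l) \<bullet> b)"
    using lu by (subst emeasure_lborel_box) (auto simp: of_wo_def Basis_vec_def inner_axis)
  also have "(\<Prod>b\<in>Basis. (of_wo u - of_wo l) \<bullet> b) = (\<Prod>b\<in>Basis. (u - l) \<bullet> b)"
    unfolding prod_Basis_cart of_wo_def
    by (rule prod.reindex_bij_witness[of _ Rep_wo_copy Abs_wo_copy]) auto
  finally show "emeasure (distr lborel borel to_wo) (box l u) = (\<Prod>b\<in>Basis. (u - l) \<bullet> b)" .
qed simp

lemma to_wo_image:
  fixes X :: "(real ^ 'n) set"
  assumes X: "X \<in> sets borel"
  shows "to_wo ` X \<in> sets borel" "emeasure lborel (to_wo ` X) = emeasure lborel X"
proof -
  have m: "(to_wo :: real ^ 'n \<Rightarrow> _) \<in> borel_measurable borel"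
    unfolding to_wo_def by (intro borel_measurable_continuous_onI continuous_on_vec_components) (auto intro!: continuous_intros)
  have m': "(of_wo :: _ \<Rightarrow> real ^ 'n) \<in> borel_measurable borel"
    unfolding of_wo_def by (intro borel_measurable_continuous_onI continuous_on_vec_components) (auto intro!: continuous_intros)
  have eq: "to_wo ` X = of_wo -` X"
    by (auto intro: image_eqI[of _ _ "of_wo x" for x])
  show b: "to_wo ` X \<in> sets borel"
    unfolding eq using measurable_sets[OF m' X] by simp
  have "to_wo -` (to_wo ` X) = X" by (auto simp: eq)
  then show "emeasure lborel (to_wo ` X) = emeasure lborel X"
    using emeasure_distr[of "to_wo :: real ^ 'n \<Rightarrow> _" lborel borel "to_wo ` X"] m b
    by (simp add: distr_lborel_to_wo)
qed

text \<open>The preimage is the image of a translate of \<open>S\<close> under the inverse matrix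
  \<open>B\<close>, so the determinant formula, transported through \<open>to_wo\<close>, applies
  with |det B| = 1/|det A|. Boundedness of \<open>S\<close> makes the measures finite and lets real
  measures determine them.\<close>

lemma emeasure_lborel_affine_vimage:
  fixes A :: "real ^ 'n ^ 'n"
  assumes A: "det A \<noteq> 0" and S: "S \<in> sets borel" "bounded S"
  shows "emeasure lborel {w. A *v w + c \<in> S} = ennreal (measure lborel S / \<bar>det A\<bar>)"
proof -
  obtain B where BA: "B ** A = mat 1" "A ** B = mat 1"
    using A unfolding invertible_det_nz[symmetric] invertible_def by blast
  then have "det B * det A = 1" by (metis det_I det_mul)
  then have detB: "\<bar>det B\<bar> = 1 / \<bar>det A\<bar>" using A by (simp add: field_simps flip: abs_mult)
  define S1 where "S1 = (\<lambda>u. u - c) ` S"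
  have S1_eq: "S1 = (\<lambda>w. w + c) -` S"
    by (auto simp: S1_def intro: image_eqI[of _ _ "x + c" for x])
  have S1: "S1 \<in> sets borel"
    unfolding S1_eq using measurable_sets[of "\<lambda>w. w + c" borel borel S] S(1) by simp
  have mS1: "measure lborel S1 = measure lborel S"
    using measure_translation_subtract[of c S] S S1 by (simp add: S1_def)
  have "bounded S1"
    unfolding S1_def using S(2) by (rule bounded_translation_minus)
  then have fS1: "emeasure lborel S1 < \<infinity>" by (rule emeasure_bounded_finite)
  let ?T = "{w. A *v w + c \<in> S}"
  have "continuous_on UNIV (\<lambda>w. A *v w + c)" by (intro continuous_intros)
  then have "(\<lambda>w. A *v w + c) -` S \<inter> space borel \<in> sets borel"
    by (intro measurable_sets[OF borel_measurable_continuous_onI S(1)])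
  then have T: "?T \<in> sets borel" by (simp add: vimage_def)
  have T_eq: "?T = (*v) B ` S1"
    unfolding S1_def image_image
    by (force intro: image_eqI[of _ _ "A *v w + c" for w] simp: matrix_vector_mul_assoc BA)
  have "to_wo ` ?T = (*v) (mat_to_wo B) ` to_wo ` S1"
    by (simp add: T_eq image_image mat_to_wo_mult)
  moreover have "to_wo ` S1 \<in> lmeasurable"
    using to_wo_image[OF S1] fS1 by (intro fmeasurableI) auto
  ultimately have "measure lebesgue (to_wo ` ?T) = \<bar>det B\<bar> * measure lebesgue (to_wo ` S1)"
    "to_wo ` ?T \<in> lmeasurable"
    using measure_linear_image[of "(*v) (mat_to_wo B)" "to_wo ` S1"]
      measurable_linear_image[of "(*v) (mat_to_wo B)" "to_wo ` S1"]
    by (simp_all add: det_mat_to_wo)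
  moreover from this(2) have "emeasure lborel ?T < \<infinity>"
    using to_wo_image[OF T] by (simp add: fmeasurable_def)
  moreover have "measure lebesgue (to_wo ` X) = measure lborel X" if "X \<in> sets borel" for X :: "(real ^ 'n) set"
  proof -
    have "measure lebesgue (to_wo ` X) = measure lborel (to_wo ` X)"
      using to_wo_image(1)[OF that] by simp
    also have "\<dots> = measure lborel X" unfolding measure_def to_wo_image(2)[OF that] ..
    finally show ?thesis .
  qed
  ultimately have "measure lborel ?T = measure lborel S / \<bar>det A\<bar>"
    using T S1 mS1 detB by simp
  then show ?thesis
    using \<open>emeasure lborel ?T < \<infinity>\<close> by (simp add: emeasure_eq_ennreal_measure)
qed

subsection \<open>Product measures\<close>

lemma borel_measurable_vec_lambda:
  fixes f :: "'a \<Rightarrow> 'n::finite \<Rightarrow> real"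
  assumes "\<And>i. (\<lambda>x. f x i) \<in> borel_measurable M"
  shows "(\<lambda>x. \<chi> i. f x i) \<in> borel_measurable M"
proof (rule borel_measurable_euclidean_space[THEN iffD2], rule ballI)
  fix b :: "real ^ 'n" assume "b \<in> Basis"
  then obtain i where "b = axis i 1" by (auto simp: Basis_vec_def)
  then show "(\<lambda>x. (\<chi> i. f x i) \<bullet> b) \<in> borel_measurable M"
    using assms[of i] by (simp add: inner_axis)
qed

text \<open>This turns integration over the coordinates of one block of fractional parts into
  integration over a Euclidean vector.\<close>

lemma distr_PiM_block:
  fixes f :: "'n::finite \<Rightarrow> 'i"
  assumes f: "inj f"
  shows "distr (Pi\<^sub>M (range f) (\<lambda>_. lborel)) borel (\<lambda>\<theta>. \<chi> i. \<theta> (f i)) = (lborel :: (real ^ 'n) measure)"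
proof (rule lborel_eqI[symmetric])
  interpret product_sigma_finite "\<lambda>_. lborel :: real measure" by (rule product_sigma_finite_lborel)
  let ?M = "Pi\<^sub>M (range f) (\<lambda>_. lborel :: real measure)"
  fix l u :: "real ^ 'n" assume "\<And>b. b \<in> Basis \<Longrightarrow> l \<bullet> b \<le> u \<bullet> b"
  then have lu: "l $ i \<le> u $ i" for i by (rule Basis_le_cart)
  have "(\<lambda>\<theta>. \<theta> (f i)) \<in> borel_measurable ?M" for i
    using measurable_component_singleton[of "f i" "range f" "\<lambda>_. lborel :: real measure"] by simp
  then have m: "(\<lambda>\<theta>. \<chi> i. \<theta> (f i)) \<in> borel_measurable ?M"
    by (rule borel_measurable_vec_lambda)
  have eq: "(\<lambda>\<theta>. \<chi> i. \<theta> (f i)) -` box l u \<inter> space ?M =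
      Pi\<^sub>E (range f) (\<lambda>j. {l $ inv f j<..<u $ inv f j})"
    using f by (auto simp: mem_box_cart space_PiM PiE_iff)
  have "emeasure (distr ?M borel (\<lambda>\<theta>. \<chi> i. \<theta> (f i))) (box l u) =
      (\<Prod>j\<in>range f. emeasure lborel {l $ inv f j<..<u $ inv f j})"
    using m by (simp add: emeasure_distr eq emeasure_PiM)
  also have "\<dots> = (\<Prod>i\<in>UNIV. emeasure lborel {l $ i<..<u $ i})"
    using f by (simp add: prod.reindex)
  also have "\<dots> = (\<Prod>i\<in>UNIV. u $ i - l $ i)"
    using lu by (simp add: prod_ennreal)
  finally show "emeasure (distr ?M borel (\<lambda>\<theta>. \<chi> i. \<theta> (f i))) (box l u) = (\<Prod>b\<in>Basis. (u - l) \<bullet> b)"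
    by (simp only: prod_Basis_cart)
qed simp

text \<open>The direction of Fubini that passes from almost all sections to the product, hence the
  measurability of \<open>P\<close>.\<close>

lemma AE_PiM_merge:
  fixes P :: "('i \<Rightarrow> real) \<Rightarrow> bool"
  assumes IJ: "I \<inter> J = {}" "finite I" "finite J"
    and P: "Measurable.pred (Pi\<^sub>M (I \<union> J) (\<lambda>_. lborel)) P"
    and AE: "AE x in Pi\<^sub>M I (\<lambda>_. lborel). AE y in Pi\<^sub>M J (\<lambda>_. lborel). P (merge I J (x, y))"
  shows "AE z in Pi\<^sub>M (I \<union> J) (\<lambda>_. lborel). P z"
proof -
  interpret product_sigma_finite "\<lambda>_. lborel :: real measure" by (rule product_sigma_finite_lborel)
  interpret I: finite_product_sigma_finite "\<lambda>_. lborel :: real measure" I by standard fact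
  interpret J: finite_product_sigma_finite "\<lambda>_. lborel :: real measure" J by standard fact
  let ?I = "Pi\<^sub>M I (\<lambda>_. lborel :: real measure)" and ?J = "Pi\<^sub>M J (\<lambda>_. lborel :: real measure)"
  let ?IJ = "Pi\<^sub>M (I \<union> J) (\<lambda>_. lborel :: real measure)"
  interpret P: pair_sigma_finite ?I ?J by standard
  have P': "Measurable.pred (?I \<Otimes>\<^sub>M ?J) (\<lambda>x. P (merge I J x))"
    by (rule measurable_compose[OF measurable_merge P])
  have "AE x in ?I \<Otimes>\<^sub>M ?J. P (merge I J x)"
    by (rule P.AE_pair_measure) (use P' AE in auto)
  then have "AE z in distr (?I \<Otimes>\<^sub>M ?J) ?IJ (merge I J). P z"
    using P by (subst AE_distr_iff) auto
  then show ?thesis unfolding distr_merge[OF IJ] .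
qed

lemma AE_PiM_restrict:
  fixes P :: "('i \<Rightarrow> real) \<Rightarrow> bool"
  assumes IJ: "I \<inter> J = {}" "finite I" "finite J"
    and P: "Measurable.pred (Pi\<^sub>M I (\<lambda>_. lborel)) P" and AE: "AE x in Pi\<^sub>M I (\<lambda>_. lborel). P x"
  shows "AE z in Pi\<^sub>M (I \<union> J) (\<lambda>_. lborel). P (restrict z I)"
proof (rule AE_PiM_merge[OF IJ])
  show "Measurable.pred (Pi\<^sub>M (I \<union> J) (\<lambda>_. lborel)) (\<lambda>z. P (restrict z I))"
    by (rule measurable_compose[OF measurable_restrict_subset P]) simp
  show "AE x in Pi\<^sub>M I (\<lambda>_. lborel). AE y in Pi\<^sub>M J (\<lambda>_. lborel). P (restrict (merge I J (x, y)) I)"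
    using AE AE_space
  proof eventually_elim
    case (elim x)
    then have "restrict (merge I J (x, y)) I = x" for y
      using IJ(1) by (simp add: space_PiM PiE_def extensional_restrict)
    then show ?case using elim by simp
  qed
qed

section \<open>Open sets of a finite product: coordinate neighbourhoods and measurability\<close>

lemma openin_product_euclidean_box:
  assumes I: "finite I" and U: "openin (product_topology (\<lambda>_. euclideanreal) I) U" and \<theta>: "\<theta> \<in> U"
  shows "\<exists>d>0. \<forall>\<phi>\<in>I \<rightarrow>\<^sub>E UNIV. (\<forall>i\<in>I. \<bar>\<phi> i - \<theta> i\<bar> < d) \<longrightarrow> \<phi> \<in> U"
proof -
  obtain W where W: "\<And>i. i \<in> I \<Longrightarrow> open (W i)" "\<theta> \<in> Pi\<^sub>E I W" "Pi\<^sub>E I W \<subseteq> U"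
  proof -
    obtain W where "\<forall>i\<in>I. openin euclideanreal (W i)" "\<theta> \<in> Pi\<^sub>E I W" "Pi\<^sub>E I W \<subseteq> U"
      using U \<theta> unfolding openin_product_topology_alt by blast
    then show ?thesis using that open_openin by metis
  qed
  have "\<exists>r>0. \<forall>t. \<bar>t - \<theta> i\<bar> < r \<longrightarrow> t \<in> W i" if "i \<in> I" for i
  proof -
    have "\<theta> i \<in> W i" using W(2) that by auto
    then show ?thesis using W(1)[OF that] unfolding open_dist dist_real_def by blast
  qed
  then obtain r where r: "\<And>i. i \<in> I \<Longrightarrow> r i > 0" "\<And>i t. i \<in> I \<Longrightarrow> \<bar>t - \<theta> i\<bar> < r i \<Longrightarrow> t \<in> W i"
    by metis
  \<comment> \<open>Inserting 1 keeps the minimum defined when \<open>I\<close> is empty.\<close>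
  define d where "d = Min (insert 1 (r ` I))"
  have "d > 0" using r(1) I by (simp add: d_def)
  moreover have d: "d \<le> r i" if "i \<in> I" for i using that I by (simp add: d_def)
  have "\<phi> \<in> U" if "\<phi> \<in> I \<rightarrow>\<^sub>E UNIV" "\<forall>i\<in>I. \<bar>\<phi> i - \<theta> i\<bar> < d" for \<phi>
  proof -
    have "\<phi> i \<in> W i" if "i \<in> I" for i
      using r(2)[OF that] d[OF that] \<open>\<forall>i\<in>I. \<bar>\<phi> i - \<theta> i\<bar> < d\<close> that by (meson less_le_trans)
    then show ?thesis
      using \<open>\<phi> \<in> I \<rightarrow>\<^sub>E UNIV\<close> by (intro subsetD[OF W(3)]) (auto simp: PiE_iff)
  qed
  ultimately show ?thesis by blast
qed

lemma openin_product_euclidean_sets: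
  fixes I :: "'i::countable set"
  assumes U: "openin (product_topology (\<lambda>_. euclideanreal) I) U"
  shows "U \<in> sets (Pi\<^sub>M I (\<lambda>_. lborel))"
proof -
  have "continuous_map (product_topology (\<lambda>_. euclideanreal) UNIV) (product_topology (\<lambda>_. euclideanreal) I) (\<lambda>f. restrict f I)"
    unfolding continuous_map_componentwise
    using continuous_map_product_projection[of _ UNIV "\<lambda>_. euclideanreal"] by auto
  then have "openin (product_topology (\<lambda>_. euclideanreal) UNIV) {f \<in> topspace (product_topology (\<lambda>_. euclideanreal) UNIV). restrict f I \<in> U}"
    using U by (rule openin_continuous_map_preimage)
  then have op: "open {f :: 'i \<Rightarrow> real. restrict f I \<in> U}"
    by (simp add: euclidean_product_topology)
  \<comment> \<open>Extension by 0 embeds extensional functions into the full function space and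
    pulls the open set of all \<open>f\<close> with \<open>restrict f I\<close> in \<open>U\<close>
    back to \<open>U\<close>.\<close>
  define emb where "emb \<theta> i = (if i \<in> I then \<theta> i else 0)" for \<theta> :: "'i \<Rightarrow> real" and i
  have emb: "emb \<in> borel_measurable (Pi\<^sub>M I (\<lambda>_. lborel))"
  proof (rule measurable_coordinatewise_then_product)
    show "(\<lambda>\<theta>. emb \<theta> i) \<in> borel_measurable (Pi\<^sub>M I (\<lambda>_. lborel))" for i
      by (cases "i \<in> I") (auto simp: emb_def intro!: measurable_component_singleton)
  qed
  have "restrict (emb \<theta>) I = \<theta>" if "\<theta> \<in> I \<rightarrow>\<^sub>E UNIV" for \<theta>
    using that by (auto simp: emb_def fun_eq_iff PiE_iff extensional_def)
  moreover have "U \<subseteq> I \<rightarrow>\<^sub>E UNIV" using openin_subset[OF U] by simp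
  ultimately have "U = emb -` {f. restrict f I \<in> U} \<inter> space (Pi\<^sub>M I (\<lambda>_. lborel))"
    by (auto simp: space_PiM)
  then show ?thesis using measurable_sets[OF emb borel_open[OF op]] by simp
qed

subsection \<open>Integer translates\<close>

lemma real_vec_simps [simp]: "real_vec 0 = 0" "real_vec (x + y) = real_vec x + real_vec y"
  "real_vec (x - y) = real_vec x - real_vec y" "real_vec (- x) = - real_vec x"
  by (simp_all add: real_vec_def vec_eq_iff)

definition vfloor :: "real ^ 'n \<Rightarrow> int ^ 'n" where
  "vfloor v = (\<chi> i. \<lfloor>v $ i\<rfloor>)"

definition unit_cube :: "(real ^ 'n) set" where
  "unit_cube = {v. \<forall>i. 0 \<le> v $ i \<and> v $ i < 1}"

lemma vfloor_add: "vfloor (v + real_vec z) = vfloor v + z"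
  by (simp add: vfloor_def real_vec_def vec_eq_iff)

lemma diff_vfloor_in_unit_cube: "v - real_vec (vfloor v) \<in> unit_cube"
  by (auto simp: unit_cube_def vfloor_def real_vec_def) (linarith+)

lemma diff_in_unit_cube_iff: "v - real_vec z \<in> unit_cube \<longleftrightarrow> z = vfloor v"
proof
  assume "v - real_vec z \<in> unit_cube"
  then show "z = vfloor v"
    unfolding vec_eq_iff
    by (auto simp: unit_cube_def vfloor_def real_vec_def algebra_simps intro!: floor_unique[symmetric])
qed (simp add: diff_vfloor_in_unit_cube)

lemma measurable_vec_nth [measurable]: "(\<lambda>v. v $ i) \<in> borel_measurable (borel :: (real ^ 'n) measure)"
  by (intro borel_measurable_continuous_onI continuous_intros)

lemma unit_cube_sets [measurable]: "unit_cube \<in> sets (borel :: (real ^ 'n) measure)"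
  unfolding unit_cube_def by measurable

lemma norm_unit_cube: "norm (v :: real ^ 'n) \<le> real CARD('n)" if "v \<in> unit_cube"
proof -
  have "norm v \<le> (\<Sum>i\<in>UNIV. \<bar>v $ i\<bar>)" by (rule norm_le_l1_cart)
  also have "\<dots> \<le> (\<Sum>i\<in>(UNIV :: 'n set). 1)"
    using that by (intro sum_mono) (simp add: unit_cube_def less_imp_le)
  finally show ?thesis by simp
qed

lemma emeasure_unit_cube: "emeasure lborel (unit_cube :: (real ^ 'n) set) = 1"
proof -
  let ?f = "id :: 'n \<Rightarrow> 'n"
  interpret product_sigma_finite "\<lambda>_. lborel :: real measure" by (rule product_sigma_finite_lborel)
  let ?M = "Pi\<^sub>M (range ?f) (\<lambda>_. lborel :: real measure)"
  have "(\<lambda>\<theta>. \<theta> (?f i)) \<in> borel_measurable ?M" for i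
    using measurable_component_singleton[of "?f i" "range ?f" "\<lambda>_. lborel :: real measure"] by simp
  then have m: "(\<lambda>\<theta>. \<chi> i. \<theta> (?f i)) \<in> borel_measurable ?M"
    by (rule borel_measurable_vec_lambda)
  have "(\<lambda>\<theta>. \<chi> i. \<theta> (?f i)) -` unit_cube \<inter> space ?M = Pi\<^sub>E (range ?f) (\<lambda>j. {0..<1})"
    by (auto simp: unit_cube_def space_PiM PiE_iff)
  then have "emeasure (distr ?M borel (\<lambda>\<theta>. \<chi> i. \<theta> (?f i))) unit_cube = 1"
    using m by (simp add: emeasure_distr emeasure_PiM)
  moreover have "distr ?M borel (\<lambda>\<theta>. \<chi> i. \<theta> (?f i)) = lborel" by (rule distr_PiM_block) simp
  ultimately show ?thesis by metis
qed

text \<open>Each \<open>w\<close> lies in exactly one reflected cube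
  \<open>real_vec j - unit_cube\<close>. The reflected form is chosen to match the expression
  \<open>real_vec j - t (Suc N)\<close> inside \<open>unwind\<close>.\<close>

lemma nn_integral_tiling:
  fixes f :: "real ^ 'n \<Rightarrow> ennreal"
  assumes f [measurable]: "f \<in> borel_measurable borel"
  shows "(\<integral>\<^sup>+w. f w \<partial>lborel) =
    (\<integral>\<^sup>+v. indicator unit_cube v * (\<integral>\<^sup>+j. f (real_vec j - v) \<partial>count_space UNIV) \<partial>lborel)"
proof -
  have "(\<integral>\<^sup>+j. indicator unit_cube (real_vec j - w) \<partial>count_space UNIV) = (1::ennreal)" for w :: "real ^ 'n"
  proof -
    have "real_vec j - w \<in> unit_cube \<longleftrightarrow> j \<in> {- vfloor (- w)}" for j
    proof -
      have "- j = vfloor (- w) \<longleftrightarrow> j = - vfloor (- w)" by (metis add.inverse_inverse)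
      then show ?thesis using diff_in_unit_cube_iff[of "- w" "- j"] by simp
    qed
    then have "(\<lambda>j. indicator unit_cube (real_vec j - w)) = (indicator {- vfloor (- w)} :: _ \<Rightarrow> ennreal)"
      by (auto simp: fun_eq_iff indicator_def)
    then show ?thesis by simp
  qed
  then have "(\<integral>\<^sup>+w. f w \<partial>lborel) =
      (\<integral>\<^sup>+w. \<integral>\<^sup>+j. f w * indicator unit_cube (real_vec j - w) \<partial>count_space UNIV \<partial>lborel)"
    by (simp add: nn_integral_cmult)
  also have "\<dots> = (\<integral>\<^sup>+j. \<integral>\<^sup>+w. f w * indicator unit_cube (real_vec j - w) \<partial>lborel \<partial>count_space UNIV)"
    by (rule nn_integral_count_space_nn_integral) (auto intro: countableI_type)
  also have "\<dots> = (\<integral>\<^sup>+j. \<integral>\<^sup>+v. f (real_vec j - v) * indicator unit_cube v \<partial>lborel \<partial>count_space UNIV)"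
  proof (rule nn_integral_cong)
    fix j :: "int ^ 'n"
    \<comment> \<open>Reflection scales by -1, whose absolute value contributes the density
      1.\<close>
    have "lborel = density (distr lborel borel (\<lambda>v. real_vec j + (-1) *\<^sub>R v)) (\<lambda>_. ennreal (\<bar>-1\<bar> ^ DIM(real ^ 'n)))"
      by (rule lborel_affine) simp
    then have d: "lborel = distr lborel borel (\<lambda>v. real_vec j - v)" by (simp add: density_1)
    have "(\<integral>\<^sup>+w. f w * indicator unit_cube (real_vec j - w) \<partial>lborel) =
      (\<integral>\<^sup>+w. f w * indicator unit_cube (real_vec j - w) \<partial>distr lborel borel (\<lambda>v. real_vec j - v))"
      by (subst d) rule
    also have "\<dots> = (\<integral>\<^sup>+v. f (real_vec j - v) * indicator unit_cube v \<partial>lborel)"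
      by (subst nn_integral_distr) simp_all
    finally show "(\<integral>\<^sup>+w. f w * indicator unit_cube (real_vec j - w) \<partial>lborel) =
      (\<integral>\<^sup>+v. f (real_vec j - v) * indicator unit_cube v \<partial>lborel)" .
  qed
  also have "\<dots> = (\<integral>\<^sup>+v. \<integral>\<^sup>+j. f (real_vec j - v) * indicator unit_cube v \<partial>count_space UNIV \<partial>lborel)"
    by (rule nn_integral_count_space_nn_integral[symmetric]) (auto intro: countableI_type)
  also have "\<dots> = (\<integral>\<^sup>+v. indicator unit_cube v * (\<integral>\<^sup>+j. f (real_vec j - v) \<partial>count_space UNIV) \<partial>lborel)"
    by (simp add: nn_integral_cmult mult.commute)
  finally show ?thesis .
qed

subsection \<open>A Borel measurable modification of a quantizer\<close>

text \<open>Translates by all integer vectors are included so that the exceptional set is itself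
  invariant under integer translations.\<close>

definition quantizer_boundary :: "(real ^ 'n \<Rightarrow> int ^ 'n) \<Rightarrow> (real ^ 'n) set" where
  "quantizer_boundary R = (\<Union>z. (\<lambda>u. real_vec z + u) ` frontier (R -` {0}))"

text \<open>The cells of a quantizer need not be Borel sets. This modification is measurable, still
  commutes with integer translations, and changes the quantizer only on a null set.\<close>

definition borel_quantizer :: "(real ^ 'n \<Rightarrow> int ^ 'n) \<Rightarrow> real ^ 'n \<Rightarrow> int ^ 'n" where
  "borel_quantizer R u = (if u \<in> quantizer_boundary R then vfloor u else R u)"

lemma quantizer_equivariant: "quantizer R \<Longrightarrow> R (u + real_vec z) = R u + z"
  by (simp add: quantizer_def)

lemma mem_quantizer_boundary:
  "u \<in> quantizer_boundary R \<longleftrightarrow> (\<exists>z. u - real_vec z \<in> frontier (R -` {0}))"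
proof -
  have "u \<in> (\<lambda>u. real_vec z + u) ` frontier (R -` {0}) \<longleftrightarrow> u - real_vec z \<in> frontier (R -` {0})" for z
    by (auto intro: image_eqI[of _ _ "u - real_vec z"])
  then show ?thesis by (simp add: quantizer_boundary_def)
qed

lemma quantizer_boundary_add:
  "u + real_vec z \<in> quantizer_boundary R \<longleftrightarrow> u \<in> quantizer_boundary R"
proof
  assume "u + real_vec z \<in> quantizer_boundary R"
  then obtain z' where "u + real_vec z - real_vec z' \<in> frontier (R -` {0})"
    unfolding mem_quantizer_boundary by blast
  then have "u - real_vec (z' - z) \<in> frontier (R -` {0})" by (simp add: algebra_simps)
  then show "u \<in> quantizer_boundary R" unfolding mem_quantizer_boundary by blast
next
  assume "u \<in> quantizer_boundary R"
  then obtain z' where "u - real_vec z' \<in> frontier (R -` {0})"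
    unfolding mem_quantizer_boundary by blast
  then have "u + real_vec z - real_vec (z' + z) \<in> frontier (R -` {0})" by (simp add: algebra_simps)
  then show "u + real_vec z \<in> quantizer_boundary R" unfolding mem_quantizer_boundary by blast
qed

lemma quantizer_boundary_null:
  assumes "quantizer R"
  shows "quantizer_boundary R \<in> null_sets lborel"
proof -
  have neg: "negligible (frontier (R -` {0}))"
    using assms by (simp add: quantizer_def jordan_measurable_def)
  have "(\<lambda>u. real_vec z + u) ` frontier (R -` {0}) \<in> null_sets lborel" for z
  proof -
    have "closed ((\<lambda>u. real_vec z + u) ` frontier (R -` {0}))"
      by (intro closed_translation frontier_closed)
    moreover have "negligible ((\<lambda>u. real_vec z + u) ` frontier (R -` {0}))"
      by (rule negligible_translation[OF neg])
    ultimately show ?thesis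
      by (auto simp: negligible_iff_null_sets null_sets_def)
  qed
  then show ?thesis unfolding quantizer_boundary_def
    by (intro null_sets_UN') (auto intro: countableI_type)
qed

text \<open>Subtracting \<open>R u\<close> moves \<open>u\<close> into the zero cell, and away from
  the frontier it is an interior point of that cell.\<close>

lemma quantizer_locally_constant:
  assumes R: "quantizer R" and u: "u \<notin> quantizer_boundary R"
  shows "\<exists>e>0. \<forall>w. dist w u < e \<longrightarrow> R w = R u"
proof -
  have eq: "R (w - real_vec (R u)) = R w - R u" for w
    using quantizer_equivariant[OF R, of w "- R u"] by simp
  have "u - real_vec (R u) \<in> R -` {0}" by (simp add: eq)
  moreover have "u - real_vec (R u) \<notin> frontier (R -` {0})"
    using u unfolding mem_quantizer_boundary by blast
  ultimately have "u - real_vec (R u) \<in> interior (R -` {0})"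
    using closure_subset[of "R -` {0}"] unfolding frontier_def by blast
  then obtain e where e: "e > 0" "ball (u - real_vec (R u)) e \<subseteq> R -` {0}"
    unfolding mem_interior by blast
  have "R w = R u" if "dist w u < e" for w
  proof -
    have "w - real_vec (R u) \<in> ball (u - real_vec (R u)) e"
      using that by (simp add: dist_norm norm_minus_commute)
    then have "R (w - real_vec (R u)) = 0" using e(2) by blast
    then show ?thesis by (simp add: eq)
  qed
  then show ?thesis using e(1) by blast
qed

lemma borel_quantizer_equivariant:
  "quantizer R \<Longrightarrow> borel_quantizer R (u + real_vec z) = borel_quantizer R u + z"
  by (simp add: borel_quantizer_def quantizer_boundary_add vfloor_add quantizer_equivariant)

lemma measurable_vfloor [measurable]: "vfloor \<in> borel \<rightarrow>\<^sub>M count_space UNIV"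
proof -
  have eq: "vfloor -` {z} = {v. v - real_vec z \<in> unit_cube}" for z :: "int ^ 'n"
    by (auto simp: diff_in_unit_cube_iff)
  have "vfloor -` {z} \<in> sets borel" for z :: "int ^ 'n"
    unfolding eq by measurable
  then show ?thesis
    by (subst measurable_count_space_eq2_countable) auto
qed

text \<open>Off the boundary set a point of the zero cell is an interior point, so each level set is
  assembled from the Borel set \<open>?D\<close>, a level set of \<open>vfloor\<close> and a
  translated open set.\<close>

lemma measurable_borel_quantizer:
  assumes R: "quantizer R"
  shows "borel_quantizer R \<in> borel \<rightarrow>\<^sub>M count_space UNIV"
proof -
  let ?D = "quantizer_boundary R"
  have D: "?D \<in> sets borel" using quantizer_boundary_null[OF R] by auto
  have "borel_quantizer R -` {z} = (?D \<inter> vfloor -` {z}) \<union> ((\<lambda>u. u - real_vec z) -` interior (R -` {0}) - ?D)" for z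
  proof -
    have "R u = z \<longleftrightarrow> u - real_vec z \<in> interior (R -` {0})" if "u \<notin> ?D" for u
    proof -
      have "R (u - real_vec z) = R u - z"
        using quantizer_equivariant[OF R, of u "- z"] by simp
      then have "R u = z \<longleftrightarrow> u - real_vec z \<in> R -` {0}" by auto
      moreover have "u - real_vec z \<notin> frontier (R -` {0})"
        using that unfolding mem_quantizer_boundary by blast
      ultimately show ?thesis
        using closure_subset[of "R -` {0}"] interior_subset[of "R -` {0}"]
        unfolding frontier_def by blast
    qed
    note iff = this
    show ?thesis
    proof (rule set_eqI)
      fix u
      show "u \<in> borel_quantizer R -` {z} \<longleftrightarrow>
          u \<in> (?D \<inter> vfloor -` {z}) \<union> ((\<lambda>u. u - real_vec z) -` interior (R -` {0}) - ?D)"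
        using iff[of u] by (cases "u \<in> ?D") (simp_all add: borel_quantizer_def)
    qed
  qed
  moreover have "(\<lambda>u. u - real_vec z) -` interior (R -` {0}) \<in> sets borel" for z
    by (intro borel_open open_vimage continuous_intros) simp
  moreover have "vfloor -` {z} \<in> sets borel" for z :: "int ^ 'n"
    using measurable_sets[OF measurable_vfloor, of "{z}"] by simp
  ultimately have "borel_quantizer R -` {z} \<in> sets borel" for z
    using D by auto
  then show ?thesis
    by (subst measurable_count_space_eq2_countable) auto
qed

lemma quantizer_bounded:
  fixes R :: "real ^ 'n \<Rightarrow> int ^ 'n"
  assumes R: "quantizer R"
  shows "\<exists>r. \<forall>u. norm (u - real_vec (R u)) \<le> r"
proof -
  obtain r where "\<forall>v\<in>R -` {0}. norm v \<le> r"
    using R unfolding quantizer_def jordan_measurable_def bounded_iff by blast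
  then have r: "\<And>v. R v = 0 \<Longrightarrow> norm v \<le> r" by simp
  have "R (u - real_vec (R u)) = 0" for u
    using quantizer_equivariant[OF R, of u "- R u"] by simp
  then show ?thesis using r by blast
qed

lemma borel_quantizer_bounded:
  fixes R :: "real ^ 'n \<Rightarrow> int ^ 'n"
  assumes R: "quantizer R"
  shows "\<exists>r. \<forall>u. norm (u - real_vec (borel_quantizer R u)) \<le> r"
proof -
  obtain r where "\<And>u. norm (u - real_vec (R u)) \<le> r" using quantizer_bounded[OF R] by blast
  then have "norm (u - real_vec (borel_quantizer R u)) \<le> max r (real CARD('n))" for u
    using norm_unit_cube[OF diff_vfloor_in_unit_cube, of u] by (simp add: borel_quantizer_def le_max_iff_disj)
  then show ?thesis by blast
qed

text \<open>By equivariance, for every \<open>v\<close> exactly one integer vector \<open>j\<close>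
  puts \<open>real_vec j - v\<close> into the cell. The tiling formula then reduces its volume to
  that of the unit cube.\<close>

lemma emeasure_quantizer_cell:
  assumes meas: "R \<in> borel \<rightarrow>\<^sub>M count_space UNIV"
    and equiv: "\<And>u z. R (u + real_vec z) = R u + z"
  shows "emeasure lborel (R -` {s}) = 1"
proof -
  have S: "R -` {s} \<in> sets borel" using measurable_sets[OF meas, of "{s}"] by simp
  have "(\<integral>\<^sup>+j. indicator (R -` {s}) (real_vec j - v) \<partial>count_space UNIV) = (1::ennreal)" for v
  proof -
    have "R (real_vec j - v) = s \<longleftrightarrow> j = s - R (- v)" for j
      using equiv[of "- v" j] by (auto simp: algebra_simps)
    then have "(\<lambda>j. indicator (R -` {s}) (real_vec j - v)) = (indicator {s - R (- v)} :: _ \<Rightarrow> ennreal)"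
      by (auto simp: fun_eq_iff indicator_def)
    then show ?thesis by simp
  qed
  then show ?thesis
    using nn_integral_tiling[of "indicator (R -` {s})"] S by (simp add: emeasure_unit_cube)
qed

subsection \<open>Backward orbits in fractional coordinates\<close>

text \<open>If \<open>y k + t k\<close> is a real backward orbit of \<open>y 0 + t 0\<close> under \<open>L\<close> with \<open>y k\<close> integral, then
  \<open>unwind R L t N j\<close> is the difference to \<open>y 0\<close> after \<open>N\<close> steps of the quantized map
  started at \<open>y N + j\<close>.\<close>

primrec unwind :: "(real ^ 'n \<Rightarrow> int ^ 'n) \<Rightarrow> real ^ 'n ^ 'n \<Rightarrow> (nat \<Rightarrow> real ^ 'n) \<Rightarrow> nat \<Rightarrow> int ^ 'n \<Rightarrow> int ^ 'n" where
  "unwind R L t 0 j = j"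
| "unwind R L t (Suc N) j = unwind R L t N (R (L *v (real_vec j - t (Suc N)) + t N))"

text \<open>These are the shifts \<open>j\<close> for which \<open>y N + j\<close> is an
  \<open>N\<close>-step preimage of \<open>y 0\<close>; the orbit enters only through the fractional
  parts \<open>t\<close>.\<close>

definition fiber :: "(real ^ 'n \<Rightarrow> int ^ 'n) \<Rightarrow> real ^ 'n ^ 'n \<Rightarrow> (nat \<Rightarrow> real ^ 'n) \<Rightarrow> nat \<Rightarrow> (int ^ 'n) set" where
  "fiber R L t N = {j. unwind R L t N j = 0}"

text \<open>Peeling off the first application of the map at \<open>y (Suc N) + j\<close>, linearity
  isolates the integer vector \<open>y N\<close>, and equivariance pulls it out of
  \<open>R\<close>.\<close>

lemma funpow_quantized_map_unwind:
  assumes equiv: "\<And>u z. R (u + real_vec z) = R u + z"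
    and y: "\<And>k. k < N \<Longrightarrow> L *v (real_vec (y (Suc k)) + t (Suc k)) = real_vec (y k) + t k"
  shows "(quantized_map R L ^^ N) (y N + j) = y 0 + unwind R L t N j"
  using y
proof (induction N arbitrary: j)
  case (Suc N)
  have "L *v real_vec (y (Suc N) + j) =
      L *v (real_vec (y (Suc N)) + t (Suc N)) + L *v (real_vec j - t (Suc N))"
    by (simp flip: matrix_vector_right_distrib)
  also have "\<dots> = (L *v (real_vec j - t (Suc N)) + t N) + real_vec (y N)"
    using Suc.prems[of N] by simp
  finally have "quantized_map R L (y (Suc N) + j) = R (L *v (real_vec j - t (Suc N)) + t N) + y N"
    unfolding quantized_map_def by (simp only: equiv)
  then show ?case
    using Suc.IH[of "R (L *v (real_vec j - t (Suc N)) + t N)"] Suc.prems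
    by (simp add: funpow_Suc_right add.commute del: funpow.simps)
qed simp

lemma unwind_cong:
  "(\<And>k. k \<le> N \<Longrightarrow> t k = t' k) \<Longrightarrow> unwind R L t N j = unwind R L t' N j"
  by (induction N arbitrary: j) auto

lemma fiber_cong: "(\<And>k. k \<le> N \<Longrightarrow> t k = t' k) \<Longrightarrow> fiber R L t N = fiber R L t' N"
  unfolding fiber_def using unwind_cong[of N t t'] by auto

lemma preimage_count_eq_card_fiber:
  assumes equiv: "\<And>u z. R (u + real_vec z) = R u + z"
    and y: "\<And>k. k < N \<Longrightarrow> L *v (real_vec (y (Suc k)) + t (Suc k)) = real_vec (y k) + t k"
  shows "preimage_count (quantized_map R L) N (y 0) = card (fiber R L t N)"
proof -
  have "{z. (quantized_map R L ^^ N) z = y 0} = (\<lambda>j. y N + j) ` fiber R L t N"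
  proof (rule set_eqI)
    fix z
    have "(quantized_map R L ^^ N) z = y 0 + unwind R L t N (z - y N)"
      using funpow_quantized_map_unwind[of R N L y t "z - y N", OF equiv y] by simp
    moreover have "z \<in> (\<lambda>j. y N + j) ` fiber R L t N \<longleftrightarrow> unwind R L t N (z - y N) = 0"
      by (force simp: fiber_def intro: image_eqI[of _ _ "z - y N"])
    ultimately show "z \<in> {z. (quantized_map R L ^^ N) z = y 0} \<longleftrightarrow> z \<in> (\<lambda>j. y N + j) ` fiber R L t N"
      by simp
  qed
  then show ?thesis unfolding preimage_count_def by (simp add: card_image)
qed

text \<open>Going backwards, one step inverts \<open>R\<close>, which moves points by at most
  \<open>r\<close>, subtracts a fractional part of norm at most \<open>c\<close>, and applies the
  inverse of \<open>L\<close>, bounded by \<open>K\<close>. So a bound on the result yields a bound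
  on the starting shift.\<close>

lemma unwind_bounded:
  fixes R :: "real ^ 'n \<Rightarrow> int ^ 'n"
  assumes r: "\<And>u. norm (u - real_vec (R u)) \<le> r" and L: "det L \<noteq> 0"
  shows "\<exists>b. \<forall>t. (\<forall>k\<le>N. norm (t k) \<le> c) \<longrightarrow>
    (\<forall>j. norm (real_vec (unwind R L t N j)) \<le> a \<longrightarrow> norm (real_vec j) \<le> b)"
proof (induction N)
  case (Suc N)
  then obtain b where b: "\<And>t j. \<forall>k\<le>N. norm (t k) \<le> c \<Longrightarrow>
    norm (real_vec (unwind R L t N j)) \<le> a \<Longrightarrow> norm (real_vec j) \<le> b" by blast
  obtain B where B: "B ** L = mat 1"
    using L unfolding invertible_det_nz[symmetric] invertible_def by blast
  obtain K where K: "K > 0" "\<And>v. norm (B *v v) \<le> norm v * K"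
    using bounded_linear.pos_bounded[OF matrix_vector_mul_bounded_linear[of B]] by blast
  have "norm (real_vec j) \<le> (r + b + c) * K + c"
    if t: "\<forall>k\<le>Suc N. norm (t k) \<le> c" and j: "norm (real_vec (unwind R L t (Suc N) j)) \<le> a" for t j
  proof -
    define w where "w = L *v (real_vec j - t (Suc N))"
    have "norm (real_vec (R (w + t N))) \<le> b"
      using b[of t "R (w + t N)"] t j by (simp add: w_def)
    moreover have "norm (w + t N) \<le> norm (w + t N - real_vec (R (w + t N))) + norm (real_vec (R (w + t N)))"
      using norm_triangle_ineq[of "w + t N - real_vec (R (w + t N))" "real_vec (R (w + t N))"] by simp
    moreover have "norm w \<le> norm (w + t N) + norm (t N)"
      using norm_triangle_ineq4[of "w + t N" "t N"] by simp
    moreover have "norm (t N) \<le> c" "norm (t (Suc N)) \<le> c" using t by auto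
    ultimately have w: "norm w \<le> r + b + c" using r[of "w + t N"] by linarith
    have "B *v w = real_vec j - t (Suc N)"
      by (simp add: w_def matrix_vector_mul_assoc B)
    then have "norm (real_vec j - t (Suc N)) \<le> (r + b + c) * K"
      using order_trans[OF K(2)[of w] mult_right_mono[OF w]] K(1) by simp
    then show ?thesis
      using norm_triangle_ineq[of "real_vec j - t (Suc N)" "t (Suc N)"] \<open>norm (t (Suc N)) \<le> c\<close> by simp
  qed
  then show ?case by blast
qed auto

text \<open>One finite set contains the fibers for all bounded \<open>t\<close>, which turns
  cardinalities into sums over a fixed finite set.\<close>

lemma fiber_bounded:
  fixes R :: "real ^ 'n \<Rightarrow> int ^ 'n"
  assumes r: "\<And>u. norm (u - real_vec (R u)) \<le> r" and L: "det L \<noteq> 0"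
  shows "\<exists>B. finite B \<and> (\<forall>t. (\<forall>k\<le>N. norm (t k) \<le> c) \<longrightarrow> fiber R L t N \<subseteq> B)"
proof -
  obtain b where b: "\<And>t j. \<forall>k\<le>N. norm (t k) \<le> c \<Longrightarrow>
      norm (real_vec (unwind R L t N j)) \<le> 0 \<Longrightarrow> norm (real_vec j) \<le> b"
    using unwind_bounded[OF r L, of N c 0] by blast
  have "\<bar>j $ i\<bar> \<le> \<lfloor>b\<rfloor>" if "\<forall>k\<le>N. norm (t k) \<le> c" "j \<in> fiber R L t N" for t j i
  proof -
    have "norm (real_vec j) \<le> b" using b[OF that(1)] that(2) by (simp add: fiber_def)
    then have "\<bar>real_vec j $ i\<bar> \<le> b" using component_le_norm_cart order_trans by blast
    then show ?thesis by (simp add: real_vec_def le_floor_iff)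
  qed
  then show ?thesis
    by (intro exI[of _ "{j. \<forall>i. \<bar>j $ i\<bar> \<le> \<lfloor>b\<rfloor>}"]) (auto simp: finite_bounded_int_vecs)
qed

lemma unwind_locally_constant:
  fixes R :: "real ^ 'n \<Rightarrow> int ^ 'n"
  assumes R: "\<And>u. u \<notin> D \<Longrightarrow> \<exists>e>0. \<forall>w. dist w u < e \<longrightarrow> R w = R u"
    and t: "\<And>k j. k < N \<Longrightarrow> L *v (real_vec j - t (Suc k)) + t k \<notin> D"
  shows "\<exists>d>0. \<forall>t'. (\<forall>k\<le>N. dist (t' k) (t k) < d) \<longrightarrow> unwind R L t' N j = unwind R L t N j"
  using t
proof (induction N arbitrary: j)
  case (Suc N)
  let ?u = "\<lambda>t. L *v (real_vec j - t (Suc N)) + t N"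
  have "\<exists>d>0. \<forall>t'. (\<forall>k\<le>N. dist (t' k) (t k) < d) \<longrightarrow>
      unwind R L t' N (R (?u t)) = unwind R L t N (R (?u t))"
    by (rule Suc.IH) (rule Suc.prems, simp)
  then obtain d1 where d1: "d1 > 0" "\<And>t'. \<forall>k\<le>N. dist (t' k) (t k) < d1 \<Longrightarrow>
      unwind R L t' N (R (?u t)) = unwind R L t N (R (?u t))"
    by blast
  obtain e where e: "e > 0" "\<And>w. dist w (?u t) < e \<Longrightarrow> R w = R (?u t)"
    using R[OF Suc.prems[of N j]] by blast
  obtain K where K: "K > 0" "\<And>v. norm (L *v v) \<le> norm v * K"
    using bounded_linear.pos_bounded[OF matrix_vector_mul_bounded_linear[of L]] by blast
  \<comment> \<open>If each fractional part moves by less than \<open>d\<close>, the argument of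
    \<open>R\<close> moves by less than d K + d.\<close>
  define d where "d = min d1 (e / (K + 1))"
  have "d > 0" using d1(1) e(1) K(1) by (simp add: d_def)
  moreover have "unwind R L t' (Suc N) j = unwind R L t (Suc N) j"
    if t': "\<forall>k\<le>Suc N. dist (t' k) (t k) < d" for t'
  proof -
    have eq: "?u t' - ?u t = L *v (t (Suc N) - t' (Suc N)) + (t' N - t N)"
      by (simp add: algebra_simps matrix_vector_mult_diff_distrib)
    have "dist (?u t') (?u t) \<le> norm (L *v (t (Suc N) - t' (Suc N))) + norm (t' N - t N)"
      unfolding dist_norm eq by (rule norm_triangle_ineq)
    also have "\<dots> < d * K + d"
    proof (rule add_le_less_mono)
      have "dist (t' (Suc N)) (t (Suc N)) < d" using t' by blast
      then have "norm (t (Suc N) - t' (Suc N)) \<le> d" by (simp add: dist_norm norm_minus_commute)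
      then show "norm (L *v (t (Suc N) - t' (Suc N))) \<le> d * K"
        using K(2)[of "t (Suc N) - t' (Suc N)"] mult_right_mono[of _ d K] K(1) by (meson less_imp_le order_trans)
      show "norm (t' N - t N) < d" using t' by (auto simp: dist_norm)
    qed
    also have "\<dots> = d * (K + 1)" by (simp add: algebra_simps)
    also have "\<dots> \<le> e"
    proof -
      have "d \<le> e / (K + 1)" by (simp add: d_def)
      then show ?thesis using K(1) by (simp add: pos_le_divide_eq)
    qed
    finally have "R (?u t') = R (?u t)" by (rule e(2))
    moreover have "\<forall>k\<le>N. dist (t' k) (t k) < d1" using t' by (auto simp: d_def)
    ultimately show ?thesis using d1(2) by simp
  qed
  ultimately show ?case by blast
qed (auto intro: zero_less_one)

text \<open>Each shift \<open>j\<close> has its own radius of constancy. A positive common radius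
  exists because only the finitely many \<open>j\<close> in \<open>B\<close> can belong to any of
  the fibers compared.\<close>

lemma fiber_locally_constant:
  fixes R :: "real ^ 'n \<Rightarrow> int ^ 'n"
  assumes R: "\<And>u. u \<notin> D \<Longrightarrow> \<exists>e>0. \<forall>w. dist w u < e \<longrightarrow> R w = R u"
    and r: "\<And>u. norm (u - real_vec (R u)) \<le> r" and L: "det L \<noteq> 0"
    and t: "\<And>k j. k < N \<Longrightarrow> L *v (real_vec j - t (Suc k)) + t k \<notin> D"
    and c: "\<And>k. k \<le> N \<Longrightarrow> norm (t k) \<le> c"
  shows "\<exists>d>0. \<forall>t'. (\<forall>k\<le>N. norm (t' k) \<le> c \<and> dist (t' k) (t k) < d) \<longrightarrow> fiber R L t' N = fiber R L t N"
proof -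
  obtain B where B: "finite B" "\<And>t. \<forall>k\<le>N. norm (t k) \<le> c \<Longrightarrow> fiber R L t N \<subseteq> B"
    using fiber_bounded[OF r L, of N c] by blast
  have "\<exists>d>0. \<forall>t'. (\<forall>k\<le>N. dist (t' k) (t k) < d) \<longrightarrow> unwind R L t' N j = unwind R L t N j" for j
    by (rule unwind_locally_constant[where D = D]) (rule R, assumption, rule t, assumption)
  then obtain d where d: "\<And>j. d j > 0"
    "\<And>j t'. \<forall>k\<le>N. dist (t' k) (t k) < d j \<Longrightarrow> unwind R L t' N j = unwind R L t N j" by metis
  define d' where "d' = Min (insert 1 (d ` B))"
  have "d' > 0" using d(1) B(1) by (simp add: d'_def)
  moreover have d': "d' \<le> d j" if "j \<in> B" for j using that B(1) by (simp add: d'_def)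
  have "fiber R L t' N = fiber R L t N" if t': "\<forall>k\<le>N. norm (t' k) \<le> c \<and> dist (t' k) (t k) < d'" for t'
  proof -
    have "unwind R L t' N j = unwind R L t N j" if "j \<in> B" for j
      using t' d'[OF that] by (intro d(2)) force
    moreover have "fiber R L t' N \<subseteq> B" "fiber R L t N \<subseteq> B" using B(2) t' c by auto
    ultimately show ?thesis by (auto simp: fiber_def)
  qed
  ultimately show ?thesis by blast
qed

section \<open>Measurability and volume of one backward step\<close>

lemma measurable_unwind:
  fixes R :: "real ^ 'n \<Rightarrow> int ^ 'n"
  assumes R: "R \<in> borel \<rightarrow>\<^sub>M count_space UNIV"
    and t: "\<And>k. k \<le> N \<Longrightarrow> (\<lambda>\<omega>. t \<omega> k) \<in> borel_measurable M"
  shows "(\<lambda>\<omega>. unwind R L (t \<omega>) N j) \<in> M \<rightarrow>\<^sub>M count_space UNIV"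
  using t
proof (induction N arbitrary: j)
  case (Suc N)
  have lin: "(\<lambda>v. L *v v) \<in> borel_measurable borel"
    by (intro borel_measurable_continuous_onI linear_continuous_on matrix_vector_mul_bounded_linear)
  have "(\<lambda>\<omega>. L *v (real_vec j - t \<omega> (Suc N))) \<in> borel_measurable M"
    by (rule measurable_compose[OF _ lin]) (intro borel_measurable_diff borel_measurable_const Suc.prems, simp)
  then have *: "(\<lambda>\<omega>. R (L *v (real_vec j - t \<omega> (Suc N)) + t \<omega> N)) \<in> M \<rightarrow>\<^sub>M count_space UNIV"
    using Suc.prems by (intro measurable_compose[OF _ R] borel_measurable_add) auto
  \<comment> \<open>The intermediate value is a measurable function into a countable set, so each of
    its values can be treated separately.\<close>
  show ?case
    unfolding unwind.simps
  proof (rule measurable_compose_countable[where f = "\<lambda>j' \<omega>. unwind R L (t \<omega>) N j'"])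
    show "(\<lambda>\<omega>. unwind R L (t \<omega>) N j') \<in> M \<rightarrow>\<^sub>M count_space UNIV" for j'
      by (rule Suc.IH) (rule Suc.prems, simp)
  qed (rule *)
qed simp

lemma measure_quantizer_preimage:
  fixes R :: "real ^ 'n \<Rightarrow> int ^ 'n"
  assumes meas: "R \<in> borel \<rightarrow>\<^sub>M count_space UNIV"
    and equiv: "\<And>u z. R (u + real_vec z) = R u + z"
    and S: "finite S"
  shows "measure lborel (R -` S) = card S"
proof -
  have "emeasure lborel (\<Union>s\<in>S. R -` {s}) = (\<Sum>s\<in>S. emeasure lborel (R -` {s}))"
    using S measurable_sets[OF meas]
    by (intro sum_emeasure[symmetric]) (auto simp: disjoint_family_on_def)
  also have "\<dots> = of_nat (card S)"
    by (simp add: emeasure_quantizer_cell[OF meas equiv])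
  also have "(\<Union>s\<in>S. R -` {s}) = R -` S" by auto
  finally show ?thesis by (simp add: measure_def)
qed

text \<open>The heart of the martingale identity. The sum over integer shifts and the integral over
  the cube merge by tiling into the volume of the affine preimage of the cells with labels in
  \<open>S\<close>, and each cell has volume 1.\<close>

lemma nn_integral_shifted_fiber:
  fixes R :: "real ^ 'n \<Rightarrow> int ^ 'n"
  assumes meas: "R \<in> borel \<rightarrow>\<^sub>M count_space UNIV"
    and equiv: "\<And>u z. R (u + real_vec z) = R u + z"
    and r: "\<And>u. norm (u - real_vec (R u)) \<le> r"
    and L: "det L \<noteq> 0" and S: "finite S"
  shows "(\<integral>\<^sup>+v. indicator unit_cube v *
      (\<integral>\<^sup>+j. indicator {j. R (L *v (real_vec j - v) + c) \<in> S} j \<partial>count_space UNIV) \<partial>lborel) =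
    ennreal (card S / \<bar>det L\<bar>)"
proof -
  let ?E = "R -` S"
  have E: "?E \<in> sets borel" using measurable_sets[OF meas, of S] by simp
  have "bounded ?E"
  proof -
    obtain b where b: "\<And>s. s \<in> S \<Longrightarrow> norm (real_vec s) \<le> b"
      using S finite_imp_bounded[of "real_vec ` S"] by (auto simp: bounded_iff)
    have "norm u \<le> r + b" if "u \<in> ?E" for u
      using that r[of u] b[of "R u"] norm_triangle_ineq[of "u - real_vec (R u)" "real_vec (R u)"] by simp
    then show ?thesis by (auto simp: bounded_iff)
  qed
  let ?f = "indicator {w. L *v w + c \<in> ?E} :: real ^ 'n \<Rightarrow> ennreal"
  have "continuous_on UNIV (\<lambda>w. L *v w + c)" by (intro continuous_intros)
  then have "(\<lambda>w. L *v w + c) -` ?E \<inter> space borel \<in> sets borel"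
    by (intro measurable_sets[OF borel_measurable_continuous_onI E])
  then have m: "{w. L *v w + c \<in> ?E} \<in> sets borel" by (simp add: vimage_def)
  have "(\<integral>\<^sup>+v. indicator unit_cube v *
      (\<integral>\<^sup>+j. indicator {j. R (L *v (real_vec j - v) + c) \<in> S} j \<partial>count_space UNIV) \<partial>lborel) =
    (\<integral>\<^sup>+v. indicator unit_cube v * (\<integral>\<^sup>+j. ?f (real_vec j - v) \<partial>count_space UNIV) \<partial>lborel)"
    by (simp add: indicator_def)
  also have "\<dots> = (\<integral>\<^sup>+w. ?f w \<partial>lborel)"
    by (rule nn_integral_tiling[symmetric]) (use m in simp)
  also have "\<dots> = ennreal (measure lborel ?E / \<bar>det L\<bar>)"
    using m emeasure_lborel_affine_vimage[OF L E \<open>bounded ?E\<close>, of c] by simp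
  finally show ?thesis by (simp add: measure_quantizer_preimage[OF meas equiv S])
qed

subsection \<open>Coordinates of the backward algebras\<close>

definition block_index :: "nat \<Rightarrow> (int \<times> 'n) set" where
  "block_index N = {- int N .. - 1} \<times> UNIV"

text \<open>\<open>block \<theta> k\<close> collects the coordinates of the fractional part of \<open>L\<^sup>-\<^sup>k x\<close>; for \<open>k = 0\<close> it
  vanishes because \<open>x\<close> is integral.\<close>

definition block :: "(int \<times> 'n::finite \<Rightarrow> real) \<Rightarrow> nat \<Rightarrow> real ^ 'n" where
  "block \<theta> k = (if k = 0 then 0 else \<chi> i. \<theta> (- int k, i))"

lemma finite_block_index [simp]: "finite (block_index N :: (int \<times> 'n::finite) set)"
  by (simp add: block_index_def)

lemma mem_block_index: "(- int k, i) \<in> block_index N \<longleftrightarrow> k \<noteq> 0 \<and> k \<le> N"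
  by (auto simp: block_index_def)

lemma block_index_Suc:
  "block_index (Suc N) = block_index N \<union> range (\<lambda>i :: 'n. (- int (Suc N), i))"
  "block_index N \<inter> range (\<lambda>i :: 'n. (- int (Suc N), i)) = {}"
  by (auto simp: block_index_def)

lemma block_index_mono: "M \<le> N \<Longrightarrow> block_index M \<subseteq> block_index N"
  by (auto simp: block_index_def)

lemma block_in_unit_cube:
  assumes "\<theta> \<in> block_index N \<rightarrow>\<^sub>E {0..<1}" "k \<le> N"
  shows "block \<theta> k \<in> unit_cube"
  using assms by (auto simp: block_def unit_cube_def PiE_iff mem_block_index)

lemma norm_block:
  fixes \<theta> :: "int \<times> 'n::finite \<Rightarrow> real"
  assumes "\<theta> \<in> block_index N \<rightarrow>\<^sub>E {0..<1}" "k \<le> N"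
  shows "norm (block \<theta> k) \<le> real CARD('n)"
  by (rule norm_unit_cube[OF block_in_unit_cube[OF assms]])

lemma measurable_block:
  assumes "k \<le> N"
  shows "(\<lambda>\<theta> :: int \<times> 'n::finite \<Rightarrow> real. block \<theta> k) \<in> borel_measurable (Pi\<^sub>M (block_index N) (\<lambda>_. lborel))"
proof (cases "k = 0")
  case False
  have "(\<lambda>\<theta>. \<theta> (- int k, i)) \<in> borel_measurable (Pi\<^sub>M (block_index N) (\<lambda>_. lborel))" for i :: 'n
    using measurable_component_singleton[of "(- int k, i)" "block_index N" "\<lambda>_. lborel :: real measure"]
      False assms by (simp add: mem_block_index)
  then have "(\<lambda>\<theta>. (\<chi> i. \<theta> (- int k, i)) :: real ^ 'n) \<in> borel_measurable (Pi\<^sub>M (block_index N) (\<lambda>_. lborel))"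
    by (rule borel_measurable_vec_lambda)
  then show ?thesis using False by (simp add: block_def)
qed (simp add: block_def)

lemma block_merge:
  assumes "k \<le> N"
  shows "block (merge (block_index N) J (x, y)) k = block x k"
  using assms by (auto simp: block_def merge_def vec_eq_iff mem_block_index)

lemma block_merge_Suc:
  "block (merge (block_index N) (range (\<lambda>i. (- int (Suc N), i))) (x, y)) (Suc N) =
    (\<chi> i. y (- int (Suc N), i))"
  by (auto simp: block_def merge_def vec_eq_iff block_index_def)

lemma nonresonant_block_index:
  fixes L :: "real ^ 'n ^ 'n"
  shows "iteratively_nonresonant L \<Longrightarrow> nonresonant (block_index N) (stacked_powers L)"
proof -
  have "finite (block_index N :: (int \<times> 'n) set)" "block_index N \<subseteq> (UNIV - {0}) \<times> (UNIV :: 'n set)"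
    by (auto simp: block_index_def)
  then show "iteratively_nonresonant L \<Longrightarrow> nonresonant (block_index N) (stacked_powers L)"
    unfolding iteratively_nonresonant_def by blast
qed

lemma stacked_powers_inner:
  assumes "1 \<le> k"
  shows "stacked_powers L (- int k, i) \<bullet> v = (matrix_pow (matrix_inv L) k *v v) $ i"
proof -
  have "stacked_powers L (- int k, i) = row i (matrix_pow (matrix_inv L) k)"
    using assms by (simp add: stacked_powers_def matrix_powi_def)
  then show ?thesis by (simp only: row_def vec_lambda_eta matrix_vector_mul_component)
qed

lemma matrix_inv_mult_right:
  fixes L :: "real ^ 'n ^ 'n"
  assumes "det L \<noteq> 0"
  shows "L ** matrix_inv L = mat 1"
  using assms unfolding matrix_inv_def invertible_det_nz[symmetric] invertible_def
  by (rule someI2_ex) simp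

text \<open>The splitting into integer and fractional part that provides the backward orbit; at
  \<open>k = 0\<close> the fractional part vanishes because \<open>x\<close> is integral.\<close>

lemma block_torus_point:
  assumes "k \<le> N"
  shows "real_vec (vfloor (matrix_pow (matrix_inv L) k *v real_vec x)) +
    block (torus_point (block_index N) (stacked_powers L) x) k = matrix_pow (matrix_inv L) k *v real_vec x"
proof (cases "k = 0")
  case True
  have "vfloor (real_vec x) = x" by (simp add: vfloor_def real_vec_def vec_eq_iff)
  then show ?thesis using True by (simp add: block_def matrix_pow_def)
next
  case False
  then show ?thesis using assms
    by (simp add: vec_eq_iff block_def torus_point_def mem_block_index stacked_powers_inner
        vfloor_def real_vec_def frac_def)
qed

lemma preimage_count_torus_point:
  fixes L :: "real ^ 'n ^ 'n"
  assumes R: "quantizer R" and L: "det L \<noteq> 0"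
  shows "preimage_count (quantized_map R L) N x =
    card (fiber R L (block (torus_point (block_index N) (stacked_powers L) x)) N)"
proof -
  let ?M = "matrix_pow (matrix_inv L)"
  let ?t = "block (torus_point (block_index N) (stacked_powers L) x)"
  define y where "y k = vfloor (?M k *v real_vec x)" for k
  have "L *v (real_vec (y (Suc k)) + ?t (Suc k)) = real_vec (y k) + ?t k" if "k < N" for k
  proof -
    have "?M (Suc k) = matrix_inv L ** ?M k" by (simp add: matrix_pow_def)
    then have "L *v (?M (Suc k) *v real_vec x) = ?M k *v real_vec x"
      by (simp add: matrix_vector_mul_assoc matrix_mul_assoc matrix_inv_mult_right[OF L])
    then show ?thesis using that by (simp add: y_def block_torus_point)
  qed
  then have "preimage_count (quantized_map R L) N (y 0) = card (fiber R L ?t N)"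
    by (intro preimage_count_eq_card_fiber quantizer_equivariant[OF R])
  moreover have "y 0 = x" by (simp add: y_def matrix_pow_def vfloor_def real_vec_def vec_eq_iff)
  ultimately show ?thesis by simp
qed

text \<open>A point of the half-open cube is the only representative of its class modulo 1, so the
  integers \<open>z i\<close> must be the floors.\<close>

lemma mem_quasiperiodic_set:
  assumes "G \<subseteq> I \<rightarrow>\<^sub>E {0..<1}"
  shows "x \<in> quasiperiodic_set I G \<Lambda> \<longleftrightarrow> torus_point I \<Lambda> x \<in> G"
proof
  assume "x \<in> quasiperiodic_set I G \<Lambda>"
  then obtain g z where g: "g \<in> G" "\<And>i. i \<in> I \<Longrightarrow> \<Lambda> i \<bullet> real_vec x = g i + real_of_int (z i)"
    unfolding quasiperiodic_set_def by blast
  have "torus_point I \<Lambda> x = g"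
  proof (rule PiE_ext[OF torus_point_in])
    show "g \<in> I \<rightarrow>\<^sub>E {0..<1}" using g(1) assms by blast
    fix i assume i: "i \<in> I"
    have "g i \<in> {0..<1}" using PiE_mem[OF subsetD[OF assms g(1)] i] .
    then have "frac (g i + real_of_int (z i)) = g i"
      by (simp add: frac_unique_iff)
    then show "torus_point I \<Lambda> x i = g i" using g(2)[OF i] i by (simp add: torus_point_def)
  qed
  then show "torus_point I \<Lambda> x \<in> G" using g(1) by simp
next
  assume "torus_point I \<Lambda> x \<in> G"
  then show "x \<in> quasiperiodic_set I G \<Lambda>"
    unfolding quasiperiodic_set_def
    by (intro CollectI bexI[of _ "torus_point I \<Lambda> x"] exI[of _ "\<lambda>i. \<lfloor>\<Lambda> i \<bullet> real_vec x\<rfloor>"])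
      (simp add: torus_point_def frac_def)
qed

subsection \<open>Almost every point avoids the quantizer boundary\<close>

text \<open>The exceptional set is a smooth image of a null set, hence negligible. Its Borel
  measurability is shown separately to obtain a null set of \<open>lborel\<close> and not just of
  its completion.\<close>

lemma AE_affine_notin_null:
  fixes L :: "real ^ 'n ^ 'n"
  assumes D: "D \<in> null_sets lborel" and L: "det L \<noteq> 0"
  shows "AE v in lborel. L *v (a - v) + c \<notin> D"
proof -
  obtain B where B: "B ** L = mat 1" "L ** B = mat 1"
    using L unfolding invertible_det_nz[symmetric] invertible_def by blast
  have "{v. L *v (a - v) + c \<in> D} = (\<lambda>u. a - B *v (u - c)) ` D"
  proof (intro set_eqI iffI)
    fix v assume "v \<in> {v. L *v (a - v) + c \<in> D}"
    moreover have "v = a - B *v (L *v (a - v) + c - c)"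
      by (simp add: matrix_vector_mul_assoc B)
    ultimately show "v \<in> (\<lambda>u. a - B *v (u - c)) ` D" by blast
  next
    fix v assume "v \<in> (\<lambda>u. a - B *v (u - c)) ` D"
    then show "v \<in> {v. L *v (a - v) + c \<in> D}"
      by (auto simp: matrix_vector_mul_assoc B)
  qed
  moreover have "negligible ((\<lambda>u. a - B *v (u - c)) ` D)"
  proof (rule negligible_differentiable_image_negligible)
    show "negligible D" using D by (simp add: negligible_iff_null_sets null_sets_completionI)
    show "(\<lambda>u. a - B *v (u - c)) differentiable_on D"
      unfolding differentiable_on_def differentiable_def
      by (intro ballI exI[of _ "\<lambda>h. 0 - B *v (h - 0)"] has_derivative_diff has_derivative_const
          has_derivative_ident bounded_linear.has_derivative[OF matrix_vector_mul_bounded_linear])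
  qed simp
  moreover have "{v. L *v (a - v) + c \<in> D} \<in> sets borel"
  proof -
    have "continuous_on UNIV (\<lambda>v. L *v (a - v) + c)"
      by (intro continuous_intros continuous_on_compose2[OF linear_continuous_on[OF
            matrix_vector_mul_bounded_linear[of L]], of UNIV]) auto
    then have "(\<lambda>v. L *v (a - v) + c) -` D \<inter> space borel \<in> sets borel"
      using D by (intro measurable_sets[OF borel_measurable_continuous_onI]) auto
    then show ?thesis by (simp add: vimage_def)
  qed
  ultimately have "{v. L *v (a - v) + c \<in> D} \<in> null_sets lborel"
    by (auto simp: negligible_iff_null_sets null_sets_def)
  from AE_not_in[OF this] show ?thesis by simp
qed

text \<open>Induction over the blocks. With the earlier blocks fixed, the last block enters only the
  step \<open>k = N\<close>, through an invertible affine map, and the shifts \<open>j\<close> are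
  countably many.\<close>

lemma AE_block_notin_null:
  fixes L :: "real ^ 'n ^ 'n"
  assumes D: "D \<in> null_sets lborel" and L: "det L \<noteq> 0"
  shows "AE \<theta> in Pi\<^sub>M (block_index N) (\<lambda>_. lborel).
    \<forall>k<N. \<forall>j. L *v (real_vec j - block \<theta> (Suc k)) + block \<theta> k \<notin> D"
proof (induction N)
  case (Suc N)
  let ?f = "\<lambda>i :: 'n. (- int (Suc N), i)"
  let ?P = "\<lambda>\<theta>. \<forall>k<Suc N. \<forall>j. L *v (real_vec j - block \<theta> (Suc k)) + block \<theta> k \<notin> D"
  have "AE \<theta> in Pi\<^sub>M (block_index N \<union> range ?f) (\<lambda>_. lborel). ?P \<theta>"
  proof (rule AE_PiM_merge)
    let ?M = "Pi\<^sub>M (block_index N \<union> range ?f) (\<lambda>_. lborel :: real measure)"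
    have lin: "(\<lambda>v. L *v v) \<in> borel_measurable borel"
      by (intro borel_measurable_continuous_onI linear_continuous_on matrix_vector_mul_bounded_linear)
    have "Measurable.pred ?M (\<lambda>\<theta>. L *v (real_vec j - block \<theta> (Suc k)) + block \<theta> k \<notin> D)" if "k < Suc N" for k j
    proof -
      have b: "(\<lambda>\<theta>. block \<theta> k) \<in> borel_measurable ?M" "(\<lambda>\<theta>. block \<theta> (Suc k)) \<in> borel_measurable ?M"
        using measurable_block[of k "Suc N"] measurable_block[of "Suc k" "Suc N"] that
        by (simp_all add: block_index_Suc(1) del: of_nat_Suc)
      have "(\<lambda>\<theta>. L *v (real_vec j - block \<theta> (Suc k))) \<in> borel_measurable ?M"
        by (rule measurable_compose[OF _ lin]) (intro borel_measurable_diff borel_measurable_const b)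
      then have "(\<lambda>\<theta>. L *v (real_vec j - block \<theta> (Suc k)) + block \<theta> k) \<in> borel_measurable ?M"
        by (intro borel_measurable_add b)
      moreover have "D \<in> sets borel" using D by auto
      ultimately show ?thesis by (intro pred_intros_logic pred_sets2)
    qed
    then have "Measurable.pred ?M (\<lambda>\<theta>. \<forall>j. L *v (real_vec j - block \<theta> (Suc k)) + block \<theta> k \<notin> D)" if "k < Suc N" for k
      using that by (intro pred_intros_countable(1))
    then have "Measurable.pred ?M (\<lambda>\<theta>. k < Suc N \<longrightarrow> (\<forall>j. L *v (real_vec j - block \<theta> (Suc k)) + block \<theta> k \<notin> D))" for k
      by (cases "k < Suc N") simp_all
    then show "Measurable.pred ?M ?P"
      by (rule pred_intros_countable(1))
    show "AE x in Pi\<^sub>M (block_index N) (\<lambda>_. lborel). AE y in Pi\<^sub>M (range ?f) (\<lambda>_. lborel).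
        ?P (merge (block_index N) (range ?f) (x, y))"
      using Suc.IH
    proof eventually_elim
      case (elim x)
      let ?J = "Pi\<^sub>M (range ?f) (\<lambda>_. lborel :: real measure)"
      have "AE v in lborel. \<forall>j. L *v (real_vec j - v) + block x N \<notin> D"
        using AE_affine_notin_null[OF D L] by (subst AE_all_countable) auto
      then have "AE v in distr ?J borel (\<lambda>y. \<chi> i. y (?f i)). \<forall>j. L *v (real_vec j - v) + block x N \<notin> D"
        by (subst distr_PiM_block) (auto intro: injI)
      then have "AE y in ?J. \<forall>j. L *v (real_vec j - (\<chi> i. y (?f i))) + block x N \<notin> D"
      proof (rule AE_distrD[rotated])
        have "(\<lambda>y. y (?f i)) \<in> borel_measurable ?J" for i
          using measurable_component_singleton[of "?f i" "range ?f" "\<lambda>_. lborel :: real measure"] by simp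
        then show "(\<lambda>y. \<chi> i. y (?f i)) \<in> borel_measurable ?J"
          by (rule borel_measurable_vec_lambda)
      qed
      then show ?case
      proof eventually_elim
        case (elim y)
        show ?case
        proof (intro allI impI)
          fix k j assume k: "k < Suc N"
          show "L *v (real_vec j - block (merge (block_index N) (range ?f) (x, y)) (Suc k)) +
              block (merge (block_index N) (range ?f) (x, y)) k \<notin> D"
          proof (cases "k = N")
            case True
            then show ?thesis using elim(1) by (simp add: block_merge block_merge_Suc del: of_nat_Suc)
          next
            case False
            then show ?thesis using k \<open>\<forall>k<N. \<forall>j. L *v (real_vec j - block x (Suc k)) + block x k \<notin> D\<close>
              by (simp add: block_merge del: of_nat_Suc)
          qed
        qed
      qed
    qed
  qed (use block_index_Suc(2) in \<open>simp_all del: of_nat_Suc\<close>)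
  then show ?case unfolding block_index_Suc(1) .
qed simp

subsection \<open>The martingale property\<close>

lemma real_card_eq_sum_indicator:
  assumes "finite B" "S \<subseteq> B"
  shows "real (card S) = (\<Sum>j\<in>B. indicator S j)"
proof -
  have "real (card S) = (\<Sum>j\<in>S. indicator S j)" by simp
  also have "\<dots> = (\<Sum>j\<in>B. indicator S j)"
    using assms by (intro sum.mono_neutral_left) auto
  finally show ?thesis .
qed

lemma ennreal_card_eq_nn_integral:
  "finite S \<Longrightarrow> ennreal (real (card S)) = (\<integral>\<^sup>+j. indicator S j \<partial>count_space UNIV)"
  by (simp add: ennreal_of_nat_eq_real_of_nat)

text \<open>On \<open>C\<close> the parameters are bounded, so the cardinality is a sum over a fixed
  finite set of indicators of \<open>unwind\<close> being 0.\<close>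

lemma measurable_card_fiber:
  fixes R :: "real ^ 'n \<Rightarrow> int ^ 'n" and t :: "'a \<Rightarrow> nat \<Rightarrow> real ^ 'n"
  assumes R: "R \<in> borel \<rightarrow>\<^sub>M count_space UNIV"
    and r: "\<And>u. norm (u - real_vec (R u)) \<le> r" and L: "det L \<noteq> 0"
    and t: "\<And>k. k \<le> N \<Longrightarrow> (\<lambda>\<omega>. t \<omega> k) \<in> borel_measurable M"
    and C: "C \<in> sets M" "\<And>\<omega> k. \<omega> \<in> C \<Longrightarrow> k \<le> N \<Longrightarrow> norm (t \<omega> k) \<le> c"
  shows "(\<lambda>\<omega>. indicator C \<omega> * real (card (fiber R L (t \<omega>) N))) \<in> borel_measurable M"
proof -
  obtain B where B: "finite B" "\<And>t. \<forall>k\<le>N. norm (t k) \<le> c \<Longrightarrow> fiber R L t N \<subseteq> B"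
    using fiber_bounded[OF r L, of N c] by blast
  have "(\<lambda>\<omega>. indicator C \<omega> * real (card (fiber R L (t \<omega>) N))) =
      (\<lambda>\<omega>. indicator C \<omega> * (\<Sum>j\<in>B. indicator {0} (unwind R L (t \<omega>) N j)))"
  proof
    fix \<omega>
    show "indicator C \<omega> * real (card (fiber R L (t \<omega>) N)) =
      indicator C \<omega> * (\<Sum>j\<in>B. indicator {0} (unwind R L (t \<omega>) N j))"
    proof (cases "\<omega> \<in> C")
      case True
      then have "fiber R L (t \<omega>) N \<subseteq> B" using B(2) C(2) by blast
      then show ?thesis using real_card_eq_sum_indicator[OF B(1)]
        by (simp add: fiber_def indicator_def)
    qed simp
  qed
  moreover have "(\<lambda>\<omega>. indicator C \<omega> * (\<Sum>j\<in>B. indicator {0} (unwind R L (t \<omega>) N j)) :: real) \<in> borel_measurable M"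
    using C(1) by (intro borel_measurable_times borel_measurable_sum borel_measurable_indicator
        measurable_compose[OF measurable_unwind[OF R t]]) auto
  ultimately show ?thesis by simp
qed

lemma cube_sets: "block_index N \<rightarrow>\<^sub>E {0..<1::real} \<in> sets (Pi\<^sub>M (block_index N :: (int \<times> 'n::finite) set) (\<lambda>_. lborel))"
  by (intro sets_PiM_I_finite) auto

lemma measurable_card_fiber_block:
  fixes R :: "real ^ 'n \<Rightarrow> int ^ 'n"
  assumes "R \<in> borel \<rightarrow>\<^sub>M count_space UNIV"
    and "\<And>u. norm (u - real_vec (R u)) \<le> r" and "det L \<noteq> 0"
  shows "(\<lambda>\<theta>. indicator (block_index N \<rightarrow>\<^sub>E {0..<1}) \<theta> * real (card (fiber R L (block \<theta>) N)))
    \<in> borel_measurable (Pi\<^sub>M (block_index N) (\<lambda>_. lborel))"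
  by (rule measurable_card_fiber[OF assms measurable_block cube_sets norm_block])

text \<open>Integrate out the last block first. For fixed earlier blocks, the longer fiber consists
  of the shifts that one step sends into the shorter fiber, so
  \<open>nn_integral_shifted_fiber\<close> gives its cardinality divided by |det L|. Since
  \<open>G\<close> constrains only the earlier coordinates, it passes through the inner
  integral.\<close>

lemma integral_fiber_Suc:
  fixes R :: "real ^ 'n \<Rightarrow> int ^ 'n"
  assumes R: "R \<in> borel \<rightarrow>\<^sub>M count_space UNIV"
    and equiv: "\<And>u z. R (u + real_vec z) = R u + z"
    and r: "\<And>u. norm (u - real_vec (R u)) \<le> r" and L: "det L \<noteq> 0"
    and G: "G \<in> sets (Pi\<^sub>M (block_index N) (\<lambda>_. lborel))"
  shows "(\<integral>\<theta>. indicator (block_index (Suc N) \<rightarrow>\<^sub>E {0..<1}) \<theta> * real (card (fiber R L (block \<theta>) (Suc N))) *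
        indicator G (restrict \<theta> (block_index N)) \<partial>Pi\<^sub>M (block_index (Suc N)) (\<lambda>_. lborel)) =
    (\<integral>\<theta>. indicator (block_index N \<rightarrow>\<^sub>E {0..<1}) \<theta> * real (card (fiber R L (block \<theta>) N)) *
        indicator G \<theta> \<partial>Pi\<^sub>M (block_index N) (\<lambda>_. lborel)) / \<bar>det L\<bar>"
    (is "(\<integral>\<theta>. ?f \<theta> \<partial>_) = (\<integral>\<theta>. ?g \<theta> \<partial>_) / _")
proof -
  interpret product_sigma_finite "\<lambda>_. lborel :: real measure" by (rule product_sigma_finite_lborel)
  define I where "I = (block_index N :: (int \<times> 'n) set)"
  let ?e = "\<lambda>i :: 'n. (- int (Suc N), i)"
  define J where "J = range ?e"
  have IJ: "block_index (Suc N) = I \<union> J" "I \<inter> J = {}" "finite I" "finite J"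
    unfolding I_def J_def by (rule block_index_Suc(1)) (use block_index_Suc(2) in \<open>simp_all del: of_nat_Suc\<close>)
  have f: "?f \<in> borel_measurable (Pi\<^sub>M (I \<union> J) (\<lambda>_. lborel))"
  proof -
    have "(\<lambda>\<theta>. restrict \<theta> I) \<in> Pi\<^sub>M (I \<union> J) (\<lambda>_. lborel) \<rightarrow>\<^sub>M Pi\<^sub>M I (\<lambda>_. lborel :: real measure)"
      by (rule measurable_restrict_subset) simp
    then have "(\<lambda>\<theta>. indicator G (restrict \<theta> I) :: real) \<in> borel_measurable (Pi\<^sub>M (I \<union> J) (\<lambda>_. lborel))"
      by (rule measurable_compose) (use G in \<open>simp add: I_def\<close>)
    then show ?thesis
      using measurable_card_fiber_block[OF R r L, of "Suc N"] unfolding IJ(1) I_def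
      by (intro borel_measurable_times[of "\<lambda>\<theta>. indicator _ \<theta> * real (card (fiber R L (block \<theta>) (Suc N)))"])
  qed
  have g: "?g \<in> borel_measurable (Pi\<^sub>M I (\<lambda>_. lborel))"
    unfolding I_def
    by (rule borel_measurable_times[OF measurable_card_fiber_block[OF R r L] borel_measurable_indicator[OF G]])
  define vec where "vec y = (\<chi> i. y (?e i))" for y :: "int \<times> 'n \<Rightarrow> real"
  have vec: "vec \<in> borel_measurable (Pi\<^sub>M J (\<lambda>_. lborel))"
  proof -
    have "(\<lambda>y. y (?e i)) \<in> borel_measurable (Pi\<^sub>M J (\<lambda>_. lborel))" for i
      using measurable_component_singleton[of "?e i" J "\<lambda>_. lborel :: real measure"] by (simp add: J_def)
    then show ?thesis unfolding vec_def by (rule borel_measurable_vec_lambda)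
  qed
  have distr_vec: "distr (Pi\<^sub>M J (\<lambda>_. lborel)) borel vec = lborel"
    unfolding J_def vec_def by (rule distr_PiM_block) (auto intro: injI)
  have inner: "(\<integral>\<^sup>+y. ennreal (?f (merge I J (x, y))) \<partial>Pi\<^sub>M J (\<lambda>_. lborel)) = ennreal (?g x / \<bar>det L\<bar>)"
    if x: "x \<in> space (Pi\<^sub>M I (\<lambda>_. lborel))" for x
  proof -
    \<comment> \<open>The inner integral lets the last block run over vectors \<open>v\<close>, with
      the earlier blocks frozen at \<open>x\<close>.\<close>
    define t where "t v k = (if k = Suc N then v else block x k)" for v k
    have fib: "fiber R L (block (merge I J (x, y))) (Suc N) = fiber R L (t (vec y)) (Suc N)" for y
      by (rule fiber_cong)
        (auto simp: t_def vec_def I_def J_def block_merge block_merge_Suc le_Suc_eq simp del: of_nat_Suc)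
    have restr: "restrict (merge I J (x, y)) I = x" for y
      using x IJ(2) by (simp add: space_PiM PiE_def extensional_restrict)
    have cube: "merge I J (x, y) \<in> I \<union> J \<rightarrow>\<^sub>E {0..<1} \<longleftrightarrow> x \<in> I \<rightarrow>\<^sub>E {0..<1} \<and> vec y \<in> unit_cube" for y
    proof
      assume *: "merge I J (x, y) \<in> I \<union> J \<rightarrow>\<^sub>E {0..<1}"
      have "x i \<in> {0..<1}" if "i \<in> I" for i
        using PiE_mem[OF *, of i] that by (simp add: merge_def)
      moreover have "y i \<in> {0..<1}" if "i \<in> J" for i
      proof -
        have "i \<notin> I" using that IJ(2) by blast
        then show ?thesis using PiE_mem[OF *, of i] that by (simp add: merge_def)
      qed
      ultimately show "x \<in> I \<rightarrow>\<^sub>E {0..<1} \<and> vec y \<in> unit_cube"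
        using x by (auto simp: unit_cube_def vec_def J_def space_PiM PiE_iff)
    next
      assume *: "x \<in> I \<rightarrow>\<^sub>E {0..<1} \<and> vec y \<in> unit_cube"
      then have "y i \<in> {0..<1}" if "i \<in> J" for i
        using that by (auto simp: unit_cube_def vec_def J_def)
      then show "merge I J (x, y) \<in> I \<union> J \<rightarrow>\<^sub>E {0..<1}"
        using * by (auto simp: merge_def PiE_iff extensional_def)
    qed
    show ?thesis
    proof (cases "x \<in> I \<rightarrow>\<^sub>E {0..<1} \<and> x \<in> G")
      case False
      then have 0: "?f (merge I J (x, y)) = 0" "?g x = 0" for y
        unfolding IJ(1) I_def[symmetric] restr using cube by (auto simp: indicator_def)
      show ?thesis unfolding 0 by simp
    next
      case True
      let ?S = "fiber R L (block x) N"
      have tx: "norm (block x k) \<le> real CARD('n)" if "k \<le> N" for k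
        using norm_block[of x N k] True that by (simp add: I_def)
      obtain B where B: "finite B" "\<And>t. \<forall>k\<le>Suc N. norm (t k) \<le> real CARD('n) \<Longrightarrow> fiber R L t (Suc N) \<subseteq> B"
        using fiber_bounded[OF r L, of "Suc N" "real CARD('n)"] by blast
      obtain B' where B': "finite B'" "\<And>t. \<forall>k\<le>N. norm (t k) \<le> real CARD('n) \<Longrightarrow> fiber R L t N \<subseteq> B'"
        using fiber_bounded[OF r L, of N "real CARD('n)"] by blast
      have S: "finite ?S" using B'(2)[of "block x"] tx finite_subset[OF _ B'(1)] by blast
      have fin: "finite (fiber R L (t v) (Suc N))" if "v \<in> unit_cube" for v
        using B(2)[of "t v"] tx norm_unit_cube[OF that] finite_subset[OF _ B(1)] by (auto simp: t_def)
      have m: "(\<lambda>v. indicator unit_cube v * real (card (fiber R L (t v) (Suc N)))) \<in> borel_measurable borel"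
        by (rule measurable_card_fiber[OF R r L, where c = "real CARD('n)"])
          (use tx norm_unit_cube in \<open>auto simp: t_def\<close>)
      have "(\<integral>\<^sup>+y. ennreal (?f (merge I J (x, y))) \<partial>Pi\<^sub>M J (\<lambda>_. lborel)) =
          (\<integral>\<^sup>+y. ennreal (indicator unit_cube (vec y) * real (card (fiber R L (t (vec y)) (Suc N)))) \<partial>Pi\<^sub>M J (\<lambda>_. lborel))"
        unfolding IJ(1) I_def[symmetric] restr fib using cube True by (simp add: indicator_def)
      also have "\<dots> = (\<integral>\<^sup>+v. ennreal (indicator unit_cube v * real (card (fiber R L (t v) (Suc N)))) \<partial>distr (Pi\<^sub>M J (\<lambda>_. lborel)) borel vec)"
        by (rule nn_integral_distr[symmetric, OF vec]) (use m in simp)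
      also have "\<dots> = (\<integral>\<^sup>+v. indicator unit_cube v *
          (\<integral>\<^sup>+j. indicator {j. R (L *v (real_vec j - v) + block x N) \<in> ?S} j \<partial>count_space UNIV) \<partial>lborel)"
        unfolding distr_vec
      proof (rule nn_integral_cong)
        fix v :: "real ^ 'n"
        have "fiber R L (t v) (Suc N) = {j. R (L *v (real_vec j - v) + block x N) \<in> ?S}"
          using unwind_cong[of N "t v" "block x" R L] by (simp add: fiber_def t_def)
        then show "ennreal (indicator unit_cube v * real (card (fiber R L (t v) (Suc N)))) =
          indicator unit_cube v * (\<integral>\<^sup>+j. indicator {j. R (L *v (real_vec j - v) + block x N) \<in> ?S} j \<partial>count_space UNIV)"
          using fin[of v] ennreal_card_eq_nn_integral[of "fiber R L (t v) (Suc N)"]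
          by (cases "v \<in> unit_cube") simp_all
      qed
      also have "\<dots> = ennreal (card ?S / \<bar>det L\<bar>)"
        by (rule nn_integral_shifted_fiber[OF R equiv r L S])
      also have "real (card ?S) = ?g x" using True by (simp add: I_def)
      finally show ?thesis .
    qed
  qed
  have "(\<integral>\<theta>. ?f \<theta> \<partial>Pi\<^sub>M (I \<union> J) (\<lambda>_. lborel)) = enn2real (\<integral>\<^sup>+\<theta>. ennreal (?f \<theta>) \<partial>Pi\<^sub>M (I \<union> J) (\<lambda>_. lborel))"
    by (rule integral_eq_nn_integral) (use f in auto)
  also have "(\<integral>\<^sup>+\<theta>. ennreal (?f \<theta>) \<partial>Pi\<^sub>M (I \<union> J) (\<lambda>_. lborel)) =
      (\<integral>\<^sup>+x. \<integral>\<^sup>+y. ennreal (?f (merge I J (x, y))) \<partial>Pi\<^sub>M J (\<lambda>_. lborel) \<partial>Pi\<^sub>M I (\<lambda>_. lborel))"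
    by (rule product_nn_integral_fold[OF IJ(2-4)]) (use f in simp)
  also have "\<dots> = (\<integral>\<^sup>+x. ennreal (?g x / \<bar>det L\<bar>) \<partial>Pi\<^sub>M I (\<lambda>_. lborel))"
    by (rule nn_integral_cong) (rule inner)
  also have "enn2real \<dots> = (\<integral>x. ?g x / \<bar>det L\<bar> \<partial>Pi\<^sub>M I (\<lambda>_. lborel))"
    by (rule integral_eq_nn_integral[symmetric]) (use g in auto)
  also have "\<dots> = (\<integral>x. ?g x \<partial>Pi\<^sub>M I (\<lambda>_. lborel)) / \<bar>det L\<bar>"
    by (rule integral_divide_zero)
  finally show ?thesis unfolding IJ(1) I_def .
qed

lemma unwind_eqI:
  assumes "\<And>u. u \<notin> D \<Longrightarrow> R u = R' u"
    and "\<And>k j. k < N \<Longrightarrow> L *v (real_vec j - t (Suc k)) + t k \<notin> D"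
  shows "unwind R L t N j = unwind R' L t N j"
  using assms(2) by (induction N arbitrary: j) (auto simp: assms(1))

text \<open>Separate levels \<open>M\<close> and \<open>N\<close> allow the same set, described by
  \<open>M\<close> blocks, to be tested against both counts in the martingale identity. The
  integrand of \<open>?I\<close> is the measurable companion of the function being averaged.\<close>

lemma has_average_preimage_count:
  fixes R :: "real ^ 'n \<Rightarrow> int ^ 'n" and L :: "real ^ 'n ^ 'n"
  assumes R: "quantizer R" and L: "det L \<noteq> 0" and res: "iteratively_nonresonant L"
    and MN: "M \<le> N" and G: "G \<subseteq> block_index M \<rightarrow>\<^sub>E {0..<1}" "jordan_measurable_on (block_index M) G"
  shows "has_average (\<lambda>x. real (preimage_count (quantized_map R L) N x) *
      indicator (quasiperiodic_set (block_index M) G (stacked_powers L)) x)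
    (\<integral>\<theta>. indicator (block_index N \<rightarrow>\<^sub>E {0..<1}) \<theta> * real (card (fiber (borel_quantizer R) L (block \<theta>) N)) *
      indicator (product_topology (\<lambda>_. euclideanreal) (block_index M) interior_of G) (restrict \<theta> (block_index M))
      \<partial>Pi\<^sub>M (block_index N) (\<lambda>_. lborel))" (is "has_average ?a ?I")
    and "\<exists>b. \<forall>x. real (preimage_count (quantized_map R L) N x) \<le> b"
proof -
  let ?X = "product_topology (\<lambda>_. euclideanreal) (block_index M)"
  let ?CM = "block_index M \<rightarrow>\<^sub>E {0..<1::real} :: (int \<times> 'n \<Rightarrow> real) set"
  let ?CN = "block_index N \<rightarrow>\<^sub>E {0..<1::real} :: (int \<times> 'n \<Rightarrow> real) set"
  let ?PN = "Pi\<^sub>M (block_index N :: (int \<times> 'n) set) (\<lambda>_. lborel :: real measure)"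
  let ?r = "\<lambda>\<theta> :: int \<times> 'n \<Rightarrow> real. restrict \<theta> (block_index M)"
  let ?R' = "borel_quantizer R" and ?D = "quantizer_boundary R"
  let ?p = "\<lambda>N. torus_point (block_index N) (stacked_powers L)"
  let ?c = "real CARD('n)"
  define F where "F \<theta> = real (card (fiber R L (block \<theta>) N)) * indicator G (?r \<theta>)" for \<theta>
  define H where "H \<theta> = indicator ?CN \<theta> * real (card (fiber ?R' L (block \<theta>) N)) *
    indicator (?X interior_of G) (?r \<theta>)" for \<theta>
  obtain r where r: "\<And>u. norm (u - real_vec (R u)) \<le> r" using quantizer_bounded[OF R] by blast
  obtain r' where r': "\<And>u. norm (u - real_vec (?R' u)) \<le> r'" using borel_quantizer_bounded[OF R] by blast
  obtain B where B: "finite B" "\<And>t. \<forall>k\<le>N. norm (t k) \<le> ?c \<Longrightarrow> fiber R L t N \<subseteq> B"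
    using fiber_bounded[OF r L, of N ?c] by blast
  have card_le: "card (fiber R L (block \<theta>) N) \<le> card B" if "\<theta> \<in> ?CN" for \<theta>
    using B norm_block[OF that] by (intro card_mono) auto
  show "\<exists>b. \<forall>x. real (preimage_count (quantized_map R L) N x) \<le> b"
    unfolding preimage_count_torus_point[OF R L]
    by (rule exI[of _ "real (card B)"]) (simp add: card_le torus_point_in)
  have restr: "?r \<theta> \<in> ?CM" if "\<theta> \<in> ?CN" for \<theta>
    using that block_index_mono[OF MN] by (auto simp: PiE_iff)
  have restr_M: "?r \<in> ?PN \<rightarrow>\<^sub>M Pi\<^sub>M (block_index M) (\<lambda>_. lborel)"
    by (rule measurable_restrict_subset[OF block_index_mono[OF MN]])
  have F_eq: "F (?p N x) = ?a x" for x
  proof -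
    have "?r (?p N x) = ?p M x"
      using block_index_mono[OF MN] by (auto simp: torus_point_def fun_eq_iff restrict_def)
    then show ?thesis
      by (simp add: F_def preimage_count_torus_point[OF R L] mem_quasiperiodic_set[OF G(1)] indicator_def)
  qed
  have H: "H \<in> borel_measurable ?PN"
    unfolding H_def
  proof (rule borel_measurable_times[OF measurable_card_fiber_block[OF measurable_borel_quantizer[OF R] r' L]])
    have "?X interior_of G \<in> sets (Pi\<^sub>M (block_index M) (\<lambda>_. lborel))"
      by (rule openin_product_euclidean_sets) simp
    then show "(\<lambda>\<theta>. indicator (?X interior_of G) (?r \<theta>) :: real) \<in> borel_measurable ?PN"
      by (intro measurable_compose[OF restr_M] borel_measurable_indicator)
  qed
  have frontier: "AE \<theta> in ?PN. ?r \<theta> \<notin> ?X frontier_of G"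
  proof -
    have fr: "?X frontier_of G \<in> null_sets (Pi\<^sub>M (block_index M) (\<lambda>_. lborel))"
      using G(2) by (simp add: jordan_measurable_on_def)
    have N_eq: "block_index N = block_index M \<union> (block_index N - block_index M :: (int \<times> 'n) set)"
      using block_index_mono[OF MN] by auto
    have "AE \<theta> in Pi\<^sub>M (block_index M \<union> (block_index N - block_index M)) (\<lambda>_. lborel). ?r \<theta> \<notin> ?X frontier_of G"
    proof (rule AE_PiM_restrict)
      have "?X frontier_of G \<in> sets (Pi\<^sub>M (block_index M) (\<lambda>_. lborel))" using fr by auto
      then show "Measurable.pred (Pi\<^sub>M (block_index M) (\<lambda>_. lborel)) (\<lambda>x. x \<notin> ?X frontier_of G)"
        by (intro pred_intros_logic pred_sets2[where N = "Pi\<^sub>M (block_index M) (\<lambda>_. lborel)"]) simp_all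
    qed (use AE_not_in[OF fr] in auto)
    then show ?thesis using N_eq by metis
  qed
  have "AE \<theta> in ?PN. \<theta> \<in> ?CN \<longrightarrow> F \<theta> = H \<theta> \<and>
      (\<forall>e>0. \<exists>d>0. \<forall>\<phi>\<in>?CN. (\<forall>i\<in>block_index N. \<bar>\<phi> i - \<theta> i\<bar> < d) \<longrightarrow> \<bar>F \<phi> - F \<theta>\<bar> < e)"
    using AE_block_notin_null[OF quantizer_boundary_null[OF R] L] frontier
  proof eventually_elim
    case (elim \<theta>)
    show ?case
    proof
      assume \<theta>: "\<theta> \<in> ?CN"
      have rX: "?r \<phi> \<in> topspace ?X" for \<phi> by simp
      \<comment> \<open>Off the frontier, membership in \<open>G\<close> and in its interior
        coincide.\<close>
      have G_eq: "?r \<theta> \<in> G \<longleftrightarrow> ?r \<theta> \<in> ?X interior_of G"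
        using elim(2) rX closure_of_subset[of G ?X] interior_of_subset[of ?X G] G(1)
        by (auto simp: frontier_of_def PiE_iff)
      have "fiber R L (block \<theta>) N = fiber ?R' L (block \<theta>) N"
        unfolding fiber_def
        using unwind_eqI[of ?D R ?R' N L "block \<theta>"] elim(1) by (auto simp: borel_quantizer_def)
      then have FH: "F \<theta> = H \<theta>" using \<theta> by (simp add: F_def H_def G_eq indicator_def)
      obtain d1 where d1: "d1 > 0" "\<And>t'. \<forall>k\<le>N. norm (t' k) \<le> ?c \<and> dist (t' k) (block \<theta> k) < d1 \<Longrightarrow>
          fiber R L t' N = fiber R L (block \<theta>) N"
      proof -
        have "\<exists>d>0. \<forall>t'. (\<forall>k\<le>N. norm (t' k) \<le> ?c \<and> dist (t' k) (block \<theta> k) < d) \<longrightarrow>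
            fiber R L t' N = fiber R L (block \<theta>) N"
          by (rule fiber_locally_constant[where D = ?D, OF _ r L])
            (use quantizer_locally_constant[OF R] elim(1) norm_block[OF \<theta>] in auto)
        then show ?thesis using that by blast
      qed
      obtain d2 where d2: "d2 > 0" "\<And>\<phi>. \<phi> \<in> block_index M \<rightarrow>\<^sub>E UNIV \<Longrightarrow>
          \<forall>i\<in>block_index M. \<bar>\<phi> i - \<theta> i\<bar> < d2 \<Longrightarrow> \<phi> \<in> G \<longleftrightarrow> ?r \<theta> \<in> G"
      proof (cases "?r \<theta> \<in> G")
        case True
        then show ?thesis
          using openin_product_euclidean_box[of "block_index M" "?X interior_of G" "?r \<theta>"]
            G_eq interior_of_subset[of ?X G] that by (simp, metis subsetD)
      next
        case False
        \<comment> \<open>A point outside \<open>G\<close> and off its frontier lies in the open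
          complement of the closure.\<close>
        let ?U = "topspace ?X - ?X closure_of G"
        have "?r \<theta> \<notin> ?X closure_of G" using False elim(2) G_eq by (simp add: frontier_of_def)
        then have "?r \<theta> \<in> ?U" using rX by blast
        moreover have "openin ?X ?U" by (intro openin_diff openin_topspace closedin_closure_of)
        ultimately obtain d where "d > 0" "\<forall>\<phi>\<in>block_index M \<rightarrow>\<^sub>E UNIV. (\<forall>i\<in>block_index M. \<bar>\<phi> i - ?r \<theta> i\<bar> < d) \<longrightarrow> \<phi> \<in> ?U"
          using openin_product_euclidean_box[of "block_index M" ?U "?r \<theta>"] by auto
        moreover have "G \<subseteq> ?X closure_of G"
          by (rule closure_of_subset) (use G(1) in \<open>auto simp: PiE_iff\<close>)
        ultimately show ?thesis using that[of d] False by auto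
      qed
      \<comment> \<open>A block has \<open>?c\<close> coordinates, so coordinate errors below d1 /
        \<open>?c\<close> keep the sum of their absolute values, hence the distance, below
        \<open>d1\<close>.\<close>
      define d where "d = min d2 (d1 / ?c)"
      have "d > 0" using d1(1) d2(1) by (simp add: d_def)
      moreover have "F \<phi> = F \<theta>" if \<phi>: "\<phi> \<in> ?CN" "\<forall>i\<in>block_index N. \<bar>\<phi> i - \<theta> i\<bar> < d" for \<phi>
      proof -
        have "dist (block \<phi> k) (block \<theta> k) < d1" if "k \<le> N" for k
        proof (cases "k = 0")
          case False
          have "dist (block \<phi> k) (block \<theta> k) \<le> (\<Sum>i\<in>UNIV. \<bar>(block \<phi> k - block \<theta> k) $ i\<bar>)"
            unfolding dist_norm by (rule norm_le_l1_cart)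
          also have "\<dots> < (\<Sum>i\<in>(UNIV :: 'n set). d1 / ?c)"
          proof (rule sum_strict_mono)
            fix i :: 'n
            have "(- int k, i) \<in> block_index N" using that False by (simp add: mem_block_index)
            then have "\<bar>\<phi> (- int k, i) - \<theta> (- int k, i)\<bar> < d1 / ?c" using \<phi>(2) by (auto simp: d_def)
            then show "\<bar>(block \<phi> k - block \<theta> k) $ i\<bar> < d1 / ?c" using False by (simp add: block_def)
          qed auto
          finally show ?thesis by simp
        qed (use d1(1) in \<open>simp add: block_def\<close>)
        then have "fiber R L (block \<phi>) N = fiber R L (block \<theta>) N"
          using norm_block[OF \<phi>(1)] by (intro d1(2)) auto
        moreover have "?r \<phi> \<in> G \<longleftrightarrow> ?r \<theta> \<in> G"
          using \<phi>(2) block_index_mono[OF MN] by (intro d2(2)) (auto simp: d_def)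
        ultimately show ?thesis by (simp add: F_def indicator_def)
      qed
      ultimately show "F \<theta> = H \<theta> \<and>
          (\<forall>e>0. \<exists>d>0. \<forall>\<phi>\<in>?CN. (\<forall>i\<in>block_index N. \<bar>\<phi> i - \<theta> i\<bar> < d) \<longrightarrow> \<bar>F \<phi> - F \<theta>\<bar> < e)"
        using FH by (intro conjI allI impI exI[of _ d] ballI) simp_all
    qed
  qed
  then have "has_average (\<lambda>x. F (?p N x)) (\<integral>\<theta>. indicator ?CN \<theta> * H \<theta> \<partial>?PN)"
  proof (rule has_average_torus_function[OF finite_block_index nonresonant_block_index[OF res] _ H, rotated])
    show "\<bar>F \<theta>\<bar> \<le> real (card B)" if "\<theta> \<in> ?CN" for \<theta>
      using card_le[OF that] by (auto simp: F_def indicator_def)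
  qed
  moreover have "(\<integral>\<theta>. indicator ?CN \<theta> * H \<theta> \<partial>?PN) = ?I"
    by (rule Bochner_Integration.integral_cong) (auto simp: H_def indicator_def)
  ultimately show "has_average ?a ?I" unfolding F_eq by simp
qed

theorem theorem14:
  fixes R :: "real ^ 'n \<Rightarrow> int ^ 'n"
    and L :: "real ^ 'n ^ 'n"
    and T :: "int ^ 'n \<Rightarrow> int ^ 'n"
    and \<nu>' :: "nat \<Rightarrow> int ^ 'n \<Rightarrow> real"
  assumes "quantizer R"
    and "det L \<noteq> 0"
    and "iteratively_nonresonant L"
    and "T = quantized_map R L"
    and "\<nu>' = (\<lambda>N x. \<bar>det L\<bar> ^ N * real (preimage_count T N x))"
  shows "\<forall>N\<ge>1. \<forall>A\<in>backward_algebra L N.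
    averageable (\<lambda>x. \<nu>' (N + 1) x * indicator A x) \<and>
    averageable (\<lambda>x. \<nu>' N x * indicator A x) \<and>
    average (\<lambda>x. \<nu>' (N + 1) x * indicator A x) = average (\<lambda>x. \<nu>' N x * indicator A x)"
proof (intro allI impI ballI)
  fix N :: nat and A
  assume "A \<in> backward_algebra L N"
  then obtain G where G: "G \<subseteq> block_index N \<rightarrow>\<^sub>E {0..<1}" "jordan_measurable_on (block_index N) G"
    and A: "A = quasiperiodic_set (block_index N) G (stacked_powers L)"
    by (auto simp: backward_algebra_def quasiperiodic_algebra_def block_index_def)
  let ?G = "product_topology (\<lambda>_. euclideanreal) (block_index N) interior_of G"
  \<comment> \<open>\<open>K\<close> varies while \<open>G\<close> stays on the first
    \<open>N\<close> blocks; comparing \<open>K = N\<close> with \<open>K = Suc N\<close>, the extra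
    factor |det L| cancels the quotient from \<open>integral_fiber_Suc\<close>.\<close>
  define V where "V K = (\<integral>\<theta>. indicator (block_index K \<rightarrow>\<^sub>E {0..<1}) \<theta> *
      real (card (fiber (borel_quantizer R) L (block \<theta>) K)) *
      indicator ?G (restrict \<theta> (block_index N)) \<partial>Pi\<^sub>M (block_index K) (\<lambda>_. lborel))" for K
  have avg: "averageable (\<lambda>x. \<nu>' K x * indicator A x) \<and>
      average (\<lambda>x. \<nu>' K x * indicator A x) = \<bar>det L\<bar> ^ K * V K" if "N \<le> K" for K
  proof -
    note * = has_average_preimage_count[OF assms(1-3) that G]
    obtain b where b: "\<And>x. real (preimage_count (quantized_map R L) K x) \<le> b" using *(2) by blast
    have eq: "(\<lambda>x. \<nu>' K x * indicator A x) = (\<lambda>x. \<bar>det L\<bar> ^ K *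
        (real (preimage_count (quantized_map R L) K x) * indicator A x))"
      by (simp add: assms(4,5) mult.assoc)
    have "has_average (\<lambda>x. \<nu>' K x * indicator A x) (\<bar>det L\<bar> ^ K * V K)"
      unfolding eq unfolding A V_def by (rule has_average_mult_left[OF *(1)])
    moreover have "\<bar>\<nu>' K x * indicator A x\<bar> \<le> \<bar>det L\<bar> ^ K * b" for x
      using b[of x] order_trans[OF of_nat_0_le_iff b[of x]] unfolding assms(4,5)
      by (auto simp: indicator_def intro: mult_left_mono)
    ultimately show ?thesis using has_average_imp_average by blast
  qed
  obtain r where r: "\<And>u. norm (u - real_vec (borel_quantizer R u)) \<le> r"
    using borel_quantizer_bounded[OF assms(1)] by blast
  have "V (Suc N) = (\<integral>\<theta>. indicator (block_index N \<rightarrow>\<^sub>E {0..<1}) \<theta> *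
      real (card (fiber (borel_quantizer R) L (block \<theta>) N)) * indicator ?G \<theta>
      \<partial>Pi\<^sub>M (block_index N) (\<lambda>_. lborel)) / \<bar>det L\<bar>"
    unfolding V_def
    by (rule integral_fiber_Suc[OF measurable_borel_quantizer[OF assms(1)]
          borel_quantizer_equivariant[OF assms(1)] r assms(2)])
      (rule openin_product_euclidean_sets, simp)
  \<comment> \<open>Points of the product space are extensional, so restricting them to their own
    index set changes nothing.\<close>
  also have "(\<integral>\<theta>. indicator (block_index N \<rightarrow>\<^sub>E {0..<1}) \<theta> *
      real (card (fiber (borel_quantizer R) L (block \<theta>) N)) * indicator ?G \<theta>
      \<partial>Pi\<^sub>M (block_index N) (\<lambda>_. lborel)) = V N"
    unfolding V_def
    by (rule Bochner_Integration.integral_cong)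
      (auto simp: space_PiM PiE_def extensional_restrict)
  finally have "V (Suc N) = V N / \<bar>det L\<bar>" .
  then show "averageable (\<lambda>x. \<nu>' (N + 1) x * indicator A x) \<and>
    averageable (\<lambda>x. \<nu>' N x * indicator A x) \<and>
    average (\<lambda>x. \<nu>' (N + 1) x * indicator A x) = average (\<lambda>x. \<nu>' N x * indicator A x)"
    using avg[of N] avg[of "Suc N"] assms(2) by simp
qed

end
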